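(* Let $\mathfrak{h}$ be a vector space over $\mathbb{C}$ equipped with a nondegenerate bilinear form $(\cdot,\cdot)$. Let $V=T(\hat{\mathfrak{h}}_{-})$, with the $\mathbb{Z}$-grading, the element $\mathbf{1}=1\in T(\hat{\mathfrak{h}}_{-})$ and the vertex operator map $Y_{T(\hat{\mathfrak{h}}_{-})}$ described in the context. Then the triple $(T(\hat{\mathfrak{h}}_{-}), Y_{T(\hat{\mathfrak{h}}_{-})}, \mathbf{1})$ is a meromorphic open-string vertex algebra. If $\mathfrak{h}$ is finite dimensional, then $(T(\hat{\mathfrak{h}}_{-}), Y_{T(\hat{\mathfrak{h}}_{-})}, \mathbf{1})$ is a grading-restricted meromorphic open-string vertex algebra.
   Context: All vector spaces are over $\mathbb{C}$; $T(X)$ denotes the tensor algebra of a vector space $X$; $\mathbb{Z}_{+}$ is the set of positive integers. **The algebra $N(\hat{\mathfrak{h}})$.** Let $\hat{\mathfrak{h}}=\mathfrak{h}\otimes\mathbb{C}[t,t^{-1}]\oplus\mathbb{C}\mathbf{k}$ (as a vector space), $\hat{\mathfrak{h}}_{+}=\mathfrak{h}\otimes t\mathbb{C}[t]$, $\hat{\mathfrak{h}}_{-}=\mathfrak{h}\otimes t^{-1}\mathbb{C}[t^{-1}]$, $\hat{\mathfrak{h}}_{0}=\mathfrak{h}\otimes t^{0}\oplus\mathbb{C}\mathbf{k}$, and identify $\mathfrak{h}$ with $\mathfrak{h}\otimes t^{0}$. Let $N(\hat{\mathfrak{h}})=T(\hat{\mathfrak{h}})/I$, where $I$ is the two-sided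 ideal generated by the elements $(a\otimes t^{m})\otimes(b\otimes t^{n})-(b\otimes t^{n})\otimes(a\otimes t^{m})-m(a,b)\delta_{m+n,0}\mathbf{k}$ for $m\in\mathbb{Z}_{+}$, $n\in-\mathbb{Z}_{+}$; $(a\otimes t^{k})\otimes(b\otimes t^{0})-(b\otimes t^{0})\otimes(a\otimes t^{k})$ for $k\in\mathbb{Z}\setminus\{0\}$; and $(a\otimes t^{k})\otimes\mathbf{k}-\mathbf{k}\otimes(a\otimes t^{k})$ for $k\in\mathbb{Z}$; here $a,b\in\mathfrak{h}$. **The module.** Let $M=\mathbb{C}$ be the trivial left $T(\mathfrak{h})$-module ($\mathfrak{h}$ acts by $0$), on which $\mathbf{k}$ acts as $1$ and $\hat{\mathfrak{h}}_{+}$ acts as $0$. It is a left module for the subalgebra $N(\hat{\mathfrak{h}}_{+}\oplus\hat{\mathfrak{h}}_{0})$ of $N(\hat{\mathfrak{h}})$ generated by $\hat{\mathfrak{h}}_{+}$ and $\hat{\mathfrak{h}}_{0}$, and the induced left module $N(\hat{\mathfrak{h}})\otimes_{N(\hat{\mathfrak{h}}_{+}\oplus\hat{\mathfrak{h}}_{0})}\mathbb{C}$ is identified with $T(\hat{\mathfrak{h}}_{-})\otimes\mathbb{C}=T(\hat{\mathfrak{h}}_{-})$ (the elements of $\hat{\mathfrak{h}}_-$ acting by left multiplication). Write $a(n)$ for the operator by which $a\otimes t^{n}$ acts on it. Then $T(\hat{\mathfrak{h}}_{-})$ is spanned by the elements $a_{1}(-m_{1})\cdots a_{k}(-m_{k})\mathbf{1}$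 with $k\ge 0$, $a_i\in\mathfrak{h}$, $m_i\in\mathbb{Z}_{+}$; such an element is given weight $m_{1}+\cdots+m_{k}$, which defines the $\mathbb{Z}$-grading. **Normal ordering.** For a (formal) product of operators, $:a_{1}(n_{1})\cdots a_{k}(n_{k}):\;=a_{\sigma(1)}(n_{\sigma(1)})\cdots a_{\sigma(k)}(n_{\sigma(k)})$, where $\sigma\in S_k$ is the unique permutation for which there are $0\le\alpha\le\beta\le k$ with $\sigma$ increasing on $\{1,\dots,\alpha\}$, on $\{\alpha+1,\dots,\beta\}$ and on $\{\beta+1,\dots,k\}$, and with $n_{\sigma(i)}<0$ for $i\le\alpha$, $n_{\sigma(i)}>0$ for $\alpha<i\le\beta$, $n_{\sigma(i)}=0$ for $i>\beta$. It is extended linearly (coefficientwise) to products of formal series. **Vertex operators.** With $a(x)=\sum_{n\in\mathbb{Z}}a(n)x^{-n-1}$, the linear map $Y_{T(\hat{\mathfrak{h}}_{-})}:T(\hat{\mathfrak{h}}_{-})\to(\mathrm{End}\,T(\hat{\mathfrak{h}}_{-}))[[x,x^{-1}]]$ is given by $$Y_{T(\hat{\mathfrak{h}}_{-})}(a_{1}(-m_{1})\cdots a_{k}(-m_{k})\mathbf{1},x)=\;:\Big(\tfrac{1}{(m_{1}-1)!}\tfrac{d^{m_{1}-1}}{dx^{m_{1}-1}}a_{1}(x)\Big)\cdots\Big(\tfrac{1}{(m_{k}-1)!}\tfrac{d^{m_{k}-1}}{dx^{m_{k}-1}}a_{k}(x)\Big):$$ **Definition.** For a graded space $V=\coprod_n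 V_{(n)}$, $V'=\coprod_n V_{(n)}^{*}$ is the graded dual. A *meromorphic open-string vertex algebra* is a $\mathbb{Z}$-graded vector space $V=\coprod_{n\in\mathbb{Z}}V_{(n)}$ with a linear map $Y_V:V\to(\mathrm{End}\,V)[[x,x^{-1}]]$, $u\mapsto Y_V(u,x)$, and $\mathbf{1}\in V$ such that: 1. (Lower bound) $V_{(n)}=0$ when $n$ is sufficiently negative. 2. (Vacuum) $Y_V(\mathbf{1},x)=1_V$; and for $u\in V$, $Y_V(u,x)\mathbf{1}\in V[[x]]$ and $\lim_{x\to0}Y_V(u,x)\mathbf{1}=u$. 3. (Rationality) For $u_1,\dots,u_n,v\in V$, $v'\in V'$, the series $\langle v',Y_V(u_1,z_1)\cdots Y_V(u_n,z_n)v\rangle$ converges absolutely when $|z_1|>\cdots>|z_n|>0$ to a rational function in $z_1,\dots,z_n$ with only possible poles at $z_i=0$ and $z_i=z_j$ ($i\ne j$). For $u_1,u_2,v\in V$, $v'\in V'$, the series $\langle v',Y_V(Y_V(u_1,z_1-z_2)u_2,z_2)v\rangle$ converges absolutely when $|z_2|>|z_1-z_2|>0$ to a rational function with only possible poles at $z_1=0$, $z_2=0$, $z_1=z_2$. 4. (Associativity) For $u_1,u_2,v\in V$, $v'\in V'$, $\langle v',Y_V(u_1,z_1)Y_V(u_2,z_2)v\rangle=\langle v',Y_V(Y_V(u_1,z_1-z_2)u_2,z_2)v\rangle$ when $|z_1|>|z_2|>|z_1-z_2|>0$. 5. ($\mathbf{d}$-bracket) If $\mathbf{d}_V$ is the grading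 operator ($\mathbf{d}_Vu=mu$ for $u\in V_{(m)}$), then $[\mathbf{d}_V,Y_V(u,x)]=Y_V(\mathbf{d}_Vu,x)+x\frac{d}{dx}Y_V(u,x)$ for $u\in V$. 6. ($D$-derivative and $D$-commutator) If $D_V:V\to V$ is defined by $D_Vu=\lim_{x\to0}\frac{d}{dx}Y_V(u,x)\mathbf{1}$, then $\frac{d}{dx}Y_V(u,x)=Y_V(D_Vu,x)=[D_V,Y_V(u,x)]$ for $u\in V$. It is *grading restricted* if $\dim V_{(n)}<\infty$ for all $n\in\mathbb{Z}$. *)

theory Defs
  imports "HOL-Analysis.Analysis" "HOL-Library.Poly_Mapping" "HOL-Library.Groups_Big_Fun"
begin

section \<open>Complex vector spaces and algebras\<close>

class complex_vector = ab_group_add +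
  fixes scaleC :: "complex \<Rightarrow> 'a \<Rightarrow> 'a" (infixr \<open>*\<^sub>C\<close> 75)
  assumes scaleC_add_right: "a *\<^sub>C (x + y) = a *\<^sub>C x + a *\<^sub>C y"
    and scaleC_add_left: "(a + b) *\<^sub>C x = a *\<^sub>C x + b *\<^sub>C x"
    and scaleC_scaleC: "a *\<^sub>C b *\<^sub>C x = (a * b) *\<^sub>C x"
    and scaleC_one: "1 *\<^sub>C x = x"

global_interpretation cvs: vector_space "scaleC :: complex \<Rightarrow> 'a \<Rightarrow> 'a::complex_vector"
  by unfold_locales (rule scaleC_add_right scaleC_add_left scaleC_scaleC scaleC_one)+

abbreviation clinear :: "('a::complex_vector \<Rightarrow> 'b::complex_vector) \<Rightarrow> bool" where
  "clinear \<equiv> Vector_Spaces.linear scaleC scaleC"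

class complex_algebra_1 = complex_vector + ring_1 +
  assumes mult_scaleC_left: "(a *\<^sub>C x) * y = a *\<^sub>C (x * y)"
    and mult_scaleC_right: "x * (a *\<^sub>C y) = a *\<^sub>C (x * y)"

definition algebra_hom :: "('a::complex_algebra_1 \<Rightarrow> 'b::complex_algebra_1) \<Rightarrow> bool" where
  "algebra_hom g \<longleftrightarrow> clinear g \<and> g 1 = 1 \<and> (\<forall>x y. g (x * y) = g x * g y)"

definition finite_dimensional :: "'a::complex_vector set \<Rightarrow> bool" where
  "finite_dimensional W \<longleftrightarrow> (\<exists>S. finite S \<and> cvs.span S = W)"

definition bilinear_form :: "('a::complex_vector \<Rightarrow> 'a \<Rightarrow> complex) \<Rightarrow> bool" where
  "bilinear_form B \<longleftrightarrow>
     (\<forall>x y z. B (x + y) z = B x z + B y z) \<and> (\<forall>c x z. B (c *\<^sub>C x) z = c * B x z) \<and>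
     (\<forall>x y z. B x (y + z) = B x y + B x z) \<and> (\<forall>c x z. B x (c *\<^sub>C z) = c * B x z)"

definition nondegenerate :: "('a::complex_vector \<Rightarrow> 'a \<Rightarrow> complex) \<Rightarrow> bool" where
  "nondegenerate B \<longleftrightarrow>
     (\<forall>x. (\<forall>y. B x y = 0) \<longrightarrow> x = 0) \<and> (\<forall>y. (\<forall>x. B x y = 0) \<longrightarrow> y = 0)"

instantiation complex :: complex_algebra_1
begin
definition scaleC_complex :: "complex \<Rightarrow> complex \<Rightarrow> complex" where
  "scaleC_complex a x = a * x"
instance by standard (simp_all add: scaleC_complex_def algebra_simps)
end

instantiation prod :: (complex_vector, complex_vector) complex_vector
begin
definition scaleC_prod :: "complex \<Rightarrow> 'a \<times> 'b \<Rightarrow> 'a \<times> 'b" where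
  "scaleC_prod c p = (c *\<^sub>C fst p, c *\<^sub>C snd p)"
instance
  by standard
    (simp_all add: scaleC_prod_def scaleC_add_right scaleC_add_left scaleC_scaleC scaleC_one)
end

instantiation poly_mapping :: (type, complex_vector) complex_vector
begin
lift_definition scaleC_poly_mapping :: "complex \<Rightarrow> ('a \<Rightarrow>\<^sub>0 'b) \<Rightarrow> ('a \<Rightarrow>\<^sub>0 'b)"
  is "\<lambda>c f k. c *\<^sub>C f k"
  by (rule finite_subset[rotated]) auto
instance
  by standard (transfer;
    simp add: scaleC_add_right scaleC_add_left scaleC_scaleC scaleC_one fun_eq_iff)+
end

section \<open>The tensor algebra\<close>

inductive_set ideal_generated :: "'r::ring_1 set \<Rightarrow> 'r set" for G where
  zero: "0 \<in> ideal_generated G"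
| gen: "x \<in> G \<Longrightarrow> x \<in> ideal_generated G"
| add: "x \<in> ideal_generated G \<Longrightarrow> y \<in> ideal_generated G \<Longrightarrow> x + y \<in> ideal_generated G"
| mult_left: "x \<in> ideal_generated G \<Longrightarrow> r * x \<in> ideal_generated G"
| mult_right: "x \<in> ideal_generated G \<Longrightarrow> x * r \<in> ideal_generated G"

inductive_set subalgebra_generated :: "'r::complex_algebra_1 set \<Rightarrow> 'r set" for G where
  one: "1 \<in> subalgebra_generated G"
| gen: "x \<in> G \<Longrightarrow> x \<in> subalgebra_generated G"
| add: "x \<in> subalgebra_generated G \<Longrightarrow> y \<in> subalgebra_generated G \<Longrightarrow>
          x + y \<in> subalgebra_generated G"
| scale: "x \<in> subalgebra_generated G \<Longrightarrow> c *\<^sub>C x \<in> subalgebra_generated G"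
| mult: "x \<in> subalgebra_generated G \<Longrightarrow> y \<in> subalgebra_generated G \<Longrightarrow>
          x * y \<in> subalgebra_generated G"

lemma ideal_generated_diff:
  "x \<in> ideal_generated G \<Longrightarrow> y \<in> ideal_generated G \<Longrightarrow> x - y \<in> ideal_generated G"
  using ideal_generated.add[of x G "(- 1) * y"] ideal_generated.mult_left[of y G "- 1"] by simp

text \<open>Words form the free monoid under concatenation, so that \<open>'a list \<Rightarrow>\<^sub>0 complex\<close> with the
  convolution product of \<^theory>\<open>HOL-Library.Poly_Mapping\<close> is the free associative algebra
  on the set \<open>'a\<close>.\<close>

instantiation list :: (type) monoid_add
begin
definition zero_list :: "'a list" where "zero_list = []"
definition plus_list :: "'a list \<Rightarrow> 'a list \<Rightarrow> 'a list" where "plus_list = append"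
instance by standard (simp_all add: zero_list_def plus_list_def)
end

definition linear_relators :: "('a::complex_vector list \<Rightarrow>\<^sub>0 complex) set" where
  "linear_relators =
     {Poly_Mapping.single [x + y] 1 - Poly_Mapping.single [x] 1 - Poly_Mapping.single [y] 1
        | x y. True}
   \<union> {Poly_Mapping.single [c *\<^sub>C x] 1 - c *\<^sub>C Poly_Mapping.single [x] 1 | c x. True}"

definition tensor_eq ::
    "('a::complex_vector list \<Rightarrow>\<^sub>0 complex) \<Rightarrow> ('a list \<Rightarrow>\<^sub>0 complex) \<Rightarrow> bool" where
  "tensor_eq p q \<longleftrightarrow> p - q \<in> ideal_generated linear_relators"

text \<open>The tensor algebra \<open>T(X)\<close> of the vector space \<open>X = 'a\<close>: the free associative algebra on the
  underlying set of \<open>X\<close>, modulo the relations making the inclusion of \<open>X\<close> linear.\<close>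

quotient_type (overloaded) 'a tensor_algebra = "'a::complex_vector list \<Rightarrow>\<^sub>0 complex" / tensor_eq
proof (rule equivpI)
  show "reflp tensor_eq"
    by (rule reflpI) (simp add: tensor_eq_def ideal_generated.zero)
  show "symp tensor_eq"
    using ideal_generated_diff[OF ideal_generated.zero]
    by (intro sympI) (force simp: tensor_eq_def)
  show "transp tensor_eq"
    using ideal_generated.add by (intro transpI) (force simp: tensor_eq_def)
qed

lemma scaleC_free_algebra:
  "c *\<^sub>C p = Poly_Mapping.single 0 c * (p :: 'a list \<Rightarrow>\<^sub>0 complex)"
  by (rule poly_mapping_eqI)
    (simp add: scaleC_poly_mapping.rep_eq scaleC_complex_def mult_map_scale_conv_mult[symmetric]
      Poly_Mapping.map.rep_eq when_def)

lemma free_algebra_scaleC_right: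
  "p * (c *\<^sub>C q) = c *\<^sub>C (p * q)" for p q :: "'a list \<Rightarrow>\<^sub>0 complex"
proof -
  have update: "Poly_Mapping.update a b f = Poly_Mapping.single a b + f"
    if "a \<notin> Poly_Mapping.keys f" for a b and f :: "'a list \<Rightarrow>\<^sub>0 complex"
    using that by (intro poly_mapping_eqI)
      (auto simp: lookup_add lookup_update lookup_single in_keys_iff)
  have "p * Poly_Mapping.single 0 c = Poly_Mapping.single 0 c * p"
    by (induction p rule: Poly_Mapping.update_induct)
      (simp_all add: update mult_single distrib_left distrib_right mult.commute)
  then show ?thesis
    by (simp add: scaleC_free_algebra flip: mult.assoc)
qed

lemma free_algebra_constant_term:
  "Poly_Mapping.lookup (p * q) [] = Poly_Mapping.lookup p [] * Poly_Mapping.lookup q []"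
  for p q :: "'a list \<Rightarrow>\<^sub>0 complex"
proof -
  have *: "[] = l + m \<longleftrightarrow> l = [] \<and> m = []" for l m :: "'a list"
    by (auto simp: plus_list_def)
  have "Sum_any (\<lambda>m. Poly_Mapping.lookup q m when [] = l + m)
      = (Poly_Mapping.lookup q [] when l = [])" for l
    by (cases "l = []") (simp_all add: *)
  then show ?thesis
    by (simp add: lookup_mult mult_when)
qed

lemma linear_relators_constant_term:
  "p \<in> ideal_generated linear_relators \<Longrightarrow> Poly_Mapping.lookup p [] = 0"
proof (induction rule: ideal_generated.induct)
  case (gen x)
  then show ?case
    by (auto simp: linear_relators_def lookup_minus scaleC_poly_mapping.rep_eq
        scaleC_complex_def lookup_single)
qed (simp_all add: lookup_add free_algebra_constant_term)

instantiation tensor_algebra :: (complex_vector) complex_algebra_1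
begin

lift_definition zero_tensor_algebra :: "'a tensor_algebra" is 0 .
lift_definition one_tensor_algebra :: "'a tensor_algebra" is 1 .

lift_definition plus_tensor_algebra ::
    "'a tensor_algebra \<Rightarrow> 'a tensor_algebra \<Rightarrow> 'a tensor_algebra" is "(+)"
  unfolding tensor_eq_def
  by (metis (no_types, lifting) add_diff_add ideal_generated.add)

lift_definition uminus_tensor_algebra :: "'a tensor_algebra \<Rightarrow> 'a tensor_algebra" is "uminus"
  unfolding tensor_eq_def
  using ideal_generated_diff[OF ideal_generated.zero] by force

lift_definition minus_tensor_algebra ::
    "'a tensor_algebra \<Rightarrow> 'a tensor_algebra \<Rightarrow> 'a tensor_algebra" is "(-)"
proof -
  fix p p' q q' :: "'a list \<Rightarrow>\<^sub>0 complex"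
  assume "tensor_eq p p'" "tensor_eq q q'"
  then have "(p - p') - (q - q') \<in> ideal_generated linear_relators"
    unfolding tensor_eq_def by (rule ideal_generated_diff)
  then show "tensor_eq (p - q) (p' - q')"
    unfolding tensor_eq_def by (simp add: algebra_simps)
qed

lift_definition times_tensor_algebra ::
    "'a tensor_algebra \<Rightarrow> 'a tensor_algebra \<Rightarrow> 'a tensor_algebra" is "(*)"
proof -
  fix p p' q q' :: "'a list \<Rightarrow>\<^sub>0 complex"
  assume "tensor_eq p p'" "tensor_eq q q'"
  then have "(p - p') * q + p' * (q - q') \<in> ideal_generated linear_relators"
    unfolding tensor_eq_def
    by (intro ideal_generated.add ideal_generated.mult_left ideal_generated.mult_right)
  then show "tensor_eq (p * q) (p' * q')"
    unfolding tensor_eq_def by (simp add: algebra_simps)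
qed

lift_definition scaleC_tensor_algebra :: "complex \<Rightarrow> 'a tensor_algebra \<Rightarrow> 'a tensor_algebra"
  is "scaleC"
  unfolding tensor_eq_def
  by (metis cvs.scale_right_diff_distrib ideal_generated.mult_left scaleC_free_algebra)

instance
proof
  fix x y z :: "'a tensor_algebra" and a b :: complex
  show "x + y + z = x + (y + z)" by transfer (simp add: tensor_eq_def ideal_generated.zero add.assoc)
  show "x + y = y + x" by transfer (simp add: tensor_eq_def ideal_generated.zero add.commute)
  show "0 + x = x" by transfer (simp add: tensor_eq_def ideal_generated.zero)
  show "- x + x = 0" by transfer (simp add: tensor_eq_def ideal_generated.zero)
  show "x - y = x + - y" by transfer (simp add: tensor_eq_def ideal_generated.zero)
  show "x * y * z = x * (y * z)"
    by transfer (simp add: tensor_eq_def ideal_generated.zero mult.assoc)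
  show "1 * x = x" by transfer (simp add: tensor_eq_def ideal_generated.zero)
  show "x * 1 = x" by transfer (simp add: tensor_eq_def ideal_generated.zero)
  show "(x + y) * z = x * z + y * z"
    by transfer (simp add: tensor_eq_def ideal_generated.zero distrib_right)
  show "x * (y + z) = x * y + x * z"
    by transfer (simp add: tensor_eq_def ideal_generated.zero distrib_left)
  show "a *\<^sub>C (x + y) = a *\<^sub>C x + a *\<^sub>C y"
    by transfer (simp add: tensor_eq_def ideal_generated.zero scaleC_add_right)
  show "(a + b) *\<^sub>C x = a *\<^sub>C x + b *\<^sub>C x"
    by transfer (simp add: tensor_eq_def ideal_generated.zero scaleC_add_left)
  show "a *\<^sub>C b *\<^sub>C x = (a * b) *\<^sub>C x"
    by transfer (simp add: tensor_eq_def ideal_generated.zero)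
  show "1 *\<^sub>C x = x"
    by transfer (simp add: tensor_eq_def ideal_generated.zero)
  show "(a *\<^sub>C x) * y = a *\<^sub>C (x * y)"
    by transfer (simp add: tensor_eq_def ideal_generated.zero scaleC_free_algebra mult.assoc)
  show "x * (a *\<^sub>C y) = a *\<^sub>C (x * y)"
    by transfer (simp add: tensor_eq_def ideal_generated.zero free_algebra_scaleC_right)
  show "(0 :: 'a tensor_algebra) \<noteq> 1"
    by transfer (auto simp: tensor_eq_def lookup_one zero_list_def
        dest!: linear_relators_constant_term)
qed

end

lift_definition tensor_gen :: "'a::complex_vector \<Rightarrow> 'a tensor_algebra"
  is "\<lambda>x. Poly_Mapping.single [x] 1" .

text \<open>The algebra homomorphism on \<open>T(X)\<close> extending a linear map \<open>f\<close> on \<open>X\<close>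
  (unspecified if \<open>f\<close> is not linear).\<close>

definition tensor_extend ::
    "('a::complex_vector \<Rightarrow> 'b::complex_algebra_1) \<Rightarrow> 'a tensor_algebra \<Rightarrow> 'b" where
  "tensor_extend f = (THE g. algebra_hom g \<and> (\<forall>x. g (tensor_gen x) = f x))"

section \<open>The Heisenberg-type algebra\<close>

text \<open>In the comments, \<open>\<hh>\<close> is the space \<open>'a\<close> with its bilinear form \<open>B\<close>, \<open>H\<close> is its
  affinization with subspaces \<open>H\<^sub>+\<close>, \<open>H\<^sub>0\<close>, \<open>H\<^sub>-\<close>, and \<open>N(H)\<close> is the quotient of \<open>T(H)\<close> by
  the two-sided ideal \<open>I\<close> generated by \<open>heis_relators B\<close>.\<close>

text \<open>Elements of \<open>\<hh> \<otimes> \<complex>[t, t\<^sup>-\<^sup>1]\<close> are finitely supported families of coefficients in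
  \<open>\<hh>\<close>, indexed by the exponent of \<open>t\<close>.\<close>

type_synonym 'a affinization = "(int \<Rightarrow>\<^sub>0 'a) \<times> complex"

definition aff :: "'a::complex_vector \<Rightarrow> int \<Rightarrow> 'a affinization" where
  "aff a n = (Poly_Mapping.single n a, 0)"

definition central :: "'a::complex_vector affinization" where
  "central = (0, 1)"

definition aff_plus :: "'a::complex_vector affinization set" where
  "aff_plus = {x. snd x = 0 \<and> (\<forall>n\<le>0. Poly_Mapping.lookup (fst x) n = 0)}"

definition aff_zero :: "'a::complex_vector affinization set" where
  "aff_zero = {x. \<forall>n. n \<noteq> 0 \<longrightarrow> Poly_Mapping.lookup (fst x) n = 0}"

typedef (overloaded) ('a::complex_vector) aff_minus =
  "{x :: 'a affinization. snd x = 0 \<and> (\<forall>n\<ge>0. Poly_Mapping.lookup (fst x) n = 0)}"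
  by (rule exI[of _ 0]) simp

setup_lifting type_definition_aff_minus

instantiation aff_minus :: (complex_vector) complex_vector
begin
lift_definition zero_aff_minus :: "'a aff_minus" is 0 by simp
lift_definition plus_aff_minus :: "'a aff_minus \<Rightarrow> 'a aff_minus \<Rightarrow> 'a aff_minus" is "(+)"
  by (simp add: lookup_add)
lift_definition minus_aff_minus :: "'a aff_minus \<Rightarrow> 'a aff_minus \<Rightarrow> 'a aff_minus" is "(-)"
  by (simp add: lookup_minus)
lift_definition uminus_aff_minus :: "'a aff_minus \<Rightarrow> 'a aff_minus" is "uminus"
  by simp
lift_definition scaleC_aff_minus :: "complex \<Rightarrow> 'a aff_minus \<Rightarrow> 'a aff_minus" is "scaleC"
  by (simp add: scaleC_prod_def scaleC_poly_mapping.rep_eq)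
instance
  by standard (transfer; simp add: algebra_simps scaleC_add_right scaleC_add_left)+
end

definition heis_relators ::
    "('a::complex_vector \<Rightarrow> 'a \<Rightarrow> complex) \<Rightarrow> 'a affinization tensor_algebra set" where
  "heis_relators B =
     {tensor_gen (aff a m) * tensor_gen (aff b n) - tensor_gen (aff b n) * tensor_gen (aff a m)
        - (of_int m * B a b * (if m + n = 0 then 1 else 0)) *\<^sub>C tensor_gen central
        | a b m n. m > 0 \<and> n < 0}
   \<union> {tensor_gen (aff a k) * tensor_gen (aff b 0) - tensor_gen (aff b 0) * tensor_gen (aff a k)
        | a b k. k \<noteq> 0}
   \<union> {tensor_gen (aff a k) * tensor_gen central - tensor_gen central * tensor_gen (aff a k)
        | a k. True}"

text \<open>\<open>heis_class B p\<close> is the coset \<open>p + I\<close>, so \<open>N(H)\<close> is the range of \<open>heis_class B\<close>, with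
  the operations induced from representatives.\<close>

definition heis_class ::
    "('a::complex_vector \<Rightarrow> 'a \<Rightarrow> complex) \<Rightarrow> 'a affinization tensor_algebra \<Rightarrow>
     'a affinization tensor_algebra set" where
  "heis_class B p = {q. q - p \<in> ideal_generated (heis_relators B)}"

section \<open>The induced module\<close>

text \<open>\<open>heis_nonneg\<close> consists of representatives of the elements of the subalgebra of \<open>N(H)\<close>
  generated by the nonnegative part.  Such a representative \<open>s\<close> acts on the module \<open>\<complex>\<close> as the
  scalar \<open>vac_char s\<close>: the generators act through the projection \<open>snd\<close>, under which \<open>central\<close> is sent
  to \<open>1\<close> and all \<open>a \<otimes> t\<^sup>n\<close> to \<open>0\<close>.  The values of \<open>vac_char\<close> outside \<open>heis_nonneg\<close> are
  not used.\<close>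

definition heis_nonneg :: "'a::complex_vector affinization tensor_algebra set" where
  "heis_nonneg = subalgebra_generated (tensor_gen ` (aff_plus \<union> aff_zero))"

definition vac_char :: "'a::complex_vector affinization tensor_algebra \<Rightarrow> complex" where
  "vac_char = tensor_extend snd"

text \<open>The tensor product of the right module \<open>N(H)\<close> and the left module \<open>\<complex>\<close> over that
  subalgebra is the free vector space on pairs modulo bilinearity and balancedness;
  \<open>ind_tensor B p c\<close> is the coset of the pure tensor \<open>(p + I) \<otimes> c\<close>.\<close>

type_synonym 'a ind_free = "'a affinization tensor_algebra set \<times> complex \<Rightarrow>\<^sub>0 complex"

definition ind_pair :: "('a::complex_vector \<Rightarrow> 'a \<Rightarrow> complex) \<Rightarrow>
    'a affinization tensor_algebra \<Rightarrow> complex \<Rightarrow> 'a ind_free" where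
  "ind_pair B p c = Poly_Mapping.single (heis_class B p, c) 1"

definition ind_relations :: "('a::complex_vector \<Rightarrow> 'a \<Rightarrow> complex) \<Rightarrow> 'a ind_free set" where
  "ind_relations B = cvs.span (
     {ind_pair B (p + q) c - ind_pair B p c - ind_pair B q c | p q c. True}
   \<union> {ind_pair B p (c + d) - ind_pair B p c - ind_pair B p d | p c d. True}
   \<union> {ind_pair B (z *\<^sub>C p) c - z *\<^sub>C ind_pair B p c | z p c. True}
   \<union> {ind_pair B p (z * c) - z *\<^sub>C ind_pair B p c | z p c. True}
   \<union> {ind_pair B (p * s) c - ind_pair B p (vac_char s * c) | p s c. s \<in> heis_nonneg})"

definition ind_tensor :: "('a::complex_vector \<Rightarrow> 'a \<Rightarrow> complex) \<Rightarrow>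
    'a affinization tensor_algebra \<Rightarrow> complex \<Rightarrow> 'a ind_free set" where
  "ind_tensor B p c = {f. f - ind_pair B p c \<in> ind_relations B}"

definition minus_incl :: "'a::complex_vector aff_minus tensor_algebra \<Rightarrow>
    'a affinization tensor_algebra" where
  "minus_incl = tensor_extend (\<lambda>x. tensor_gen (Rep_aff_minus x))"

text \<open>The operator \<open>a(n)\<close>: under the identification \<open>w \<mapsto> w \<otimes> 1\<close> of \<open>T(H\<^sub>-)\<close> with the
  induced module, \<open>a \<otimes> t\<^sup>n\<close> sends \<open>v \<otimes> 1\<close> to \<open>(a \<otimes> t\<^sup>n) v \<otimes> 1\<close>.\<close>

definition heis_op :: "('a::complex_vector \<Rightarrow> 'a \<Rightarrow> complex) \<Rightarrow> 'a \<Rightarrow> int \<Rightarrow>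
    'a aff_minus tensor_algebra \<Rightarrow> 'a aff_minus tensor_algebra" where
  "heis_op B a n v =
     (THE w. ind_tensor B (minus_incl w) 1
               = ind_tensor B (tensor_gen (aff a n) * minus_incl v) 1)"

section \<open>Grading and vertex operators\<close>

text \<open>A list \<open>[(a\<^sub>1, n\<^sub>1), \<dots>, (a\<^sub>k, n\<^sub>k)]\<close> stands for the formal product
  \<open>a\<^sub>1(n\<^sub>1) \<cdots> a\<^sub>k(n\<^sub>k)\<close>.\<close>

definition heis_product :: "('a::complex_vector \<Rightarrow> 'a \<Rightarrow> complex) \<Rightarrow> ('a \<times> int) list \<Rightarrow>
    'a aff_minus tensor_algebra \<Rightarrow> 'a aff_minus tensor_algebra" where
  "heis_product B ps v = foldr (\<lambda>(a, n). heis_op B a n) ps v"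

text \<open>The order of the factors is kept within each of the three blocks, and the zero modes come
  last.\<close>

definition normal_order :: "('a \<times> int) list \<Rightarrow> ('a \<times> int) list" where
  "normal_order ps =
     filter (\<lambda>(a, n). n < 0) ps @ filter (\<lambda>(a, n). n > 0) ps @ filter (\<lambda>(a, n). n = 0) ps"

text \<open>For \<open>[(a\<^sub>1, m\<^sub>1), \<dots>, (a\<^sub>k, m\<^sub>k)]\<close>, the element
  \<open>a\<^sub>1(-m\<^sub>1) \<cdots> a\<^sub>k(-m\<^sub>k) 1\<close>.\<close>

definition heis_monomial :: "('a::complex_vector \<Rightarrow> 'a \<Rightarrow> complex) \<Rightarrow> ('a \<times> nat) list \<Rightarrow>
    'a aff_minus tensor_algebra" where
  "heis_monomial B ams = heis_product B (map (\<lambda>(a, m). (a, - int m)) ams) 1"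

definition positive_modes :: "('a \<times> nat) list \<Rightarrow> bool" where
  "positive_modes ams \<longleftrightarrow> (\<forall>(a, m) \<in> set ams. 1 \<le> m)"

definition heis_grading :: "('a::complex_vector \<Rightarrow> 'a \<Rightarrow> complex) \<Rightarrow> int \<Rightarrow>
    'a aff_minus tensor_algebra set" where
  "heis_grading B n = cvs.span {heis_monomial B ams | ams.
     positive_modes ams \<and> int (\<Sum>(a, m)\<leftarrow>ams. m) = n}"

text \<open>Formal series in \<open>x, x\<^sup>-\<^sup>1\<close> are functions on \<open>int\<close>, whose value at \<open>j\<close> is the coefficient
  of \<open>x\<^sup>j\<close>.  Since the \<open>(m-1)\<close>-st derivative of \<open>x\<^sup>-\<^sup>n\<^sup>-\<^sup>1\<close> divided by \<open>(m-1)!\<close> is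
  \<open>((-n-1) gchoose (m-1)) x\<^sup>-\<^sup>n\<^sup>-\<^sup>m\<close>, the next definition is the coefficient of \<open>x\<^sup>j\<close> in the
  normal ordered product of the series \<open>a\<^sub>i(x)\<close>, each differentiated \<open>m\<^sub>i - 1\<close> times and divided
  by \<open>(m\<^sub>i - 1)!\<close>.  The sum over all mode sequences \<open>ns\<close> is finite when applied to a vector.\<close>

definition normal_product_coeff :: "('a::complex_vector \<Rightarrow> 'a \<Rightarrow> complex) \<Rightarrow> ('a \<times> nat) list \<Rightarrow>
    int \<Rightarrow> 'a aff_minus tensor_algebra \<Rightarrow> 'a aff_minus tensor_algebra" where
  "normal_product_coeff B ams j v =
     Sum_any (\<lambda>ns. if length ns = length ams \<and> (\<Sum>((a, m), n)\<leftarrow>zip ams ns. - n - int m) = j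
       then (\<Prod>((a, m), n)\<leftarrow>zip ams ns. of_int (- n - 1) gchoose (m - 1)) *\<^sub>C
              heis_product B (normal_order (zip (map fst ams) ns)) v
       else 0)"

text \<open>\<open>heis_Y B u j v\<close> is the coefficient of \<open>x\<^sup>j\<close> in \<open>Y(u, x) v\<close>.\<close>

definition heis_Y :: "('a::complex_vector \<Rightarrow> 'a \<Rightarrow> complex) \<Rightarrow> 'a aff_minus tensor_algebra \<Rightarrow>
    int \<Rightarrow> 'a aff_minus tensor_algebra \<Rightarrow> 'a aff_minus tensor_algebra" where
  "heis_Y B = (THE Y. (\<forall>j v. clinear (\<lambda>u. Y u j v)) \<and>
     (\<forall>ams. positive_modes ams \<longrightarrow> Y (heis_monomial B ams) = normal_product_coeff B ams))"

section \<open>Meromorphic open-string vertex algebras\<close>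

definition graded_space :: "(int \<Rightarrow> 'v::complex_vector set) \<Rightarrow> bool" where
  "graded_space V \<longleftrightarrow> (\<forall>n. cvs.subspace (V n)) \<and>
     (\<forall>v. \<exists>!f :: int \<Rightarrow>\<^sub>0 'v. (\<forall>n. Poly_Mapping.lookup f n \<in> V n) \<and>
       (\<Sum>n\<in>Poly_Mapping.keys f. Poly_Mapping.lookup f n) = v)"

text \<open>The graded dual, as the space of functionals on the whole space that vanish on all but
  finitely many of the homogeneous subspaces.\<close>

definition graded_dual :: "(int \<Rightarrow> 'v::complex_vector set) \<Rightarrow> ('v \<Rightarrow> complex) set" where
  "graded_dual V = {v'. clinear v' \<and> finite {n. \<exists>v\<in>V n. v' v \<noteq> 0}}"

definition grading_operator :: "(int \<Rightarrow> 'v::complex_vector set) \<Rightarrow> 'v \<Rightarrow> 'v" where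
  "grading_operator V = (THE d. clinear d \<and> (\<forall>m. \<forall>u\<in>V m. d u = of_int m *\<^sub>C u))"

definition series_deriv :: "(int \<Rightarrow> 'v \<Rightarrow> 'v) \<Rightarrow> int \<Rightarrow> 'v \<Rightarrow> 'v::complex_vector" where
  "series_deriv f j v = of_int (j + 1) *\<^sub>C f (j + 1) v"

text \<open>The limit of a series without negative powers as \<open>x\<close> tends to \<open>0\<close> is its constant term.\<close>

definition D_operator :: "('v::complex_vector \<Rightarrow> int \<Rightarrow> 'v \<Rightarrow> 'v) \<Rightarrow> 'v \<Rightarrow> 'v \<Rightarrow> 'v" where
  "D_operator Y vac u = series_deriv (Y u) 0 vac"

definition polynomial_function :: "nat \<Rightarrow> ((nat \<Rightarrow> complex) \<Rightarrow> complex) \<Rightarrow> bool" where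
  "polynomial_function n p \<longleftrightarrow> (\<exists>(A :: (nat \<Rightarrow> nat) set) c. finite A \<and>
     p = (\<lambda>z. \<Sum>\<alpha>\<in>A. c \<alpha> * (\<Prod>i<n. z i ^ \<alpha> i)))"

text \<open>Rational functions of \<open>z 0, \<dots>, z (n - 1)\<close> with only possible poles at \<open>z i = 0\<close> and
  \<open>z i = z j\<close>.\<close>

definition rational_function :: "nat \<Rightarrow> ((nat \<Rightarrow> complex) \<Rightarrow> complex) \<Rightarrow> bool" where
  "rational_function n R \<longleftrightarrow> (\<exists>p q. polynomial_function n p \<and> polynomial_function n q \<and>
     (\<forall>z. (\<forall>i<n. z i \<noteq> 0) \<and> (\<forall>i<n. \<forall>j<n. i \<noteq> j \<longrightarrow> z i \<noteq> z j) \<longrightarrow> q z \<noteq> 0) \<and>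
     R = (\<lambda>z. p z / q z))"

text \<open>The series \<open>\<langle>v', Y(u\<^sub>1, z\<^sub>1) \<cdots> Y(u\<^sub>n, z\<^sub>n) v\<rangle>\<close>, as the family of its terms indexed by the
  lists of exponents.\<close>

definition product_indices :: "'v list \<Rightarrow> int list set" where
  "product_indices us = {js. length js = length us}"

definition product_term :: "('v::complex_vector \<Rightarrow> int \<Rightarrow> 'v \<Rightarrow> 'v) \<Rightarrow> ('v \<Rightarrow> complex) \<Rightarrow>
    'v list \<Rightarrow> 'v \<Rightarrow> (nat \<Rightarrow> complex) \<Rightarrow> int list \<Rightarrow> complex" where
  "product_term Y v' us v z js =
     v' (foldr (\<lambda>(u, j). Y u j) (zip us js) v) * (\<Prod>i<length us. z i powi (js ! i))"

text \<open>The series \<open>\<langle>v', Y(Y(u\<^sub>1, z\<^sub>1 - z\<^sub>2)u\<^sub>2, z\<^sub>2) v\<rangle>\<close>; the first index is the exponent of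
  \<open>z\<^sub>1 - z\<^sub>2\<close>.\<close>

definition iterate_term :: "('v::complex_vector \<Rightarrow> int \<Rightarrow> 'v \<Rightarrow> 'v) \<Rightarrow> ('v \<Rightarrow> complex) \<Rightarrow>
    'v \<Rightarrow> 'v \<Rightarrow> 'v \<Rightarrow> (nat \<Rightarrow> complex) \<Rightarrow> int \<times> int \<Rightarrow> complex" where
  "iterate_term Y v' u1 u2 v z = (\<lambda>(i, j).
     v' (Y (Y u1 i u2) j v) * (z 0 - z 1) powi i * z 1 powi j)"

definition product_region :: "nat \<Rightarrow> (nat \<Rightarrow> complex) set" where
  "product_region n =
     {z. (\<forall>i. Suc i < n \<longrightarrow> norm (z (Suc i)) < norm (z i)) \<and> (\<forall>i<n. 0 < norm (z i))}"

definition iterate_region :: "(nat \<Rightarrow> complex) set" where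
  "iterate_region = {z. norm (z 1) > norm (z 0 - z 1) \<and> norm (z 0 - z 1) > 0}"

locale meromorphic_open_string_vertex_algebra =
  fixes V :: "int \<Rightarrow> 'v::complex_vector set"
    and Y :: "'v \<Rightarrow> int \<Rightarrow> 'v \<Rightarrow> 'v"
    and vac :: 'v
  assumes graded: "graded_space V"
    and Y_linear: "clinear (\<lambda>u. Y u j v)"
    and Y_endomorphism: "clinear (Y u j)"
    and lower_bound: "\<exists>N. \<forall>n<N. V n = {0}"
    and vacuum: "Y vac j v = (if j = 0 then v else 0)"
    and creation: "j < 0 \<Longrightarrow> Y u j vac = 0" "Y u 0 vac = u"
    and product_rationality: "v' \<in> graded_dual V \<Longrightarrow>
      \<exists>R. rational_function (length us) R \<and> (\<forall>z\<in>product_region (length us).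
        (\<lambda>js. norm (product_term Y v' us v z js)) summable_on product_indices us \<and>
        (product_term Y v' us v z has_sum R z) (product_indices us))"
    and iterate_rationality: "v' \<in> graded_dual V \<Longrightarrow>
      \<exists>R. rational_function 2 R \<and> (\<forall>z\<in>iterate_region.
        (\<lambda>ij. norm (iterate_term Y v' u1 u2 v z ij)) summable_on UNIV \<and>
        (iterate_term Y v' u1 u2 v z has_sum R z) UNIV)"
    and associativity: "v' \<in> graded_dual V \<Longrightarrow> z \<in> product_region 2 \<Longrightarrow> z \<in> iterate_region \<Longrightarrow>
      infsum (product_term Y v' [u1, u2] v z) (product_indices [u1, u2]) =
      infsum (iterate_term Y v' u1 u2 v z) UNIV"
    \<comment> \<open>the coefficient of \<open>x\<^sup>j\<close> in \<open>x (d/dx) Y(u, x)\<close> is \<open>j Y u j\<close>\<close>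
    and d_bracket: "grading_operator V (Y u j v) - Y u j (grading_operator V v) =
      Y (grading_operator V u) j v + series_deriv (Y u) (j - 1) v"
    and D_derivative: "series_deriv (Y u) j v = Y (D_operator Y vac u) j v"
    and D_commutator: "series_deriv (Y u) j v =
      D_operator Y vac (Y u j v) - Y u j (D_operator Y vac v)"

locale grading_restricted_meromorphic_open_string_vertex_algebra =
  meromorphic_open_string_vertex_algebra +
  assumes finite_dimensional_homogeneous: "finite_dimensional (V n)"

end

(* Since zero modes commute with all other modes and kill the vacuum, they act by 0 on T(H_-).  So a(-k)
   acts by left multiplication and a(n), n > 0, by the derivation sending b(-k) to n B(a,b) if k = n and to
   0 otherwise; these derivations commute.  The normal ordered product then satisfies, for m > 0,
     Y(a(-m)u, x) = sum_{n<0} c(m,n) x^(-n-m) a(n) Y(u,x) + sum_{n>0} c(m,n) x^(-n-m) Y(u,x) a(n)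
   with c(m,n) = binomial(-n-1, m-1), and every axiom follows from this recursion by induction on u.
   For a product Y(a(-m)u, z_1) Y(u_2, z_2) ... v one moves the annihilation operators to the right with
     [a(n), Y(u,x)] = sum_{q=1..n} binomial(n,q) x^(n-q) Y(a(q)u, x),
   which produces the rational functions c(m,q) (z_1 - z_j)^(-q-m).  The iterate Y(Y(a(-m)u, z_1 - z_2)u_2, z_2)
   obeys the same recursion as the product Y(a(-m)u, z_1) Y(u_2, z_2), which gives associativity. *)

theory Submission
  imports Defs
begin


section \<open>Linear maps\<close>

text \<open>The recursion replaces v' by its composite with a(-k), v by a(n)v and u_j by a(q)u_j, so
  the inductions that prove convergence keep v', v and the remaining u_j arbitrary. Its mode bounds
  depend on the vectors and the exponent; it is therefore stated for all sufficiently large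
  truncations N, and several instances can be compared at one common N. For fixed exponents of z_1,
  z_2, ... the sum over annihilation modes is finite, but its commutator terms are not finitely many
  correlation functions: for each q, the modes n contribute the series of c(m,n) binomial(n,q)
  z_1^(-n-m) z_j^(n-q), which converges for |z_j| < |z_1|. Hence one sums a family indexed by the
  mode and the exponents together. Absolute convergence permits both orders of summation: one gives
  the series of the product, the other the rational function. The operators a(n) and Y are given by
  definite descriptions, and monomials span without being a basis. So the action must be shown to
  descend to the induced module, and the normal ordered products to be multilinear, before either
  can be computed.\<close>

lemma clinearI:
  assumes "\<And>x y. f (x + y) = f x + f y" "\<And>c x. f (c *\<^sub>C x) = c *\<^sub>C f x"
  shows "clinear f"
  using assms by (auto simp: Vector_Spaces.linear_iff cvs.vector_space_axioms)

lemma clinearD: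
  assumes "clinear f"
  shows clinear_add: "f (x + y) = f x + f y" and clinear_scale: "f (c *\<^sub>C x) = c *\<^sub>C f x"
  using assms by (auto simp: Vector_Spaces.linear_iff)

lemma clinear_zero: "clinear f \<Longrightarrow> f 0 = 0"
  using clinear_scale[of f 0 0] by simp

lemma clinear_diff: "clinear f \<Longrightarrow> f (x - y) = f x - f y"
  by (metis add_diff_cancel clinear_add diff_add_cancel)

lemma clinear_sum: "clinear f \<Longrightarrow> f (\<Sum>i\<in>I. g i) = (\<Sum>i\<in>I. f (g i))"
  by (induction I rule: infinite_finite_induct) (simp_all add: clinear_zero clinear_add)

lemma clinear_compose: "clinear f \<Longrightarrow> clinear g \<Longrightarrow> clinear (\<lambda>x. f (g x))"
  by (rule clinearI) (simp_all add: clinear_add clinear_scale)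

lemma clinear_plus: "clinear f \<Longrightarrow> clinear g \<Longrightarrow> clinear (\<lambda>x. f x + g x)"
  by (rule clinearI) (simp_all add: clinear_add clinear_scale scaleC_add_right)

lemma clinear_scaleC: "clinear f \<Longrightarrow> clinear (\<lambda>x. c *\<^sub>C f x)"
  by (rule clinearI) (simp_all add: clinear_add clinear_scale scaleC_add_right mult.commute)

lemma clinear_sums: "(\<And>i. clinear (f i)) \<Longrightarrow> clinear (\<lambda>x. \<Sum>i\<in>I. f i x)"
  by (rule clinearI) (simp_all add: clinear_add clinear_scale sum.distrib cvs.scale_sum_right)

text \<open>Additivity involves three vectors with three different truncations; a single large N
  serves all of them.\<close>

lemma clinear_eventually:
  assumes G: "\<And>N :: nat. clinear (G N)" and f: "\<And>x. \<forall>\<^sub>F N in sequentially. f x = G N x"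
  shows "clinear f"
proof (rule clinearI)
  fix x y c
  have "\<forall>\<^sub>F N in sequentially. f (x + y) = f x + f y"
    using f[of x] f[of y] f[of "x + y"] by eventually_elim (simp add: clinear_add[OF G])
  then show "f (x + y) = f x + f y" by simp
  have "\<forall>\<^sub>F N in sequentially. f (c *\<^sub>C x) = c *\<^sub>C f x"
    using f[of x] f[of "c *\<^sub>C x"] by eventually_elim (simp add: clinear_scale[OF G])
  then show "f (c *\<^sub>C x) = c *\<^sub>C f x" by simp
qed

lemma clinear_eq_on_span:
  assumes "clinear f" "clinear g" "\<And>x. x \<in> S \<Longrightarrow> f x = g x" "x \<in> cvs.span S"
  shows "f x = g x"
  using assms(4)
  by (induction rule: cvs.span_induct_alt)
    (simp_all add: clinear_zero clinear_add clinear_scale assms)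

lemma scaleC_sum_right: "c *\<^sub>C (\<Sum>i\<in>I. f i) = (\<Sum>i\<in>I. c *\<^sub>C (f i::'a::complex_vector))"
  by (rule cvs.scale_sum_right)

lemma scaleC_complex [simp]: "c *\<^sub>C (z::complex) = c * z"
  by (simp add: scaleC_complex_def)

section \<open>The universal property of the tensor algebra\<close>

lemma tensor_gen_add: "tensor_gen (x + y) = tensor_gen x + tensor_gen y"
proof -
  have "Poly_Mapping.single [x + y] 1 - Poly_Mapping.single [x] 1 - Poly_Mapping.single [y] (1::complex)
      \<in> ideal_generated linear_relators"
    by (rule ideal_generated.gen) (auto simp: linear_relators_def)
  then show ?thesis
    by transfer (simp add: tensor_eq_def algebra_simps)
qed

lemma tensor_gen_scaleC: "tensor_gen (c *\<^sub>C x) = c *\<^sub>C tensor_gen x"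
proof -
  have "Poly_Mapping.single [c *\<^sub>C x] 1 - c *\<^sub>C Poly_Mapping.single [x] (1::complex)
      \<in> ideal_generated linear_relators"
    by (rule ideal_generated.gen) (auto simp: linear_relators_def)
  then show ?thesis
    by transfer (simp add: tensor_eq_def algebra_simps)
qed

lemma clinear_tensor_gen: "clinear tensor_gen"
  by (rule clinearI) (simp_all add: tensor_gen_add tensor_gen_scaleC)

definition tensor_word :: "'a::complex_vector list \<Rightarrow> 'a tensor_algebra" where
  "tensor_word xs = prod_list (map tensor_gen xs)"

lemma tensor_word_simps [simp]:
  "tensor_word [] = 1"
  "tensor_word (x # xs) = tensor_gen x * tensor_word xs"
  "tensor_word (xs @ ys) = tensor_word xs * tensor_word ys"
  by (simp_all add: tensor_word_def)

lemma abs_tensor_algebra_single: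
  "abs_tensor_algebra (Poly_Mapping.single xs 1) = tensor_word xs"
proof (induction xs)
  case Nil
  have "(1 :: 'a list \<Rightarrow>\<^sub>0 complex) = Poly_Mapping.single [] 1"
    by (metis single_one zero_list_def)
  then show ?case
    by (simp add: one_tensor_algebra_def)
next
  case (Cons x xs)
  have "Poly_Mapping.single (x # xs) (1::complex) = Poly_Mapping.single [x] 1 * Poly_Mapping.single xs 1"
    by (simp add: mult_single plus_list_def)
  then show ?case
    by (simp add: times_tensor_algebra.abs_eq[symmetric] Cons tensor_gen.abs_eq)
qed

lemma scaleC_single: "c *\<^sub>C Poly_Mapping.single k (d::complex) = Poly_Mapping.single k (c * d)"
  by (rule poly_mapping_eqI) (simp add: scaleC_poly_mapping.rep_eq lookup_single when_def)

lemma poly_mapping_sum_single: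
  "p = (\<Sum>k\<in>Poly_Mapping.keys p. Poly_Mapping.lookup p k *\<^sub>C Poly_Mapping.single k (1::complex))"
  by (rule poly_mapping_eqI)
    (simp add: lookup_sum scaleC_poly_mapping.rep_eq lookup_single when_def in_keys_iff
      sum.delta if_distrib cong: if_cong)

lemma poly_mapping_induct [case_names zero add single]:
  fixes p :: "'k \<Rightarrow>\<^sub>0 complex"
  assumes "P 0" "\<And>p q. P p \<Longrightarrow> P q \<Longrightarrow> P (p + q)" "\<And>c k. P (c *\<^sub>C Poly_Mapping.single k 1)"
  shows "P p"
proof -
  have "P (\<Sum>k\<in>I. Poly_Mapping.lookup p k *\<^sub>C Poly_Mapping.single k 1)" if "finite I" for I
    using that by induction (use assms in auto)
  from this[OF finite_keys] show ?thesis
    by (subst poly_mapping_sum_single)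
qed

lemma poly_mapping_extension:
  fixes f :: "'k \<Rightarrow> 'b::complex_vector"
  shows "\<exists>E. clinear E \<and> (\<forall>k c. E (Poly_Mapping.single k c) = c *\<^sub>C f k)"
proof (intro exI conjI allI)
  define E where "E p = Sum_any (\<lambda>k. Poly_Mapping.lookup p k *\<^sub>C f k)" for p
  have E: "E p = (\<Sum>k\<in>A. Poly_Mapping.lookup p k *\<^sub>C f k)"
    if "finite A" "Poly_Mapping.keys p \<subseteq> A" for p A
    unfolding E_def using that by (intro Sum_any.expand_superset) (auto simp: in_keys_iff)
  show "clinear E"
  proof (rule clinearI)
    fix p q :: "'k \<Rightarrow>\<^sub>0 complex" and c
    let ?A = "Poly_Mapping.keys p \<union> Poly_Mapping.keys q"
    have "E (p + q) = (\<Sum>k\<in>?A. Poly_Mapping.lookup (p + q) k *\<^sub>C f k)"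
      using Poly_Mapping.keys_add[of p q] by (intro E) auto
    also have "\<dots> = E p + E q"
      by (simp add: E[of ?A p] E[of ?A q] lookup_add scaleC_add_left sum.distrib)
    finally show "E (p + q) = E p + E q" .
    have "E (c *\<^sub>C p) = (\<Sum>k\<in>Poly_Mapping.keys p. Poly_Mapping.lookup (c *\<^sub>C p) k *\<^sub>C f k)"
      by (intro E) (auto simp: in_keys_iff scaleC_poly_mapping.rep_eq)
    then show "E (c *\<^sub>C p) = c *\<^sub>C E p"
      by (simp add: E[of "Poly_Mapping.keys p" p] scaleC_sum_right scaleC_poly_mapping.rep_eq)
  qed
  show "E (Poly_Mapping.single k c) = c *\<^sub>C f k" for k c
    by (subst E[of "{k}"]) auto
qed

lemma abs_tensor_algebra_clinear: "clinear abs_tensor_algebra"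
  by (rule clinearI) (simp_all add: plus_tensor_algebra.abs_eq scaleC_tensor_algebra.abs_eq)

lemma span_tensor_word: "cvs.span (range tensor_word) = UNIV"
proof -
  have "t \<in> cvs.span (range tensor_word)" for t :: "'a tensor_algebra"
  proof (induct t rule: tensor_algebra.abs_induct)
    case (1 p)
    have "abs_tensor_algebra p = (\<Sum>k\<in>Poly_Mapping.keys p. Poly_Mapping.lookup p k *\<^sub>C tensor_word k)"
      by (subst poly_mapping_sum_single)
        (simp add: clinear_sum[OF abs_tensor_algebra_clinear] abs_tensor_algebra_single
          clinear_scale[OF abs_tensor_algebra_clinear])
    then show ?case
      by (simp only:) (rule cvs.span_sum, rule cvs.span_scale, rule cvs.span_base, rule rangeI)
  qed
  then show ?thesis by auto
qed

lemma tensor_induct [case_names one mult add scale]: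
  fixes P :: "'a::complex_vector tensor_algebra \<Rightarrow> bool"
  assumes "P 1" "\<And>x u. P u \<Longrightarrow> P (tensor_gen x * u)"
    "\<And>u v. P u \<Longrightarrow> P v \<Longrightarrow> P (u + v)" "\<And>c u. P u \<Longrightarrow> P (c *\<^sub>C u)"
  shows "P u"
proof -
  have word: "P (tensor_word xs)" for xs
    by (induction xs) (simp_all add: assms)
  have "u \<in> cvs.span (range tensor_word)"
    by (simp add: span_tensor_word)
  then show ?thesis
    by (induction rule: cvs.span_induct_alt)
      (use assms(3,4) word assms(4)[OF word, of 0] in auto)
qed

text \<open>Lists of all lengths are treated at once: on lists of length k this is k-linearity, so
  such a map is a family of maps on the tensor powers, with no condition on the empty list.\<close>

definition multilinear :: "('a::complex_vector list \<Rightarrow> 'b::complex_vector) \<Rightarrow> bool" where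
  "multilinear f \<longleftrightarrow> (\<forall>l r. clinear (\<lambda>x. f (l @ x # r)))"

lemma multilinear_extension:
  assumes f: "multilinear f"
  shows "\<exists>F. clinear F \<and> (\<forall>xs. F (tensor_word xs) = f xs)"
proof -
  obtain E where E_lin: "clinear E" and E_single: "\<And>xs c. E (Poly_Mapping.single xs c) = c *\<^sub>C f xs"
    using poly_mapping_extension[of f] by blast
  note E = clinear_add[OF E_lin] clinear_scale[OF E_lin] clinear_diff[OF E_lin]
    clinear_zero[OF E_lin] clinear_sum[OF E_lin]
  have "clinear (\<lambda>x. f (l @ x # r))" for l r
    using f by (simp add: multilinear_def)
  note fl' = clinear_add[OF this] clinear_scale[OF this]
  have fl: "f (l @ (x + y) # r) = f (l @ x # r) + f (l @ y # r)"
       "f (l @ (c *\<^sub>C x) # r) = c *\<^sub>C f (l @ x # r)" for l r x y c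
    by (rule fl')+
  \<comment> \<open>The arbitrary factors on both sides make the claim stable under left and right
    multiplication. For a relator between two words it is the linearity of \<open>f\<close> in one
    letter, and words span the free algebra.\<close>
  have kill: "\<forall>l r. E (l * p * r) = 0" if "p \<in> ideal_generated linear_relators" for p
    using that
  proof induction
    case zero
    show ?case by (simp add: E)
  next
    case (gen p)
    have base: "E (Poly_Mapping.single l 1 * p * Poly_Mapping.single r 1) = 0" for l r
      using gen unfolding linear_relators_def
      by (auto simp: left_diff_distrib right_diff_distrib mult_single plus_list_def E E_single fl
          scaleC_single)
    have "E (Poly_Mapping.single l 1 * p * r) = 0" for l r
    proof (rule poly_mapping_induct[where p = r])
      show "E (Poly_Mapping.single l 1 * p * (q + q')) = 0"
        if "E (Poly_Mapping.single l 1 * p * q) = 0" "E (Poly_Mapping.single l 1 * p * q') = 0" for q q'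
        using that by (simp add: distrib_left E)
    qed (simp_all add: E free_algebra_scaleC_right base)
    note base2 = this
    have "E (l * p * r) = 0" for l r
    proof (rule poly_mapping_induct[where p = l])
      show "E ((q + q') * p * r) = 0" if "E (q * p * r) = 0" "E (q' * p * r) = 0" for q q'
        using that by (simp add: distrib_right E)
      show "E (c *\<^sub>C Poly_Mapping.single xs 1 * p * r) = 0" for c xs
      proof -
        have "c *\<^sub>C Poly_Mapping.single xs 1 * p * r = c *\<^sub>C (Poly_Mapping.single xs 1 * p * r)"
          by (simp only: scaleC_free_algebra mult.assoc)
        then show ?thesis by (simp add: E base2)
      qed
    qed (simp_all add: E)
    then show ?case by blast
  next
    case (add x y)
    then show ?case by (simp add: distrib_left distrib_right E)
  next
    case (mult_left x s)
    have "l * (s * x) * r = (l * s) * x * r" for l r by (simp add: mult.assoc)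
    with mult_left show ?case by simp
  next
    case (mult_right x s)
    have "l * (x * s) * r = l * x * (s * r)" for l r by (simp add: mult.assoc)
    with mult_right show ?case by simp
  qed
  have E_cong: "E p = E q" if "tensor_eq p q" for p q
    using kill[of "p - q", rule_format, of 1 1] that unfolding tensor_eq_def by (simp add: E)
  define F where "F t = E (rep_tensor_algebra t)" for t
  have F_abs: "F (abs_tensor_algebra p) = E p" for p
    unfolding F_def
    by (rule E_cong) (rule Quotient3_rep_abs[OF Quotient3_tensor_algebra], simp add: tensor_eq_def ideal_generated.zero)
  show ?thesis
  proof (intro exI[of _ F] conjI allI)
    show "clinear F"
    proof (rule clinearI)
      show "F (x + y) = F x + F y" for x y
        by (induct x rule: tensor_algebra.abs_induct, induct y rule: tensor_algebra.abs_induct)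
          (simp add: F_abs E plus_tensor_algebra.abs_eq)
      show "F (c *\<^sub>C x) = c *\<^sub>C F x" for c x
        by (induct x rule: tensor_algebra.abs_induct) (simp add: F_abs E scaleC_tensor_algebra.abs_eq)
    qed
    show "F (tensor_word xs) = f xs" for xs
      by (simp add: abs_tensor_algebra_single[symmetric] F_abs E_single scaleC_one)
  qed
qed

text \<open>Recursion on words from the left. Algebra homomorphisms, derivations and the
  representation on T(H_-) are all obtained from it by a choice of \<open>G\<close>.\<close>

lemma tensor_recursion:
  fixes G :: "'a::complex_vector \<Rightarrow> 'b::complex_vector \<Rightarrow> 'b"
  assumes G: "\<And>x. clinear (G x)" "\<And>w. clinear (\<lambda>x. G x w)"
  shows "\<exists>F. clinear F \<and> F 1 = w0 \<and> (\<forall>x u. F (tensor_gen x * u) = G x (F u))"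
proof -
  define f where "f xs = foldr G xs w0" for xs
  have "clinear (\<lambda>x. foldr G (l @ x # r) w0)" for l r
  proof (induction l)
    case Nil
    then show ?case by (simp add: G)
  next
    case (Cons y l)
    show ?case
      by (rule clinearI)
        (simp_all add: clinear_add[OF Cons] clinear_scale[OF Cons] clinear_add[OF G(1)] clinear_scale[OF G(1)]
          del: foldr_append)
  qed
  then have "multilinear f"
    by (simp add: multilinear_def f_def)
  then obtain F where F: "clinear F" "\<And>xs. F (tensor_word xs) = f xs"
    using multilinear_extension by metis
  have "F (tensor_gen x * u) = G x (F u)" for x u
  proof (rule clinear_eq_on_span[where S = "range tensor_word" and f = "\<lambda>u. F (tensor_gen x * u)" and g = "\<lambda>u. G x (F u)"])
    show "clinear (\<lambda>u. F (tensor_gen x * u))"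
      by (rule clinearI) (simp_all add: distrib_left clinear_add[OF F(1)] mult_scaleC_right clinear_scale[OF F(1)])
    show "clinear (\<lambda>u. G x (F u))"
      by (rule clinearI)
       (simp_all add: clinear_add[OF F(1)] clinear_scale[OF F(1)] clinear_add[OF G(1)] clinear_scale[OF G(1)])
    show "F (tensor_gen x * w) = G x (F w)" if "w \<in> range tensor_word" for w
      using that F(2)[of "x # _"] by (auto simp: F f_def)
  qed (simp add: span_tensor_word)
  then show ?thesis
    using F F(2)[of "[]"] by (auto simp: f_def)
qed

lemma tensor_linear_eqI:
  assumes "clinear F" "clinear G" "F 1 = G 1"
    "\<And>x u. F u = G u \<Longrightarrow> F (tensor_gen x * u) = G (tensor_gen x * u)"
  shows "F u = G u"
  by (induction u rule: tensor_induct)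
    (simp_all add: assms clinear_add[OF assms(1)] clinear_add[OF assms(2)] clinear_scale[OF assms(1)] clinear_scale[OF assms(2)])

lemma tensor_extend:
  assumes f: "clinear f"
  shows algebra_hom_tensor_extend: "algebra_hom (tensor_extend f)"
    and tensor_extend_gen: "tensor_extend f (tensor_gen x) = f x"
proof -
  have "\<exists>F. clinear F \<and> F 1 = 1 \<and> (\<forall>x u. F (tensor_gen x * u) = f x * F u)"
    by (rule tensor_recursion)
      (auto intro!: clinearI simp: distrib_left distrib_right mult_scaleC_left mult_scaleC_right
        clinear_add[OF f] clinear_scale[OF f])
  then obtain F where F: "clinear F" "F 1 = 1" "\<And>x u. F (tensor_gen x * u) = f x * F u"
    by blast
  \<comment> \<open>The recursion gives multiplicativity only for a generator on the left; the
    general case is an induction on the left factor.\<close>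
  have mult: "F (u * v) = F u * F v" for u v
    by (induction u rule: tensor_induct)
      (simp_all add: F clinear_add[OF F(1)] clinear_scale[OF F(1)] mult_scaleC_left distrib_right mult.assoc)
  have hom: "algebra_hom F \<and> (\<forall>x. F (tensor_gen x) = f x)"
    using F(3)[of _ 1] by (simp add: algebra_hom_def F mult)
  have "tensor_extend f = F"
    unfolding tensor_extend_def
  proof (rule the_equality, rule hom, rule ext)
    fix g u assume g: "algebra_hom g \<and> (\<forall>x. g (tensor_gen x) = f x)"
    show "g u = F u"
      by (rule tensor_linear_eqI) (use g F in \<open>auto simp: algebra_hom_def\<close>)
  qed
  with hom show "algebra_hom (tensor_extend f)" "tensor_extend f (tensor_gen x) = f x"
    by simp_all
qed

text \<open>The Leibniz rule needs u besides d u, so the recursion carries the pair (u, d u), and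
  the second component is kept at the end.\<close>

lemma derivation_extension:
  fixes \<phi> :: "'a::complex_vector \<Rightarrow> 'a tensor_algebra"
  assumes \<phi>: "clinear \<phi>"
  shows "\<exists>d. clinear d \<and> d 1 = 0 \<and>
    (\<forall>x u. d (tensor_gen x * u) = \<phi> x * u + tensor_gen x * d u)"
proof -
  have "\<exists>F. clinear F \<and> F 1 = (1, 0) \<and> (\<forall>x u. F (tensor_gen x * u) =
      (tensor_gen x * fst (F u), \<phi> x * fst (F u) + tensor_gen x * snd (F u)))"
    by (rule tensor_recursion[of "\<lambda>x w. (tensor_gen x * fst w, \<phi> x * fst w + tensor_gen x * snd w)"])
      (auto intro!: clinearI simp: distrib_left distrib_right mult_scaleC_left mult_scaleC_right
        clinear_add[OF \<phi>] clinear_scale[OF \<phi>] scaleC_prod_def tensor_gen_add tensor_gen_scaleC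
        scaleC_add_right)
  then obtain F where F: "clinear F" "F 1 = (1, 0)"
    "\<And>x u. F (tensor_gen x * u) = (tensor_gen x * fst (F u), \<phi> x * fst (F u) + tensor_gen x * snd (F u))"
    by blast
  have fst: "fst (F u) = u" for u
    by (induction u rule: tensor_induct)
      (simp_all add: F clinear_add[OF F(1)] clinear_scale[OF F(1)] scaleC_prod_def)
  show ?thesis
    by (rule exI[of _ "\<lambda>u. snd (F u)"])
      (auto intro!: clinearI simp: F fst clinear_add[OF F(1)] clinear_scale[OF F(1)] scaleC_prod_def)
qed


section \<open>Modes\<close>

type_synonym 'a heis_module = "'a aff_minus tensor_algebra"

text \<open>\<open>mode a k\<close> is \<open>a \<otimes> t\<^sup>-\<^sup>k\<close> for \<open>k \<ge> 1\<close>; the value \<open>0\<close> for \<open>k = 0\<close> keeps it linear in \<open>a\<close>.\<close>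

definition mode :: "'a::complex_vector \<Rightarrow> nat \<Rightarrow> 'a aff_minus" where
  "mode a k = Abs_aff_minus (if k = 0 then 0 else aff a (- int k))"

definition component :: "'a::complex_vector aff_minus \<Rightarrow> nat \<Rightarrow> 'a" where
  "component x k = Poly_Mapping.lookup (fst (Rep_aff_minus x)) (- int k)"

lemma aff_add: "aff (a + b) n = aff a n + aff b n"
  by (simp add: aff_def single_add)

lemma aff_scaleC: "aff (c *\<^sub>C a) n = c *\<^sub>C aff a n"
  by (auto simp: aff_def scaleC_prod_def intro!: poly_mapping_eqI
      simp: scaleC_poly_mapping.rep_eq lookup_single when_def)

lemma Rep_mode: "Rep_aff_minus (mode a k) = (if k = 0 then 0 else aff a (- int k))"
  unfolding mode_def by (rule Abs_aff_minus_inverse) (auto simp: aff_def lookup_single when_def)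

lemma clinear_mode: "clinear (\<lambda>a. mode a k)"
  by (rule clinearI)
    (simp_all add: Rep_aff_minus_inject[symmetric] plus_aff_minus.rep_eq scaleC_aff_minus.rep_eq
      Rep_mode aff_add aff_scaleC)

lemma mode_0 [simp]: "mode a 0 = 0"
  by (simp add: Rep_aff_minus_inject[symmetric] Rep_mode zero_aff_minus.rep_eq)

lemma clinear_component: "clinear (\<lambda>x. component x k)"
  by (rule clinearI)
    (simp_all add: component_def plus_aff_minus.rep_eq scaleC_aff_minus.rep_eq lookup_add
      scaleC_prod_def scaleC_poly_mapping.rep_eq)

lemma component_mode: "component (mode a k) l = (if k = l \<and> k \<noteq> 0 then a else 0)"
  by (auto simp: component_def Rep_mode aff_def lookup_single when_def)

lemma mode_decomposition: "\<exists>N. x = (\<Sum>k=1..N. mode (component x k) k)"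
proof -
  define f where "f = fst (Rep_aff_minus x)"
  \<comment> \<open>An upper bound for the absolute values of all exponents in the support, valid
    also when the support is empty.\<close>
  define N where "N = (\<Sum>n\<in>Poly_Mapping.keys f. nat \<bar>n\<bar>)"
  have Rep: "snd (Rep_aff_minus x) = 0" "\<And>n. n \<ge> 0 \<Longrightarrow> Poly_Mapping.lookup f n = 0"
    using Rep_aff_minus[of x] by (auto simp: f_def)
  have N: "nat \<bar>n\<bar> \<le> N" if "Poly_Mapping.lookup f n \<noteq> 0" for n
    unfolding N_def using that by (intro member_le_sum) (auto simp: in_keys_iff)
  have rep_sum: "Rep_aff_minus (\<Sum>k\<in>I. g k) = (\<Sum>k\<in>I. Rep_aff_minus (g k))"
    for g :: "nat \<Rightarrow> 'a aff_minus" and I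
    by (induction I rule: infinite_finite_induct)
      (simp_all add: zero_aff_minus.rep_eq plus_aff_minus.rep_eq)
  have "f = (\<Sum>k=1..N. Poly_Mapping.single (- int k) (component x k))"
  proof (rule poly_mapping_eqI)
    fix n
    show "Poly_Mapping.lookup f n =
        Poly_Mapping.lookup (\<Sum>k=1..N. Poly_Mapping.single (- int k) (component x k)) n"
    proof (cases "n < 0")
      case True
      have "(\<Sum>k=1..N. component x k when - int k = n) =
          (\<Sum>k=1..N. if k = nat (- n) then component x k else 0)"
        using True by (intro sum.cong) (auto simp: when_def)
      also have "\<dots> = (if nat (- n) \<in> {1..N} then component x (nat (- n)) else 0)"
        by (simp add: sum.delta)
      also have "\<dots> = Poly_Mapping.lookup f n"
        using True N[of n] by (auto simp: component_def f_def)
      finally show ?thesis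
        by (simp add: lookup_sum lookup_single)
    next
      case False
      then show ?thesis
        using Rep(2)[of n] by (simp add: lookup_sum lookup_single when_def)
    qed
  qed
  moreover have "Rep_aff_minus (\<Sum>k=1..N. mode (component x k) k) =
      (\<Sum>k=1..N. Poly_Mapping.single (- int k) (component x k), 0)"
    by (simp add: rep_sum Rep_mode aff_def sum_prod)
  ultimately have "x = (\<Sum>k=1..N. mode (component x k) k)"
    using Rep by (metis Rep_aff_minus_inject f_def prod.collapse)
  then show ?thesis ..
qed

section \<open>The operators on the tensor algebra\<close>

locale heisenberg =
  fixes B :: "'a::complex_vector \<Rightarrow> 'a \<Rightarrow> complex"
  assumes bilinear: "bilinear_form B"
begin

lemma form_simps:
  "B (x + y) z = B x z + B y z" "B (c *\<^sub>C x) z = c * B x z"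
  "B x (y + z) = B x y + B x z" "B x (c *\<^sub>C z) = c * B x z"
  using bilinear by (auto simp: bilinear_form_def)

lemma form_zero: "B 0 z = 0" "B x 0 = 0"
  using form_simps(2)[of 0 0 z] form_simps(4)[of x 0 0] by simp_all

definition create :: "'a \<Rightarrow> nat \<Rightarrow> 'a heis_module \<Rightarrow> 'a heis_module" where
  "create a k u = tensor_gen (mode a k) * u"

definition annihilate :: "'a \<Rightarrow> nat \<Rightarrow> 'a heis_module \<Rightarrow> 'a heis_module" where
  "annihilate a n = (SOME d. clinear d \<and> d 1 = 0 \<and>
     (\<forall>x u. d (tensor_gen x * u) =
        (of_nat n * B a (component x n)) *\<^sub>C 1 * u + tensor_gen x * d u))"

lemma annihilate:
  shows clinear_annihilate: "clinear (annihilate a n)"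
    and annihilate_1 [simp]: "annihilate a n 1 = 0"
    and annihilate_gen: "annihilate a n (tensor_gen x * u) =
      (of_nat n * B a (component x n)) *\<^sub>C u + tensor_gen x * annihilate a n u"
proof -
  have "clinear (\<lambda>x. (of_nat n * B a (component x n)) *\<^sub>C 1)"
    by (rule clinearI) (simp_all add: clinear_add[OF clinear_component]
        clinear_scale[OF clinear_component] form_simps algebra_simps scaleC_add_left)
  from someI_ex[OF derivation_extension[OF this], folded annihilate_def]
  show "clinear (annihilate a n)" "annihilate a n 1 = 0"
    "annihilate a n (tensor_gen x * u) =
      (of_nat n * B a (component x n)) *\<^sub>C u + tensor_gen x * annihilate a n u"
    by (simp_all add: mult_scaleC_left)
qed

lemmas annihilate_add = clinear_add[OF clinear_annihilate]
  and annihilate_scaleC = clinear_scale[OF clinear_annihilate]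
  and annihilate_zero [simp] = clinear_zero[OF clinear_annihilate]
  and annihilate_sum = clinear_sum[OF clinear_annihilate]

lemma clinear_create: "clinear (create a k)"
  by (rule clinearI) (simp_all add: create_def distrib_left mult_scaleC_right)

lemmas create_add = clinear_add[OF clinear_create]
  and create_scaleC = clinear_scale[OF clinear_create]
  and create_zero [simp] = clinear_zero[OF clinear_create]
  and create_diff = clinear_diff[OF clinear_create]
  and create_sum = clinear_sum[OF clinear_create]

lemma clinear_create_left: "clinear (\<lambda>a. create a k u)"
  by (rule clinearI) (simp_all add: create_def clinear_add[OF clinear_mode] clinear_scale[OF clinear_mode]
      tensor_gen_add tensor_gen_scaleC distrib_right mult_scaleC_left)

lemma create_0 [simp]: "create a 0 u = 0"
  by (simp add: create_def clinear_zero[OF clinear_tensor_gen])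

lemma annihilate_create:
  "annihilate a n (create b k u) =
    (if n = k then (of_nat n * B a b) *\<^sub>C u else 0) + create b k (annihilate a n u)"
  by (auto simp: create_def annihilate_gen component_mode form_zero)

text \<open>A generator is a finite sum of modes, so multiplication by single modes with k \<ge> 1
  suffices. Most later inductions on vectors have this form.\<close>

lemma create_induct [case_names one create add scale]:
  fixes P :: "'a heis_module \<Rightarrow> bool"
  assumes "P 1" "\<And>a k u. k \<ge> 1 \<Longrightarrow> P u \<Longrightarrow> P (create a k u)"
    "\<And>u v. P u \<Longrightarrow> P v \<Longrightarrow> P (u + v)" "\<And>c u. P u \<Longrightarrow> P (c *\<^sub>C u)"
  shows "P u"
proof (induction u rule: tensor_induct)
  case (mult x u)
  obtain N where N: "x = (\<Sum>k=1..N. mode (component x k) k)"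
    using mode_decomposition by blast
  have "P 0"
    using assms(4)[OF assms(1), of 0] by simp
  have "P (\<Sum>k\<in>I. create (component x k) k u)" if "finite I" "I \<subseteq> {1..N}" for I
    using that(1,2) \<open>P 0\<close> by (induction I rule: finite_induct) (auto intro!: assms(2,3) mult)
  from this[of "{1..N}"] show ?case
    by (subst N) (simp add: create_def clinear_sum[OF clinear_tensor_gen] sum_distrib_right)
qed (use assms in auto)

lemma annihilate_0 [simp]: "annihilate a 0 u = 0"
  by (induction u rule: create_induct)
    (simp_all add: annihilate_add annihilate_scaleC annihilate_create)

lemma clinear_annihilate_left: "clinear (\<lambda>a. annihilate a n u)"
proof (rule clinearI)
  show "annihilate (a + b) n u = annihilate a n u + annihilate b n u" for a b
    by (induction u rule: create_induct)
      (simp_all add: annihilate_add annihilate_scaleC annihilate_create create_add form_simps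
        algebra_simps scaleC_add_left scaleC_add_right)
  show "annihilate (c *\<^sub>C a) n u = c *\<^sub>C annihilate a n u" for a c
    by (induction u rule: create_induct)
      (simp_all add: annihilate_add annihilate_scaleC annihilate_create create_scaleC form_simps
        algebra_simps scaleC_add_right)
qed

lemma annihilate_commute: "annihilate a m (annihilate b n u) = annihilate b n (annihilate a m u)"
  by (induction u rule: create_induct)
    (simp_all add: annihilate_add annihilate_scaleC annihilate_create)

text \<open>A product of modes is killed as soon as n exceeds all of them, whatever a is. This makes
  sums over annihilation modes finite on a fixed vector.\<close>

lemma annihilate_eventually_0: "\<exists>N. \<forall>n>N. \<forall>a. annihilate a n u = 0"
proof (induction u rule: create_induct)
  case (create a k u)
  then obtain N where "\<forall>n>N. \<forall>a. annihilate a n u = 0" by blast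
  then show ?case
    by (intro exI[of _ "max k N"]) (auto simp: annihilate_create)
next
  case (add u v)
  then obtain N M where "\<forall>n>N. \<forall>a. annihilate a n u = 0" "\<forall>n>M. \<forall>a. annihilate a n v = 0" by blast
  then show ?case
    by (intro exI[of _ "max M N"]) (auto simp: annihilate_add)
next
  case (scale c u)
  then show ?case by (auto simp: annihilate_scaleC)
qed simp

definition act :: "'a \<Rightarrow> int \<Rightarrow> 'a heis_module \<Rightarrow> 'a heis_module" where
  "act a n = (if n < 0 then create a (nat (- n)) else annihilate a (nat n))"

lemma clinear_act: "clinear (act a n)"
  by (simp add: act_def clinear_create clinear_annihilate)

lemma clinear_act_left: "clinear (\<lambda>a. act a n u)"
  by (cases "n < 0") (simp_all add: act_def clinear_create_left clinear_annihilate_left)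

lemma act_zero_mode [simp]: "act a 0 u = 0"
  by (simp add: act_def)

section \<open>Identification with the induced module\<close>

text \<open>The representation of \<open>T(H)\<close> on \<open>T(H\<^sub>-)\<close> by the operators \<^const>\<open>act\<close>.  It factors through \<open>N(H)\<close>
  and separates the elements \<open>w \<otimes> 1\<close> of the induced module.\<close>

definition act_gen :: "'a affinization \<Rightarrow> 'a heis_module \<Rightarrow> 'a heis_module" where
  "act_gen x w = (\<Sum>n\<in>Poly_Mapping.keys (fst x). act (Poly_Mapping.lookup (fst x) n) n w) + snd x *\<^sub>C w"

lemma act_gen_superset:
  assumes "finite A" "Poly_Mapping.keys (fst x) \<subseteq> A"
  shows "act_gen x w = (\<Sum>n\<in>A. act (Poly_Mapping.lookup (fst x) n) n w) + snd x *\<^sub>C w"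
  unfolding act_gen_def
  by (subst sum.mono_neutral_left[OF assms])
    (auto simp: in_keys_iff clinear_zero[OF clinear_act_left])

lemma clinear_act_gen: "clinear (act_gen x)"
  by (rule clinearI)
    (simp_all add: act_gen_def clinear_add[OF clinear_act] clinear_scale[OF clinear_act]
      sum.distrib scaleC_add_right scaleC_sum_right mult.commute)

lemma clinear_act_gen_left: "clinear (\<lambda>x. act_gen x w)"
proof (rule clinearI)
  fix x y :: "'a affinization" and c
  let ?A = "Poly_Mapping.keys (fst x) \<union> Poly_Mapping.keys (fst y)"
  have "act_gen (x + y) w =
      (\<Sum>n\<in>?A. act (Poly_Mapping.lookup (fst (x + y)) n) n w) + snd (x + y) *\<^sub>C w"
    using Poly_Mapping.keys_add[of "fst x" "fst y"] by (intro act_gen_superset) auto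
  then show "act_gen (x + y) w = act_gen x w + act_gen y w"
    by (simp add: act_gen_superset[of ?A x] act_gen_superset[of ?A y] lookup_add sum.distrib
        clinear_add[OF clinear_act_left] scaleC_add_left)
  have "act_gen (c *\<^sub>C x) w = (\<Sum>n\<in>Poly_Mapping.keys (fst x).
      act (Poly_Mapping.lookup (fst (c *\<^sub>C x)) n) n w) + snd (c *\<^sub>C x) *\<^sub>C w"
    by (intro act_gen_superset)
      (auto simp: in_keys_iff scaleC_prod_def scaleC_poly_mapping.rep_eq)
  then show "act_gen (c *\<^sub>C x) w = c *\<^sub>C act_gen x w"
    by (simp add: act_gen_def scaleC_add_right scaleC_sum_right scaleC_prod_def
        scaleC_poly_mapping.rep_eq clinear_scale[OF clinear_act_left])
qed

lemma act_gen_aff [simp]: "act_gen (aff a n) w = act a n w"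
  by (subst act_gen_superset[of "{n}"]) (auto simp: aff_def)

lemma act_gen_central [simp]: "act_gen central w = w"
  by (simp add: act_gen_def central_def)

lemma act_gen_Rep [simp]: "act_gen (Rep_aff_minus x) w = tensor_gen x * w"
proof -
  obtain N where N: "x = (\<Sum>k=1..N. mode (component x k) k)"
    using mode_decomposition by blast
  have lin: "clinear (\<lambda>x. act_gen (Rep_aff_minus x) w)" "clinear (\<lambda>x. tensor_gen x * w)"
    by (rule clinearI; simp add: clinear_add[OF clinear_act_gen_left] clinear_scale[OF clinear_act_gen_left]
        plus_aff_minus.rep_eq scaleC_aff_minus.rep_eq tensor_gen_add tensor_gen_scaleC distrib_right
        mult_scaleC_left)+
  have "act_gen (Rep_aff_minus (mode a k)) w = tensor_gen (mode a k) * w" if "k \<ge> 1" for a k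
    using that by (simp add: Rep_mode act_def create_def)
  then show ?thesis
    by (subst (1 2) N) (simp add: clinear_sum[OF lin(1)] clinear_sum[OF lin(2)])
qed

text \<open>The recursion is on \<open>p\<close> with start vector \<open>v\<close>, so linearity in
  \<open>p\<close> is built in, while linearity in \<open>v\<close> and compatibility with products
  are separate inductions.\<close>

definition act_tensor :: "'a affinization tensor_algebra \<Rightarrow> 'a heis_module \<Rightarrow> 'a heis_module" where
  "act_tensor p v = (SOME F. clinear F \<and> F 1 = v \<and>
     (\<forall>x u. F (tensor_gen x * u) = act_gen x (F u))) p"

lemma act_tensor:
  shows clinear_act_tensor_left: "clinear (\<lambda>p. act_tensor p v)"
    and act_tensor_1 [simp]: "act_tensor 1 v = v"
    and act_tensor_gen: "act_tensor (tensor_gen x * u) v = act_gen x (act_tensor u v)"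
proof -
  note * = someI_ex[OF tensor_recursion[of act_gen v, OF clinear_act_gen clinear_act_gen_left],
      folded act_tensor_def[abs_def]]
  show "clinear (\<lambda>p. act_tensor p v)" "act_tensor 1 v = v"
    "act_tensor (tensor_gen x * u) v = act_gen x (act_tensor u v)"
    unfolding act_tensor_def
    by (rule *[THEN conjunct1] *[THEN conjunct2, THEN conjunct1]
        *[THEN conjunct2, THEN conjunct2, rule_format])+
qed

lemmas act_tensor_add_left = clinear_add[OF clinear_act_tensor_left]
  and act_tensor_scaleC_left = clinear_scale[OF clinear_act_tensor_left]
  and act_tensor_diff_left = clinear_diff[OF clinear_act_tensor_left]
  and act_tensor_zero_left [simp] = clinear_zero[OF clinear_act_tensor_left]

lemma clinear_act_tensor: "clinear (act_tensor p)"
proof (rule clinearI)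
  show "act_tensor p (u + v) = act_tensor p u + act_tensor p v" for u v
    by (induction p rule: tensor_induct)
      (simp_all add: act_tensor_add_left act_tensor_scaleC_left act_tensor_gen
        clinear_add[OF clinear_act_gen] scaleC_add_right)
  show "act_tensor p (c *\<^sub>C u) = c *\<^sub>C act_tensor p u" for c u
    by (induction p rule: tensor_induct)
      (simp_all add: act_tensor_add_left act_tensor_scaleC_left act_tensor_gen
        clinear_scale[OF clinear_act_gen] scaleC_add_right mult.commute)
qed

lemma act_tensor_mult: "act_tensor (p * q) v = act_tensor p (act_tensor q v)"
  by (induction p rule: tensor_induct)
    (simp_all add: act_tensor_add_left act_tensor_scaleC_left act_tensor_gen mult_scaleC_left
      distrib_right mult.assoc)

lemma act_tensor_gen1 [simp]: "act_tensor (tensor_gen x) v = act_gen x v"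
  using act_tensor_gen[of x 1 v] by simp

text \<open>The operators satisfy the relators: annihilation and creation operators obey the
  Heisenberg relation, zero modes act by 0 and \<open>central\<close> acts by the identity. Keeping
  \<open>v\<close> arbitrary covers multiples on the right.\<close>

lemma act_tensor_ideal:
  "p \<in> ideal_generated (heis_relators B) \<Longrightarrow> act_tensor p v = 0"
proof (induction arbitrary: v rule: ideal_generated.induct)
  case (gen p)
  have "act a m (act b n v) - act b n (act a m v) -
      (of_int m * B a b * (if m + n = 0 then 1 else 0)) *\<^sub>C v = 0" if "m > 0" "n < 0" for a b m n
    using that by (auto simp: act_def annihilate_create nat_eq_iff)
  with gen show ?case
    by (auto simp: heis_relators_def act_tensor_diff_left act_tensor_mult act_tensor_scaleC_left
        clinear_zero[OF clinear_act])
qed (simp_all add: act_tensor_add_left act_tensor_mult clinear_zero[OF clinear_act_tensor])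

text \<open>All modes n \<ge> 0 kill 1, so on the vacuum a generator acts by the same scalar as on
  the trivial module. This is the compatibility with the balancing relations of the tensor
  product.\<close>

lemma act_tensor_nonneg:
  assumes "s \<in> heis_nonneg"
  shows "act_tensor s 1 = vac_char s *\<^sub>C 1"
proof -
  have lin: "clinear (snd :: 'a affinization \<Rightarrow> complex)"
    by (rule clinearI) (simp_all add: scaleC_prod_def)
  have hom: "clinear (vac_char :: 'a affinization tensor_algebra \<Rightarrow> complex)" "vac_char (1 :: 'a affinization tensor_algebra) = 1"
    "\<And>x y :: 'a affinization tensor_algebra. vac_char (x * y) = vac_char x * vac_char y"
    "\<And>x :: 'a affinization. vac_char (tensor_gen x) = snd x"
    using algebra_hom_tensor_extend[OF lin] tensor_extend_gen[OF lin]
    by (simp_all add: vac_char_def algebra_hom_def)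
  show ?thesis
    using assms unfolding heis_nonneg_def
  proof (induction rule: subalgebra_generated.induct)
    case (gen s)
    then obtain x where x: "s = tensor_gen x" "x \<in> aff_plus \<union> aff_zero" by auto
    have "act (Poly_Mapping.lookup (fst x) n) n 1 = 0" for n
      using x(2) by (cases "n < 0")
        (auto simp: aff_plus_def aff_zero_def clinear_zero[OF clinear_act_left] act_def
          clinear_zero[OF clinear_create_left])
    then show ?case
      by (simp add: x hom act_gen_def)
  qed (simp_all add: hom clinear_add[OF hom(1)] clinear_scale[OF hom(1)] act_tensor_add_left
      act_tensor_scaleC_left act_tensor_mult scaleC_add_left clinear_scale[OF clinear_act_tensor] mult.commute)
qed

section \<open>The induced module as a quotient, and its evaluation at the vacuum\<close>

lemma ind_relations_subspace: "cvs.subspace (ind_relations B)"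
  unfolding ind_relations_def by (rule cvs.subspace_span)

lemma ind_tensor_eq_iff:
  "ind_tensor B p c = ind_tensor B q d \<longleftrightarrow> ind_pair B p c - ind_pair B q d \<in> ind_relations B"
proof
  assume "ind_tensor B p c = ind_tensor B q d"
  then have "ind_pair B p c \<in> ind_tensor B q d"
    using cvs.subspace_0[OF ind_relations_subspace] unfolding ind_tensor_def by auto
  then show "ind_pair B p c - ind_pair B q d \<in> ind_relations B"
    by (simp add: ind_tensor_def)
next
  assume *: "ind_pair B p c - ind_pair B q d \<in> ind_relations B"
  have "f - ind_pair B p c \<in> ind_relations B \<longleftrightarrow> f - ind_pair B q d \<in> ind_relations B" for f
    using cvs.subspace_add[OF ind_relations_subspace _ *, of "f - ind_pair B p c"]
      cvs.subspace_diff[OF ind_relations_subspace _ *, of "f - ind_pair B q d"] by auto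
  then show "ind_tensor B p c = ind_tensor B q d"
    by (auto simp: ind_tensor_def)
qed

lemma heis_class_eqD:
  assumes "heis_class B p = heis_class B q"
  shows "p - q \<in> ideal_generated (heis_relators B)"
proof -
  have "p \<in> heis_class B p" by (simp add: heis_class_def ideal_generated.zero)
  with assms show ?thesis by (simp add: heis_class_def)
qed

lemma heis_class_eqI:
  assumes "p - q \<in> ideal_generated (heis_relators B)"
  shows "heis_class B p = heis_class B q"
proof -
  have "r - p \<in> ideal_generated (heis_relators B) \<longleftrightarrow> r - q \<in> ideal_generated (heis_relators B)" for r
    using ideal_generated.add[OF _ assms, of "r - p"] ideal_generated_diff[OF _ assms, of "r - q"] by auto
  then show ?thesis by (simp add: heis_class_def)
qed

text \<open>The map p \<otimes> c \<mapsto> c (p 1) is well defined on the induced module: it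
  respects cosets by \<open>act_tensor_ideal\<close> and balancing by
  \<open>act_tensor_nonneg\<close>. It supplies the uniqueness in the description of a(n).\<close>

lemma act_tensor_eq_of_ind_tensor_eq:
  assumes "ind_tensor B p 1 = ind_tensor B q 1"
  shows "act_tensor p 1 = act_tensor q 1"
proof -
  \<comment> \<open>A choice of representative. On sets that are not cosets the value is arbitrary,
    but \<open>ind_pair\<close> produces cosets only.\<close>
  define val where "val C = act_tensor (SOME p. heis_class B p = C) 1" for C
  have val: "val (heis_class B p) = act_tensor p 1" for p
  proof -
    have "heis_class B (SOME q. heis_class B q = heis_class B p) = heis_class B p"
      by (rule someI) simp
    from act_tensor_ideal[OF heis_class_eqD[OF this]] show ?thesis
      by (simp add: val_def act_tensor_diff_left)
  qed
  obtain \<Phi> :: "'a ind_free \<Rightarrow> 'a heis_module" where \<Phi>: "clinear \<Phi>"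
    "\<And>k c. \<Phi> (Poly_Mapping.single k c) = c *\<^sub>C (snd k *\<^sub>C val (fst k))"
    using poly_mapping_extension[of "\<lambda>k. snd k *\<^sub>C val (fst k)"] by blast
  note lin = clinear_add[OF \<Phi>(1)] clinear_scale[OF \<Phi>(1)] clinear_diff[OF \<Phi>(1)] clinear_zero[OF \<Phi>(1)]
  have pair: "\<Phi> (ind_pair B p c) = c *\<^sub>C act_tensor p 1" for p c
    by (simp add: ind_pair_def \<Phi> val)
  have "\<Phi> f = 0" if "f \<in> ind_relations B" for f
    using that unfolding ind_relations_def
  proof (induction rule: cvs.span_induct_alt)
    case (step c x y)
    then have "\<Phi> x = 0"
      by (auto simp: lin pair act_tensor_add_left act_tensor_scaleC_left scaleC_add_left
          scaleC_add_right act_tensor_mult act_tensor_nonneg clinear_scale[OF clinear_act_tensor]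
          mult.commute)
    with step show ?case by (simp add: lin)
  qed (simp add: lin)
  from this[of "ind_pair B p 1 - ind_pair B q 1"] show ?thesis
    using assms by (simp add: ind_tensor_eq_iff lin pair)
qed

lemma minus_incl:
  shows clinear_minus_incl: "clinear (minus_incl :: 'a heis_module \<Rightarrow> _)"
    and minus_incl_1 [simp]: "minus_incl (1 :: 'a heis_module) = 1"
    and minus_incl_mult: "minus_incl (u * v) = minus_incl u * minus_incl (v :: 'a heis_module)"
    and minus_incl_gen: "minus_incl (tensor_gen x :: 'a heis_module) = tensor_gen (Rep_aff_minus x)"
proof -
  have lin: "clinear (\<lambda>x :: 'a aff_minus. tensor_gen (Rep_aff_minus x))"
    by (rule clinearI) (simp_all add: plus_aff_minus.rep_eq scaleC_aff_minus.rep_eq tensor_gen_add tensor_gen_scaleC)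
  show "clinear (minus_incl :: 'a heis_module \<Rightarrow> _)" "minus_incl (1 :: 'a heis_module) = 1"
    "minus_incl (u * v) = minus_incl u * minus_incl (v :: 'a heis_module)"
    "minus_incl (tensor_gen x :: 'a heis_module) = tensor_gen (Rep_aff_minus x)"
    using algebra_hom_tensor_extend[OF lin] tensor_extend_gen[OF lin]
    by (simp_all add: minus_incl_def algebra_hom_def)
qed

text \<open>Negative modes act by multiplication. Together with the previous evaluation map this
  makes w \<mapsto> w \<otimes> 1 injective.\<close>

lemma act_tensor_minus_incl: "act_tensor (minus_incl w) 1 = w"
  by (induction w rule: tensor_induct)
    (simp_all add: minus_incl_mult minus_incl_gen act_tensor_gen clinear_add[OF clinear_minus_incl]
      clinear_scale[OF clinear_minus_incl] act_tensor_add_left act_tensor_scaleC_left)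

lemma minus_incl_create:
  "k \<ge> 1 \<Longrightarrow> minus_incl (create a k u) = tensor_gen (aff a (- int k)) * minus_incl u"
  by (simp add: create_def minus_incl_mult minus_incl_gen Rep_mode)

section \<open>Moving annihilation operators to the vacuum in the induced module\<close>

definition ind_equiv :: "'a affinization tensor_algebra \<Rightarrow> 'a affinization tensor_algebra \<Rightarrow> bool" where
  "ind_equiv p q \<longleftrightarrow> ind_tensor B p 1 = ind_tensor B q 1"

lemma ind_equiv_trans [trans]: "ind_equiv p q \<Longrightarrow> ind_equiv q r \<Longrightarrow> ind_equiv p r"
  by (simp add: ind_equiv_def)

lemma ind_equiv_sym: "ind_equiv p q \<Longrightarrow> ind_equiv q p"
  by (simp add: ind_equiv_def)

lemma ind_equiv_ideal: "p - q \<in> ideal_generated (heis_relators B) \<Longrightarrow> ind_equiv p q"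
  using heis_class_eqI[of p q] by (simp add: ind_equiv_def ind_tensor_def ind_pair_def)

lemma ind_pair_add: "ind_pair B (p + q) c - ind_pair B p c - ind_pair B q c \<in> ind_relations B"
  unfolding ind_relations_def by (rule cvs.span_base) blast

lemma ind_pair_scaleC: "ind_pair B (z *\<^sub>C p) c - z *\<^sub>C ind_pair B p c \<in> ind_relations B"
  unfolding ind_relations_def by (rule cvs.span_base) blast

lemma ind_pair_scaleC_right: "ind_pair B p (z * c) - z *\<^sub>C ind_pair B p c \<in> ind_relations B"
  unfolding ind_relations_def by (rule cvs.span_base) blast

lemma ind_pair_balanced:
  "s \<in> heis_nonneg \<Longrightarrow> ind_pair B (p * s) c - ind_pair B p (vac_char s * c) \<in> ind_relations B"
  unfolding ind_relations_def by (rule cvs.span_base) blast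

lemma ind_equiv_add:
  assumes "ind_equiv p p'" "ind_equiv q q'"
  shows "ind_equiv (p + q) (p' + q')"
proof -
  have "(ind_pair B (p + q) 1 - ind_pair B p 1 - ind_pair B q 1)
      - (ind_pair B (p' + q') 1 - ind_pair B p' 1 - ind_pair B q' 1)
      + (ind_pair B p 1 - ind_pair B p' 1) + (ind_pair B q 1 - ind_pair B q' 1) \<in> ind_relations B"
    using assms unfolding ind_equiv_def ind_tensor_eq_iff
    by (intro cvs.subspace_add[OF ind_relations_subspace]
        cvs.subspace_diff[OF ind_relations_subspace ind_pair_add ind_pair_add])
  then show ?thesis
    by (simp add: ind_equiv_def ind_tensor_eq_iff algebra_simps)
qed

lemma ind_equiv_scaleC:
  assumes "ind_equiv p q"
  shows "ind_equiv (c *\<^sub>C p) (c *\<^sub>C q)"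
proof -
  have "(ind_pair B (c *\<^sub>C p) 1 - c *\<^sub>C ind_pair B p 1) - (ind_pair B (c *\<^sub>C q) 1 - c *\<^sub>C ind_pair B q 1)
      + c *\<^sub>C (ind_pair B p 1 - ind_pair B q 1) \<in> ind_relations B"
    using assms unfolding ind_equiv_def ind_tensor_eq_iff
    by (intro cvs.subspace_add[OF ind_relations_subspace] cvs.subspace_scale[OF ind_relations_subspace]
        cvs.subspace_diff[OF ind_relations_subspace ind_pair_scaleC ind_pair_scaleC])
  then show ?thesis
    by (simp add: ind_equiv_def ind_tensor_eq_iff algebra_simps cvs.scale_right_diff_distrib)
qed

lemma ind_equiv_balanced:
  assumes "s \<in> heis_nonneg"
  shows "ind_equiv (p * s) (vac_char s *\<^sub>C p)"
proof -
  let ?z = "vac_char s"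
  have "(ind_pair B (p * s) 1 - ind_pair B p (?z * 1)) + (ind_pair B p (?z * 1) - ?z *\<^sub>C ind_pair B p 1)
      - (ind_pair B (?z *\<^sub>C p) 1 - ?z *\<^sub>C ind_pair B p 1) \<in> ind_relations B"
    by (rule cvs.subspace_diff[OF ind_relations_subspace cvs.subspace_add[OF ind_relations_subspace
          ind_pair_balanced[OF assms] ind_pair_scaleC_right] ind_pair_scaleC])
  then show ?thesis
    by (simp add: ind_equiv_def ind_tensor_eq_iff)
qed

lemma ind_equiv_gen:
  assumes "x \<in> aff_plus \<union> aff_zero"
  shows "ind_equiv (p * tensor_gen x) (snd x *\<^sub>C p)"
proof -
  have lin: "clinear (snd :: 'a affinization \<Rightarrow> complex)"
    by (rule clinearI) (simp_all add: scaleC_prod_def)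
  have "tensor_gen x \<in> heis_nonneg"
    using assms unfolding heis_nonneg_def by (intro subalgebra_generated.gen) auto
  from ind_equiv_balanced[OF this, of p] show ?thesis
    by (simp add: vac_char_def tensor_extend_gen[OF lin])
qed

text \<open>The relators let \<open>central\<close> pass one generator at a time; an induction
  carries it through a whole product of creation modes.\<close>

lemma central_commutes:
  "tensor_gen central * minus_incl u - minus_incl u * tensor_gen central
    \<in> ideal_generated (heis_relators B)" for u :: "'a heis_module"
proof (induction u rule: create_induct)
  case (create a k u)
  let ?x = "tensor_gen (aff a (- int k))" and ?c = "tensor_gen central" and ?u = "minus_incl u"
  have "?x * ?c - ?c * ?x \<in> ideal_generated (heis_relators B)"
    by (rule ideal_generated.gen) (unfold heis_relators_def, blast)
  \<comment> \<open>The two terms x c u cancel, leaving c x u - x u c.\<close>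
  then have "?x * (?c * ?u - ?u * ?c) - (?x * ?c - ?c * ?x) * ?u \<in> ideal_generated (heis_relators B)"
    by (rule ideal_generated_diff[OF ideal_generated.mult_left[OF create(2)] ideal_generated.mult_right])
  with create show ?case
    by (simp add: minus_incl_create algebra_simps)
next
  case (add u v)
  from ideal_generated.add[OF this] show ?case
    by (simp add: clinear_add[OF clinear_minus_incl] algebra_simps)
next
  case (scale c u)
  from ideal_generated.mult_left[OF this, of "c *\<^sub>C 1"] show ?case
    by (simp add: clinear_scale[OF clinear_minus_incl] algebra_simps mult_scaleC_left mult_scaleC_right)
qed (simp add: ideal_generated.zero)

text \<open>The mode is moved to the right until it reaches the vacuum and dies. Passing b(-k)
  leaves b(-k) on its left, which the arbitrary factor \<open>r\<close> absorbs, and a multiple of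
  \<open>central\<close>, which passes on to the vacuum and becomes 1.\<close>

lemma ind_equiv_annihilate:
  "ind_equiv (r * (tensor_gen (aff a (int n)) * minus_incl u)) (r * minus_incl (annihilate a n u))"
proof (induction u arbitrary: r rule: create_induct)
  case one
  have "aff a (int n) \<in> aff_plus \<union> aff_zero"
    by (cases "n = 0") (auto simp: aff_def aff_plus_def aff_zero_def lookup_single when_def)
  from ind_equiv_gen[OF this, of r] show ?case
    by (simp add: aff_def clinear_zero[OF clinear_minus_incl])
next
  case (create b k u)
  let ?a = "tensor_gen (aff a (int n))" and ?b = "tensor_gen (aff b (- int k))"
    and ?c = "tensor_gen central" and ?u = "minus_incl u"
  \<comment> \<open>The contraction of a(n) with b(-k); it vanishes for the zero mode because k
    \<ge> 1.\<close>
  define z where "z = (if n = k then of_nat n * B a b else 0)"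
  have central: "central \<in> aff_plus \<union> (aff_zero :: 'a affinization set)"
    by (simp add: central_def aff_zero_def)
  have rel: "?a * ?b - ?b * ?a - z *\<^sub>C ?c \<in> ideal_generated (heis_relators B)"
  proof (cases "n = 0")
    case True
    have "?b * ?a - ?a * ?b \<in> ideal_generated (heis_relators B)"
      using True create(1) unfolding heis_relators_def
      by (intro ideal_generated.gen) force
    from ideal_generated_diff[OF ideal_generated.zero this] show ?thesis
      using True create(1) by (simp add: z_def)
  next
    case False
    have "?a * ?b - ?b * ?a - z *\<^sub>C ?c \<in> heis_relators B"
      unfolding heis_relators_def
      by (rule UnI1, rule UnI1, rule CollectI,
          rule exI[of _ a], rule exI[of _ b], rule exI[of _ "int n"], rule exI[of _ "- int k"])
        (use False create(1) in \<open>simp add: z_def\<close>)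
    then show ?thesis by (rule ideal_generated.gen)
  qed
  \<comment> \<open>A multiple of the commutation relation plus a multiple of centrality: their sum
    is the difference between r a(n) b(-k) u and its reordered form with \<open>central\<close> at
    the far right.\<close>
  have "r * ((?a * ?b - ?b * ?a - z *\<^sub>C ?c) * ?u) + r * (z *\<^sub>C 1) * (?c * ?u - ?u * ?c)
      \<in> ideal_generated (heis_relators B)"
    by (intro ideal_generated.add ideal_generated.mult_left ideal_generated.mult_right rel central_commutes)
  also have "r * ((?a * ?b - ?b * ?a - z *\<^sub>C ?c) * ?u) + r * (z *\<^sub>C 1) * (?c * ?u - ?u * ?c) =
      r * (?a * (?b * ?u)) - ((r * ?b) * (?a * ?u) + (z *\<^sub>C r) * ?u * ?c)"
    by (simp add: algebra_simps mult_scaleC_left mult_scaleC_right)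
  finally have "ind_equiv (r * (?a * (?b * ?u))) ((r * ?b) * (?a * ?u) + (z *\<^sub>C r) * ?u * ?c)"
    by (rule ind_equiv_ideal)
  also have "ind_equiv \<dots> ((r * ?b) * minus_incl (annihilate a n u) + 1 *\<^sub>C ((z *\<^sub>C r) * ?u))"
    using ind_equiv_gen[OF central, of "(z *\<^sub>C r) * ?u"]
    by (intro ind_equiv_add create) (simp add: central_def)
  also have "(r * ?b) * minus_incl (annihilate a n u) + 1 *\<^sub>C ((z *\<^sub>C r) * ?u) =
      r * minus_incl (annihilate a n (create b k u))"
    using create(1)
    by (simp add: annihilate_create clinear_add[OF clinear_minus_incl] minus_incl_create z_def
        clinear_scale[OF clinear_minus_incl] algebra_simps mult_scaleC_left mult_scaleC_right
        clinear_zero[OF clinear_minus_incl] scaleC_one)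
  finally show ?case
    using create(1) by (simp add: minus_incl_create)
next
  case (add u v)
  from ind_equiv_add[OF add(1)[of r] add(2)[of r]] show ?case
    by (simp add: clinear_add[OF clinear_minus_incl] annihilate_add algebra_simps)
next
  case (scale c u)
  from ind_equiv_scaleC[OF this, of c r] show ?case
    by (simp add: clinear_scale[OF clinear_minus_incl] annihilate_scaleC mult_scaleC_right)
qed

text \<open>Existence of the described vector is \<open>ind_equiv_annihilate\<close>, while for n <
  0 the two representatives coincide. Uniqueness is evaluation at the vacuum.\<close>

lemma heis_op_eq_act: "heis_op B a n = act a n"
proof
  fix v
  have equiv: "ind_equiv (minus_incl (act a n v)) (tensor_gen (aff a n) * minus_incl v)"
  proof (cases "n < 0")
    case True
    then show ?thesis by (simp add: act_def minus_incl_create ind_equiv_def)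
  next
    case False
    then show ?thesis
      using ind_equiv_annihilate[of 1 a "nat n" v, THEN ind_equiv_sym] by (simp add: act_def)
  qed
  show "heis_op B a n v = act a n v"
    unfolding heis_op_def
  proof (rule the_equality)
    show "ind_tensor B (minus_incl (act a n v)) 1 = ind_tensor B (tensor_gen (aff a n) * minus_incl v) 1"
      using equiv by (simp add: ind_equiv_def)
    fix w
    assume "ind_tensor B (minus_incl w) 1 = ind_tensor B (tensor_gen (aff a n) * minus_incl v) 1"
    with equiv have "ind_tensor B (minus_incl w) 1 = ind_tensor B (minus_incl (act a n v)) 1"
      by (simp add: ind_equiv_def)
    from act_tensor_eq_of_ind_tensor_eq[OF this] show "w = act a n v"
      by (simp add: act_tensor_minus_incl)
  qed
qed

end


section \<open>The grading\<close>

lemma clinear_Sum_any: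
  assumes lin: "\<And>k. clinear (s k)" and fin: "\<And>x. finite {k. s k x \<noteq> 0}"
  shows "clinear (\<lambda>x. Sum_any (\<lambda>k. s k x))"
proof (rule clinearI)
  show "Sum_any (\<lambda>k. s k (x + y)) = Sum_any (\<lambda>k. s k x) + Sum_any (\<lambda>k. s k y)" for x y
    by (simp add: clinear_add[OF lin] Sum_any.distrib[OF fin fin])
  fix c x
  have "Sum_any (\<lambda>k. s k (c *\<^sub>C x)) = (\<Sum>k | s k x \<noteq> 0. c *\<^sub>C s k x)"
    unfolding clinear_scale[OF lin] by (rule Sum_any.expand_superset[OF fin]) auto
  then show "Sum_any (\<lambda>k. s k (c *\<^sub>C x)) = c *\<^sub>C Sum_any (\<lambda>k. s k x)"
    by (simp add: Sum_any.expand_set scaleC_sum_right)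
qed

lemma finite_components: "finite {k. component x k \<noteq> 0}"
proof (rule finite_subset)
  show "{k. component x k \<noteq> 0} \<subseteq> (\<lambda>n. nat (- n)) ` Poly_Mapping.keys (fst (Rep_aff_minus x))"
  proof
    fix k assume "k \<in> {k. component x k \<noteq> 0}"
    then show "k \<in> (\<lambda>n. nat (- n)) ` Poly_Mapping.keys (fst (Rep_aff_minus x))"
      by (intro image_eqI[of _ _ "- int k"]) (auto simp: component_def in_keys_iff)
  qed
qed simp

text \<open>H_- is the direct sum of copies of the base space, one for each k \<ge> 1, so a linear
  map may be prescribed on each copy separately.\<close>

lemma mode_extension:
  fixes g :: "nat \<Rightarrow> 'a::complex_vector \<Rightarrow> 'b::complex_vector"
  assumes g: "\<And>k. clinear (g k)"
  shows "\<exists>\<phi>. clinear \<phi> \<and> (\<forall>a k. k \<ge> 1 \<longrightarrow> \<phi> (mode a k) = g k a)"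
proof (intro exI conjI allI impI)
  define \<phi> where "\<phi> x = Sum_any (\<lambda>k. g k (component x k))" for x
  show "clinear \<phi>"
    unfolding \<phi>_def
  proof (rule clinear_Sum_any)
    show "clinear (\<lambda>x. g k (component x k))" for k
      by (rule clinear_compose[OF g clinear_component])
    show "finite {k. g k (component x k) \<noteq> 0}" for x
      by (rule finite_subset[OF _ finite_components[of x]]) (auto simp: clinear_zero[OF g])
  qed
  show "\<phi> (mode a k) = g k a" if "k \<ge> 1" for a k
  proof -
    have "\<phi> (mode a k) = (\<Sum>l\<in>{k}. g l (component (mode a k) l))"
      unfolding \<phi>_def
      by (rule Sum_any.expand_superset) (auto simp: component_mode clinear_zero[OF g] split: if_splits)
    then show ?thesis using that by (simp add: component_mode)
  qed
qed

definition graded_total :: "(int \<Rightarrow>\<^sub>0 'v::complex_vector) \<Rightarrow> 'v" where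
  "graded_total f = (\<Sum>n\<in>Poly_Mapping.keys f. Poly_Mapping.lookup f n)"

lemma graded_total_superset:
  assumes "finite A" "Poly_Mapping.keys f \<subseteq> A"
  shows "graded_total f = (\<Sum>n\<in>A. Poly_Mapping.lookup f n)"
  unfolding graded_total_def
  by (rule sum.mono_neutral_left[OF assms]) (auto simp: in_keys_iff)

lemma clinear_graded_total: "clinear graded_total"
proof (rule clinearI)
  fix f g :: "int \<Rightarrow>\<^sub>0 'v::complex_vector" and c
  let ?A = "Poly_Mapping.keys f \<union> Poly_Mapping.keys g"
  show "graded_total (f + g) = graded_total f + graded_total g"
    using Poly_Mapping.keys_add[of f g]
    by (simp add: graded_total_superset[of ?A] lookup_add sum.distrib)
  show "graded_total (c *\<^sub>C f) = c *\<^sub>C graded_total f"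
    by (subst graded_total_superset[of "Poly_Mapping.keys f"])
      (auto simp: in_keys_iff scaleC_poly_mapping.rep_eq graded_total_def scaleC_sum_right)
qed

context heisenberg
begin

text \<open>With \<open>s\<close> the identity this gives the grading operator, with
  \<open>s = Suc\<close> the operator D.\<close>

lemma create_derivation:
  "\<exists>d. clinear d \<and> d 1 = 0 \<and>
    (\<forall>a k u. d (create a k u) = of_nat k *\<^sub>C create a (s k) u + create a k (d u))"
proof -
  have "clinear (\<lambda>a. of_nat k *\<^sub>C tensor_gen (mode a (s k)))" for k
    by (intro clinear_scaleC clinear_compose[OF clinear_tensor_gen clinear_mode])
  from mode_extension[of "\<lambda>k a. of_nat k *\<^sub>C tensor_gen (mode a (s k))", OF this]
  obtain \<phi> :: "'a aff_minus \<Rightarrow> 'a heis_module" where \<phi>: "clinear \<phi>"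
    "\<And>a k. k \<ge> 1 \<Longrightarrow> \<phi> (mode a k) = of_nat k *\<^sub>C tensor_gen (mode a (s k))" by blast
  obtain d where d: "clinear d" "d 1 = 0" "\<And>x u. d (tensor_gen x * u) = \<phi> x * u + tensor_gen x * d u"
    using derivation_extension[OF \<phi>(1)] by blast
  have "d (create a k u) = of_nat k *\<^sub>C create a (s k) u + create a k (d u)" for a k u
    by (cases "k = 0") (simp_all add: clinear_zero[OF d(1)] d(3) \<phi>(2) create_def[of _ k] create_def[of _ "s k"]
        mult_scaleC_left clinear_zero[OF clinear_tensor_gen])
  with d(1,2) show ?thesis by blast
qed

definition weight :: "'a heis_module \<Rightarrow> 'a heis_module" where
  "weight = (SOME d. clinear d \<and> d 1 = 0 \<and>
     (\<forall>a k u. d (create a k u) = of_nat k *\<^sub>C create a k u + create a k (d u)))"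

lemma weight:
  shows clinear_weight: "clinear weight" and weight_1: "weight 1 = 0"
    and weight_create: "weight (create a k u) = of_nat k *\<^sub>C create a k u + create a k (weight u)"
  using someI_ex[OF create_derivation[of "\<lambda>k. k"], folded weight_def] by blast+

abbreviation V :: "int \<Rightarrow> 'a heis_module set" where
  "V \<equiv> heis_grading B"

lemma heis_monomial_Nil [simp]: "heis_monomial B [] = 1"
  by (simp add: heis_monomial_def heis_product_def)

lemma heis_monomial_Cons:
  "m \<ge> 1 \<Longrightarrow> heis_monomial B ((a, m) # ams) = create a m (heis_monomial B ams)"
  by (simp add: heis_monomial_def heis_product_def heis_op_eq_act act_def)

lemma positive_modes_simps [simp]:
  "positive_modes []" "positive_modes ((a, m) # ams) \<longleftrightarrow> 1 \<le> m \<and> positive_modes ams"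
  by (auto simp: positive_modes_def)

lemma monomial_induct [case_names Nil Cons, consumes 1]:
  assumes "positive_modes ams" "P []"
    "\<And>a m ams. 1 \<le> m \<Longrightarrow> positive_modes ams \<Longrightarrow> P ams \<Longrightarrow> P ((a, m) # ams)"
  shows "P ams"
  using assms(1) by (induction ams) (auto simp: assms(2,3))

lemma subspace_grading: "cvs.subspace (V n)"
  unfolding heis_grading_def by (rule cvs.subspace_span)

lemmas grading_zero [simp] = cvs.subspace_0[OF subspace_grading]
  and grading_add = cvs.subspace_add[OF subspace_grading]
  and grading_scaleC = cvs.subspace_scale[OF subspace_grading]
  and grading_diff = cvs.subspace_diff[OF subspace_grading]

lemma monomial_in_grading:
  "positive_modes ams \<Longrightarrow> heis_monomial B ams \<in> V (int (\<Sum>(a, m)\<leftarrow>ams. m))"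
  unfolding heis_grading_def by (rule cvs.span_base) auto

lemma span_heis_monomial: "cvs.span (heis_monomial B ` Collect positive_modes) = UNIV"
proof -
  let ?S = "heis_monomial B ` Collect positive_modes"
  have "u \<in> cvs.span ?S" for u
  proof (induction u rule: create_induct)
    case one
    show ?case
      by (rule cvs.span_base, rule image_eqI[of _ _ "[]"]) simp_all
  next
    case (create a k u)
    from create(2) show ?case
    proof (induction rule: cvs.span_induct_alt)
      case (step c x y)
      then obtain ams where "x = heis_monomial B ams" "positive_modes ams" by auto
      with create(1) have "create a k x \<in> ?S"
        by (intro image_eqI[of _ _ "(a, k) # ams"]) (simp_all add: heis_monomial_Cons)
      with step(2) show ?case
        by (simp add: create_add create_scaleC cvs.span_add cvs.span_scale cvs.span_base)
    qed (simp add: cvs.span_zero)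
  qed (simp_all add: cvs.span_add cvs.span_scale)
  then show ?thesis by auto
qed

lemma monomial_linear_induct [case_names monomial add scale]:
  assumes "\<And>ams. positive_modes ams \<Longrightarrow> P (heis_monomial B ams)"
    "\<And>u v. P u \<Longrightarrow> P v \<Longrightarrow> P (u + v)" "\<And>c u. P u \<Longrightarrow> P (c *\<^sub>C u)"
  shows "P u"
proof -
  have "u \<in> cvs.span (heis_monomial B ` Collect positive_modes)"
    by (simp add: span_heis_monomial)
  then show ?thesis
  proof (induction rule: cvs.span_induct_alt)
    case base
    show ?case
      using assms(3)[OF assms(1)[of "[]"], of 0] by simp
  qed (auto intro!: assms)
qed

lemma grading_induct [consumes 1, case_names one zero add scale create]:
  assumes "u \<in> V n" "P 0 1" "\<And>n. P n 0"
    "\<And>n u v. P n u \<Longrightarrow> P n v \<Longrightarrow> P n (u + v)" "\<And>n c u. P n u \<Longrightarrow> P n (c *\<^sub>C u)"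
    "\<And>a k n u. k \<ge> 1 \<Longrightarrow> u \<in> V n \<Longrightarrow> P n u \<Longrightarrow> P (n + int k) (create a k u)"
  shows "P n u"
proof -
  have mon: "P (int (\<Sum>(a, m)\<leftarrow>ams. m)) (heis_monomial B ams)" if "positive_modes ams" for ams
    using that
  proof (induction rule: monomial_induct)
    case (Cons a m ams)
    from assms(6)[OF this(1) monomial_in_grading[OF this(2)] this(3), of a] Cons(1) show ?case
      by (simp add: heis_monomial_Cons add.commute)
  qed (simp add: assms(2))
  show ?thesis
    using assms(1) unfolding heis_grading_def
  proof (induction rule: cvs.span_induct_alt)
    case (step c x y)
    from step(1) mon have "P n x" by auto
    from assms(4)[OF assms(5)[OF this] step(2)] show ?case .
  qed (rule assms(3))
qed

lemma create_in_grading: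
  assumes "u \<in> V n"
  shows "create a k u \<in> V (n + int k)"
proof (cases "k = 0")
  case False
  then have k: "k \<ge> 1" by simp
  show ?thesis
    using assms unfolding heis_grading_def[of B n]
  proof (induction rule: cvs.span_induct_alt)
    case (step c x y)
    from step(1) obtain ams where x: "x = heis_monomial B ams" "positive_modes ams"
      "n = int (\<Sum>(a, m)\<leftarrow>ams. m)" by auto
    have "create a k x \<in> V (n + int k)"
      using monomial_in_grading[of "(a, k) # ams"] k x by (simp add: heis_monomial_Cons add.commute)
    with step(2) show ?case
      by (simp add: create_add create_scaleC grading_add grading_scaleC)
  qed simp
qed simp

lemma grading_negative: "u \<in> V n \<Longrightarrow> n < 0 \<Longrightarrow> u = 0"
  by (induction rule: grading_induct) auto

lemma weight_on_grading: "u \<in> V n \<Longrightarrow> weight u = of_int n *\<^sub>C u"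
  by (induction rule: grading_induct)
    (simp_all add: weight_1 weight_create clinear_zero[OF clinear_weight] clinear_add[OF clinear_weight]
      clinear_scale[OF clinear_weight] scaleC_add_right scaleC_add_left create_scaleC mult.commute add.commute)

text \<open>Eigenvectors of \<^const>\<open>weight\<close> to distinct eigenvalues are independent.\<close>

lemma grading_independent:
  "finite A \<Longrightarrow> (\<And>n. n \<in> A \<Longrightarrow> h n \<in> V n) \<Longrightarrow> (\<Sum>n\<in>A. h n) = 0 \<Longrightarrow> n \<in> A \<Longrightarrow> h n = 0"
proof (induction A arbitrary: h n rule: finite_induct)
  case (insert m A)
  \<comment> \<open>Subtracting m times the relation from its image under \<open>weight\<close>
    removes the term \<open>h m\<close> and leaves a relation over \<open>A\<close> with
    coefficients n - m.\<close>
  have "weight (\<Sum>n\<in>insert m A. h n) = of_int m *\<^sub>C h m + (\<Sum>n\<in>A. of_int n *\<^sub>C h n)"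
    using insert.hyps weight_on_grading[OF insert.prems(1)]
    by (simp add: clinear_add[OF clinear_weight] clinear_sum[OF clinear_weight])
  moreover have "h m = - (\<Sum>n\<in>A. h n)"
    using insert by (simp add: eq_neg_iff_add_eq_0)
  ultimately have "(\<Sum>n\<in>A. (of_int n - of_int m) *\<^sub>C h n) = 0"
    using insert.prems(2) by (simp add: clinear_zero[OF clinear_weight] cvs.scale_left_diff_distrib
        sum_subtractf scaleC_sum_right)
  then have "(of_int n - of_int m) *\<^sub>C h n = 0" if "n \<in> A" for n
    using insert.IH[of "\<lambda>n. (of_int n - of_int m) *\<^sub>C h n" n] insert.prems(1) that
    by (simp add: grading_scaleC)
  then have A: "h n = 0" if "n \<in> A" for n
    using that insert.hyps(2) by fastforce
  then show ?case
    using insert.prems \<open>h m = - (\<Sum>n\<in>A. h n)\<close> by auto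
qed simp

lemma grading_decomposition:
  "\<exists>f :: int \<Rightarrow>\<^sub>0 'a heis_module. (\<forall>n. Poly_Mapping.lookup f n \<in> V n) \<and> graded_total f = v"
proof (induction v rule: monomial_linear_induct)
  case (monomial ams)
  let ?n = "int (\<Sum>(a, m)\<leftarrow>ams. m)"
  show ?case
    by (rule exI[of _ "Poly_Mapping.single ?n (heis_monomial B ams)"])
      (use monomial_in_grading[OF monomial] in
        \<open>simp add: graded_total_superset[of "{?n}"] lookup_single when_def\<close>)
next
  case (add u v)
  then obtain f g where "\<forall>n. Poly_Mapping.lookup f n \<in> V n" "graded_total f = u"
    "\<forall>n. Poly_Mapping.lookup g n \<in> V n" "graded_total g = v" by blast
  then show ?case
    by (intro exI[of _ "f + g"]) (simp add: clinear_add[OF clinear_graded_total] lookup_add grading_add)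
next
  case (scale c u)
  then obtain f where "\<forall>n. Poly_Mapping.lookup f n \<in> V n" "graded_total f = u" by blast
  then show ?case
    by (intro exI[of _ "c *\<^sub>C f"])
      (simp add: clinear_scale[OF clinear_graded_total] scaleC_poly_mapping.rep_eq grading_scaleC)
qed

lemma graded_space_grading: "graded_space V"
  unfolding graded_space_def graded_total_def[symmetric]
proof (intro conjI allI subspace_grading)
  fix v
  obtain f where f: "\<forall>n. Poly_Mapping.lookup f n \<in> V n" "graded_total f = v"
    using grading_decomposition by blast
  show "\<exists>!f. (\<forall>n. Poly_Mapping.lookup f n \<in> V n) \<and> graded_total f = v"
  proof (intro ex1I[of _ f] conjI f)
    fix g assume g: "(\<forall>n. Poly_Mapping.lookup g n \<in> V n) \<and> graded_total g = v"
    have "Poly_Mapping.lookup (g - f) n = 0" if "n \<in> Poly_Mapping.keys (g - f)" for n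
    proof (rule grading_independent[OF finite_keys _ _ that])
      show "Poly_Mapping.lookup (g - f) n \<in> V n" for n
        using f g by (simp add: lookup_minus grading_diff)
      show "(\<Sum>n\<in>Poly_Mapping.keys (g - f). Poly_Mapping.lookup (g - f) n) = 0"
        using f g by (simp add: clinear_diff[OF clinear_graded_total] flip: graded_total_def)
    qed
    then have "g - f = 0"
      by (intro poly_mapping_eqI) (auto simp: in_keys_iff)
    then show "g = f" by simp
  qed
qed

lemma homogeneous_induct [case_names homogeneous add]:
  assumes "\<And>n u. u \<in> V n \<Longrightarrow> P u" "\<And>u v. P u \<Longrightarrow> P v \<Longrightarrow> P (u + v)"
  shows "P u"
proof -
  obtain f where f: "\<forall>n. Poly_Mapping.lookup f n \<in> V n" "graded_total f = u"
    using grading_decomposition by blast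
  have "P (\<Sum>n\<in>A. Poly_Mapping.lookup f n)" if "finite A" for A
    using that by induction (auto intro!: assms(2) intro: assms(1)[of 0 0] assms(1)[OF f(1)[rule_format]])
  from this[OF finite_keys[of f]] f(2) show ?thesis by (simp add: graded_total_def)
qed

lemma grading_operator_eq_weight: "grading_operator V = weight"
  unfolding grading_operator_def
proof (rule the_equality)
  show "clinear weight \<and> (\<forall>m. \<forall>u\<in>V m. weight u = of_int m *\<^sub>C u)"
    by (simp add: clinear_weight weight_on_grading)
  fix d assume d: "clinear d \<and> (\<forall>m. \<forall>u\<in>V m. d u = of_int m *\<^sub>C u)"
  have "d u = weight u" for u
  proof (induction u rule: homogeneous_induct)
    case (homogeneous n u)
    with d show ?case by (simp add: weight_on_grading)
  next
    case (add u v)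
    with d show ?case by (simp add: clinear_add[OF clinear_weight] clinear_add)
  qed
  then show "d = weight" ..
qed

text \<open>Modes are at least 1, so a monomial of degree n has at most n letters, with modes at
  most n. With letters from a finite spanning set of the base space only finitely many monomials
  remain, and they still span because creation is linear in its letter.\<close>

lemma grading_finite_dimensional:
  assumes "finite_dimensional (UNIV :: 'a set)"
  shows "finite_dimensional (V n)"
proof -
  obtain S :: "'a set" where S: "finite S" "cvs.span S = UNIV"
    using assms by (auto simp: finite_dimensional_def)
  define F where "F n = {heis_monomial B ams | ams. positive_modes ams \<and>
    int (\<Sum>(a, m)\<leftarrow>ams. m) = n \<and> fst ` set ams \<subseteq> S}" for n
  have "finite (F n)"
  proof -
    have sub: "set ams \<subseteq> S \<times> {..nat n} \<and> length ams \<le> nat n"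
      if "positive_modes ams" "int (\<Sum>(a, m)\<leftarrow>ams. m) = n" "fst ` set ams \<subseteq> S" for ams n
      using that
    proof (induction arbitrary: n rule: monomial_induct)
      case (Cons a m ams)
      have "set ams \<subseteq> S \<times> {..nat (n - int m)} \<and> length ams \<le> nat (n - int m)"
        using Cons by (intro Cons.IH) auto
      moreover have "n - int m \<ge> 0" using Cons by auto
      ultimately show ?case using Cons by fastforce
    qed simp
    have "F n \<subseteq> heis_monomial B ` {ams. set ams \<subseteq> S \<times> {..nat n} \<and> length ams \<le> nat n}"
      using sub unfolding F_def by blast
    then show ?thesis
      by (rule finite_subset) (intro finite_imageI finite_lists_length_le finite_SigmaI S(1), auto)
  qed
  have create_F: "create a m u \<in> cvs.span (F (n + int m))" if "u \<in> cvs.span (F n)" "m \<ge> 1" for a m u n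
    using that(1)
  proof (induction rule: cvs.span_induct_alt)
    case (step c x y)
    from step(1) obtain ams where x: "x = heis_monomial B ams" "positive_modes ams"
      "n = int (\<Sum>(a, m)\<leftarrow>ams. m)" "fst ` set ams \<subseteq> S" by (auto simp: F_def)
    have "a \<in> cvs.span S" using S by simp
    then have "create a m x \<in> cvs.span (F (n + int m))"
    proof (induction rule: cvs.span_induct_alt)
      case (step c b a)
      have "create b m x \<in> F (n + int m)"
        using x step(1) that(2) unfolding F_def
        by (intro CollectI exI[of _ "(b, m) # ams"]) (simp add: heis_monomial_Cons)
      with step(2) show ?case
        by (simp add: clinear_add[OF clinear_create_left] clinear_scale[OF clinear_create_left]
            cvs.span_add cvs.span_scale cvs.span_base)
    qed (simp add: clinear_zero[OF clinear_create_left] cvs.span_zero)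
    with step(2) show ?case
      by (simp add: create_add create_scaleC cvs.span_add cvs.span_scale)
  qed (simp add: cvs.span_zero)
  have "u \<in> cvs.span (F n)" if "u \<in> V n" for u n
    using that
  proof (induction rule: grading_induct)
    case one
    show ?case
      unfolding F_def by (intro cvs.span_base CollectI exI[of _ "[]"]) simp
  qed (simp_all add: cvs.span_zero cvs.span_add cvs.span_scale create_F)
  moreover have "F n \<subseteq> V n"
    unfolding F_def using monomial_in_grading by auto
  then have "cvs.span (F n) \<subseteq> V n"
    using cvs.span_minimal subspace_grading by blast
  ultimately have "cvs.span (F n) = V n" by blast
  with \<open>finite (F n)\<close> show ?thesis
    unfolding finite_dimensional_def by blast
qed

end


section \<open>Normal ordered products\<close>

text \<open>The coefficient of a(n) x^(-n-m) in the (m-1)-st derivative of a(x) divided by (m-1)!,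
  which is the c(m,n) of the overview.\<close>

definition field_coeff :: "nat \<Rightarrow> int \<Rightarrow> complex" where
  "field_coeff m n = of_int (- n - 1) gchoose (m - 1)"

context heisenberg
begin

definition product_summand :: "('a \<times> nat) list \<Rightarrow> int list \<Rightarrow> 'a heis_module \<Rightarrow> 'a heis_module" where
  "product_summand ams ns v = (\<Prod>((a, m), n)\<leftarrow>zip ams ns. field_coeff m n) *\<^sub>C
     heis_product B (normal_order (zip (map fst ams) ns)) v"

definition mode_exponent :: "('a \<times> nat) list \<Rightarrow> int list \<Rightarrow> int" where
  "mode_exponent ams ns = (\<Sum>((a, m), n)\<leftarrow>zip ams ns. - n - int m)"

lemma normal_product_coeff_eq:
  "normal_product_coeff B ams j v = Sum_any (\<lambda>ns.
     if length ns = length ams \<and> mode_exponent ams ns = j then product_summand ams ns v else 0)"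
  unfolding normal_product_coeff_def mode_exponent_def product_summand_def field_coeff_def
  by (rule refl)

lemma heis_product_append: "heis_product B (ps @ qs) v = heis_product B ps (heis_product B qs v)"
  by (simp add: heis_product_def)

lemma heis_product_Nil [simp]: "heis_product B [] v = v"
  by (simp add: heis_product_def)

lemma heis_product_Cons [simp]: "heis_product B ((a, n) # ps) v = act a n (heis_product B ps v)"
  by (simp add: heis_product_def heis_op_eq_act)

lemma clinear_heis_product: "clinear (heis_product B ps)"
proof (induction ps)
  case (Cons p ps)
  then show ?case
    by (cases p) (auto intro!: clinear_compose[OF clinear_act])
qed (rule clinearI; simp)

lemma act_commute_nonneg: "m \<ge> 0 \<Longrightarrow> n \<ge> 0 \<Longrightarrow> act a m (act b n v) = act b n (act a m v)"
  by (simp add: act_def annihilate_commute)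

lemma heis_product_commute_nonneg:
  assumes "n \<ge> 0" "\<forall>(b, l) \<in> set ps. l \<ge> 0"
  shows "act a n (heis_product B ps v) = heis_product B ps (act a n v)"
  using assms(2)
  by (induction ps) (auto simp: act_commute_nonneg[OF assms(1)] clinear_zero[OF clinear_act])

text \<open>A positive mode commutes with all positive and zero modes, hence may act on
  \<open>v\<close> first, and a zero mode gives 0 in either place. This is the source of the two
  sums in the recursion for Y.\<close>

lemma heis_product_normal_order_Cons:
  "heis_product B (normal_order ((a, n) # ps)) v =
    (if n < 0 then create a (nat (- n)) (heis_product B (normal_order ps) v)
     else heis_product B (normal_order ps) (annihilate a (nat n) v))"
proof -
  let ?neg = "filter (\<lambda>(a, n). n < 0) ps" and ?pos = "filter (\<lambda>(a, n). n > 0) ps"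
    and ?zero = "filter (\<lambda>(a, n). n = 0) ps"
  consider "n < 0" | "n > 0" | "n = 0" by linarith
  then show ?thesis
  proof cases
    case 1
    then show ?thesis by (simp add: normal_order_def act_def)
  next
    case 2
    have "act a n (heis_product B (?pos @ ?zero) v) = heis_product B (?pos @ ?zero) (act a n v)"
      using 2 by (intro heis_product_commute_nonneg) auto
    with 2 show ?thesis
      by (simp add: normal_order_def heis_product_append act_def)
  next
    case 3
    then show ?thesis
      by (simp add: normal_order_def heis_product_append clinear_zero[OF clinear_heis_product])
  qed
qed

lemma product_summand_Nil [simp]: "product_summand [] [] v = v"
  by (simp add: product_summand_def normal_order_def scaleC_one)

lemma product_summand_Cons:
  "product_summand ((a, m) # ams) (n # ns) v = field_coeff m n *\<^sub>C
    (if n < 0 then create a (nat (- n)) (product_summand ams ns v)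
     else product_summand ams ns (annihilate a (nat n) v))"
  by (simp add: product_summand_def heis_product_normal_order_Cons create_scaleC)

lemma clinear_product_summand: "clinear (product_summand ams ns)"
  by (rule clinearI) (simp_all add: product_summand_def clinear_add[OF clinear_heis_product]
      clinear_scale[OF clinear_heis_product] scaleC_add_right mult.commute)

text \<open>\<open>mode_bound b v\<close> bounds the modes of the annihilation operators which do not kill \<open>v\<close>; unlike
  the weight it is not changed by annihilation operators.\<close>

definition mode_bound :: "nat \<Rightarrow> 'a heis_module \<Rightarrow> bool" where
  "mode_bound b v \<longleftrightarrow> (\<forall>n>b. \<forall>a. annihilate a n v = 0)"

lemma mode_bound_annihilate: "mode_bound b v \<Longrightarrow> mode_bound b (annihilate a n v)"
  unfolding mode_bound_def by (metis annihilate_commute annihilate_zero)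

lemma mode_bound_exists: "\<exists>b. mode_bound b v"
  using annihilate_eventually_0[of v] by (simp add: mode_bound_def)

text \<open>By normal ordering the annihilation operators act on \<open>v\<close> before anything is
  created, and \<open>mode_bound\<close> survives each of them, so the same b limits all
  modes.\<close>

lemma product_summand_modes_le:
  assumes "length ns = length ams" "mode_bound b v" "product_summand ams ns v \<noteq> 0"
  shows "\<forall>n\<in>set ns. n \<le> int b"
  using assms
proof (induction ns ams arbitrary: v rule: list_induct2)
  case (Cons n ns am ams)
  obtain a m where am: "am = (a, m)" by (cases am)
  show ?case
  proof (cases "n < 0")
    case True
    then have "product_summand ams ns v \<noteq> 0"
      using Cons.prems by (auto simp: am product_summand_Cons)
    with Cons.IH[OF Cons.prems(1)] True show ?thesis by auto
  next
    case False
    then have *: "product_summand ams ns (annihilate a (nat n) v) \<noteq> 0"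
      using Cons.prems by (auto simp: am product_summand_Cons)
    then have "annihilate a (nat n) v \<noteq> 0"
      by (auto simp: clinear_zero[OF clinear_product_summand])
    then have "n \<le> int b"
      using Cons.prems(1) by (cases "nat n > b") (auto simp: mode_bound_def)
    with Cons.IH[OF mode_bound_annihilate[OF Cons.prems(1)] *] show ?thesis by auto
  qed
qed simp

abbreviation mode_sum :: "('a \<times> nat) list \<Rightarrow> nat" where
  "mode_sum ams \<equiv> (\<Sum>(a, m)\<leftarrow>ams. m)"

lemma mode_exponent_eq:
  "length ns = length ams \<Longrightarrow> mode_exponent ams ns = - sum_list ns - int (mode_sum ams)"
  by (induction ns ams rule: list_induct2) (auto simp: mode_exponent_def)

lemma sum_list_le_bound:
  assumes "\<forall>n\<in>set ns. n \<le> int b"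
  shows "sum_list ns \<le> int (length ns * b)"
  using assms by (induction ns) auto

lemma sum_list_le_bound_member:
  assumes "\<forall>n\<in>set ns. n \<le> int b" "n \<in> set ns"
  shows "sum_list ns \<le> n + int (length ns * b)"
  using assms
proof (induction ns)
  case (Cons k ns)
  then show ?case
    using sum_list_le_bound[of ns b] by (cases "n = k") auto
qed simp

definition mode_lists :: "nat \<Rightarrow> nat \<Rightarrow> int list set" where
  "mode_lists l N = {ns. length ns = l \<and> set ns \<subseteq> {- int N..int N}}"

lemma finite_mode_lists: "finite (mode_lists l N)"
  unfolding mode_lists_def using finite_lists_length_eq[of "{- int N..int N}" l]
  by (simp add: conj_commute)

text \<open>The exponent fixes the sum of the modes, and every contributing mode is at most b, so
  each mode is also bounded below; the last condition on N makes -N such a lower bound.\<close>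

lemma normal_product_coeff_finite:
  assumes "mode_bound b v" "b \<le> N" "j + int (mode_sum ams) + int (length ams * b) \<le> int N"
  shows "normal_product_coeff B ams j v =
    (\<Sum>ns\<in>mode_lists (length ams) N. if mode_exponent ams ns = j then product_summand ams ns v else 0)"
proof -
  have "normal_product_coeff B ams j v = (\<Sum>ns\<in>mode_lists (length ams) N.
      if length ns = length ams \<and> mode_exponent ams ns = j then product_summand ams ns v else 0)"
    unfolding normal_product_coeff_eq
  proof (rule Sum_any.expand_superset[OF finite_mode_lists], rule subsetI)
    fix ns assume "ns \<in> {ns. (if length ns = length ams \<and> mode_exponent ams ns = j
      then product_summand ams ns v else 0) \<noteq> 0}"
    then have ns: "length ns = length ams" "mode_exponent ams ns = j" "product_summand ams ns v \<noteq> 0"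
      by (auto split: if_splits)
    have le: "\<forall>n\<in>set ns. n \<le> int b"
      by (rule product_summand_modes_le[OF ns(1) assms(1) ns(3)])
    have "n \<in> {- int N..int N}" if "n \<in> set ns" for n
      using le that sum_list_le_bound_member[OF le that] mode_exponent_eq[OF ns(1)] ns(1,2) assms(2,3)
      by force
    with ns(1) show "ns \<in> mode_lists (length ams) N"
      by (auto simp: mode_lists_def)
  qed
  also have "\<dots> = (\<Sum>ns\<in>mode_lists (length ams) N.
      if mode_exponent ams ns = j then product_summand ams ns v else 0)"
    by (rule sum.cong) (auto simp: mode_lists_def)
  finally show ?thesis .
qed

lemma normal_product_coeff_truncation:
  assumes "mode_bound b v" "j < - int (mode_sum ams) - int (length ams * b)"
  shows "normal_product_coeff B ams j v = 0"
proof -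
  have "product_summand ams ns v = 0" if "length ns = length ams" "mode_exponent ams ns = j" for ns
  proof (rule ccontr)
    assume "product_summand ams ns v \<noteq> 0"
    from sum_list_le_bound[OF product_summand_modes_le[OF that(1) assms(1) this]] that assms(2)
    show False by (simp add: mode_exponent_eq)
  qed
  then show ?thesis
    by (auto simp: normal_product_coeff_eq intro!: Sum_any.neutral cong: if_cong)
qed

lemma normal_product_coeff_Nil: "normal_product_coeff B [] j v = (if j = 0 then v else 0)"
proof -
  obtain b where "mode_bound b v" using mode_bound_exists by blast
  moreover have "mode_lists 0 N = {[]}" for N
    by (auto simp: mode_lists_def)
  ultimately show ?thesis
    using normal_product_coeff_finite[of b v "max b (nat j)" j "[]"]
    by (auto simp: mode_exponent_def)
qed

text \<open>The part with modes |n| \<le> N of the coefficient of x^j in the normal ordered product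
  of the (m-1)-st divided derivative of a(x) with the series \<open>F\<close>. The mode n = 0 is
  left out because it acts by 0.\<close>

definition field_terms :: "(int \<Rightarrow> 'a heis_module \<Rightarrow> 'a heis_module) \<Rightarrow> 'a \<Rightarrow> nat \<Rightarrow> int \<Rightarrow>
    'a heis_module \<Rightarrow> nat \<Rightarrow> 'a heis_module" where
  "field_terms F a m j v N = (\<Sum>n=1..N.
     field_coeff m (- int n) *\<^sub>C create a n (F (j - int n + int m) v) +
     field_coeff m (int n) *\<^sub>C F (j + int n + int m) (annihilate a n v))"

lemma sum_symmetric_interval:
  fixes h :: "int \<Rightarrow> 'b::comm_monoid_add"
  shows "(\<Sum>n=- int N..int N. h n) = h 0 + (\<Sum>n=1..N. h (- int n) + h (int n))"
proof (induction N)
  case (Suc N)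
  have "{- int (Suc N)..int (Suc N)} =
      insert (int (Suc N)) (insert (- int (Suc N)) {- int N..int N})" by auto
  with Suc show ?case by (simp add: add_ac)
qed simp

text \<open>Summing over the first mode separately from the others turns the sum over mode sequences
  into the recursion. The threshold for N depends on j and v.\<close>

lemma normal_product_coeff_Cons:
  "\<forall>\<^sub>F N in sequentially.
    normal_product_coeff B ((a, m) # ams) j v = field_terms (normal_product_coeff B ams) a m j v N"
proof -
  obtain b where b: "mode_bound b v" using mode_bound_exists by blast
  have eq: "normal_product_coeff B ((a, m) # ams) j v = field_terms (normal_product_coeff B ams) a m j v N"
    if N: "b \<le> N" "j + int (mode_sum ((a, m) # ams)) + int (length ((a, m) # ams) * b) \<le> int N" for N
  proof -
    let ?L = "mode_lists (length ams) N" and ?I = "{- int N..int N}"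
    define g where "g n ns = (if mode_exponent ams ns = j + n + int m
      then product_summand ((a, m) # ams) (n # ns) v else 0)" for n ns
    have "normal_product_coeff B ((a, m) # ams) j v = (\<Sum>ns\<in>mode_lists (Suc (length ams)) N.
        if mode_exponent ((a, m) # ams) ns = j then product_summand ((a, m) # ams) ns v else 0)"
      by (subst normal_product_coeff_finite[OF b N]) simp
    also have "\<dots> = (\<Sum>(n, ns)\<in>?I \<times> ?L. g n ns)"
      by (rule sum.reindex_bij_witness[of _ "\<lambda>(n, ns). n # ns" "\<lambda>ns. (hd ns, tl ns)"])
        (auto simp: mode_lists_def length_Suc_conv g_def mode_exponent_def intro!: if_cong)
    also have "\<dots> = (\<Sum>n\<in>?I. \<Sum>ns\<in>?L. g n ns)"
      by (simp add: sum.cartesian_product)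
    finally have split: "normal_product_coeff B ((a, m) # ams) j v = (\<Sum>n\<in>?I. \<Sum>ns\<in>?L. g n ns)" .
    have zero: "normal_product_coeff B ams i 0 = 0" for i
      by (simp add: normal_product_coeff_eq clinear_zero[OF clinear_product_summand] cong: if_cong)
    have neg: "(\<Sum>ns\<in>?L. g (- int n) ns) =
        field_coeff m (- int n) *\<^sub>C create a n (normal_product_coeff B ams (j - int n + int m) v)"
      if "n \<ge> 1" for n
    proof -
      have "(\<Sum>ns\<in>?L. g (- int n) ns) = field_coeff m (- int n) *\<^sub>C create a n
          (\<Sum>ns\<in>?L. if mode_exponent ams ns = j - int n + int m then product_summand ams ns v else 0)"
        unfolding create_sum scaleC_sum_right
        by (rule sum.cong) (use that in \<open>auto simp: g_def product_summand_Cons\<close>)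
      then show ?thesis
        by (subst normal_product_coeff_finite[OF b N(1)]) (use N in auto)
    qed
    \<comment> \<open>The exponent j + n + m on the right must stay within reach of N. The threshold
      counts one letter more than \<open>ams\<close>, and its extra b covers n \<le> b; for larger n
      both sides vanish.\<close>
    have pos: "(\<Sum>ns\<in>?L. g (int n) ns) =
        field_coeff m (int n) *\<^sub>C normal_product_coeff B ams (j + int n + int m) (annihilate a n v)" for n
    proof (cases "n \<le> b")
      case True
      have "(\<Sum>ns\<in>?L. g (int n) ns) = field_coeff m (int n) *\<^sub>C
          (\<Sum>ns\<in>?L. if mode_exponent ams ns = j + int n + int m
            then product_summand ams ns (annihilate a n v) else 0)"
        unfolding scaleC_sum_right by (rule sum.cong) (auto simp: g_def product_summand_Cons)
      then show ?thesis
        by (subst normal_product_coeff_finite[OF mode_bound_annihilate[OF b] N(1)]) (use N True in auto)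
    next
      case False
      then have "annihilate a n v = 0"
        using b by (simp add: mode_bound_def)
      then show ?thesis
        by (simp add: g_def product_summand_Cons clinear_zero[OF clinear_product_summand] zero
            cong: if_cong)
    qed
    let ?S = "\<lambda>n. \<Sum>ns\<in>?L. g n ns"
    have "(\<Sum>n\<in>?I. ?S n) = (\<Sum>n=1..N. ?S (- int n) + ?S (int n))"
      using pos[of 0] zero by (simp add: sum_symmetric_interval)
    also have "\<dots> = field_terms (normal_product_coeff B ams) a m j v N"
      unfolding field_terms_def
      by (rule sum.cong) (use neg pos in auto)
    finally show ?thesis using split by simp
  qed
  show ?thesis
    using eventually_ge_at_top[of b]
      eventually_ge_at_top[of "nat (j + int (mode_sum ((a, m) # ams)) + int (length ((a, m) # ams) * b))"]
    by eventually_elim (auto intro!: eq)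
qed

lemma eventually_eqI: "\<forall>\<^sub>F N in sequentially. x = y \<Longrightarrow> x = y"
  by simp

lemma clinear_field_terms:
  assumes "\<And>i. clinear (F i)"
  shows "clinear (\<lambda>v. field_terms F a m j v N)" "clinear (\<lambda>a. field_terms F a m j v N)"
  unfolding field_terms_def
  by (intro clinear_sums clinear_plus clinear_scaleC clinear_create_left
      clinear_compose[OF clinear_create] clinear_compose[OF _ clinear_annihilate]
      clinear_compose[OF _ clinear_annihilate_left] assms)+

lemma clinear_field_terms_series:
  "(\<And>i w. clinear (\<lambda>x. F x i w)) \<Longrightarrow> clinear (\<lambda>x. field_terms (F x) a m j v N)"
  unfolding field_terms_def
  by (intro clinear_sums clinear_plus clinear_scaleC clinear_compose[OF clinear_create])

lemma clinear_normal_product_coeff: "clinear (normal_product_coeff B ams j)"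
proof (induction ams arbitrary: j)
  case Nil
  show ?case by (rule clinearI) (simp_all add: normal_product_coeff_Nil)
next
  case (Cons am ams)
  show ?case
    by (cases am) (simp add: clinear_eventually[OF clinear_field_terms(1)[OF Cons.IH] normal_product_coeff_Cons])
qed

lemma clinear_normal_product_coeff_factor:
  "clinear (\<lambda>a. normal_product_coeff B (l @ (a, k) # r) j v)"
proof (induction l arbitrary: j v)
  case Nil
  show ?case
    unfolding append.simps
    by (rule clinear_eventually[OF clinear_field_terms(2)[OF clinear_normal_product_coeff]
          normal_product_coeff_Cons])
next
  case (Cons bm l)
  obtain b m where bm: "bm = (b, m)" by (cases bm)
  show ?case
    unfolding append.simps bm
    by (rule clinear_eventually[OF clinear_field_terms_series[OF Cons.IH] normal_product_coeff_Cons])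
qed

section \<open>Extension of multilinear prescriptions on monomials\<close>

lemma heis_monomial_eq_tensor_word:
  "positive_modes ams \<Longrightarrow> heis_monomial B ams = tensor_word (map (\<lambda>(a, m). mode a m) ams)"
  by (induction rule: monomial_induct) (simp_all add: heis_monomial_Cons create_def)

text \<open>Monomials are linearly dependent in general, so linearity in each letter is what allows
  an extension. A word in arbitrary elements of H_- is expanded into homogeneous components:
  \<open>s ks xs\<close> is the contribution of the choice \<open>ks\<close> of one degree for each
  letter.\<close>

lemma monomial_extension:
  fixes g :: "('a \<times> nat) list \<Rightarrow> 'b::complex_vector"
  assumes g: "\<And>l k r. clinear (\<lambda>a. g (l @ (a, k) # r))"
  shows "\<exists>F. clinear F \<and> (\<forall>ams. positive_modes ams \<longrightarrow> F (heis_monomial B ams) = g ams)"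
proof -
  define s where "s ks xs = (if length ks = length xs
    then g (map2 (\<lambda>x k. (component x k, k)) xs ks) else 0)" for ks xs
  \<comment> \<open>A vanishing component makes the contribution 0, so only finitely many choices of
    degrees matter.\<close>
  have s_component: "component x k \<noteq> 0" if "s ks xs \<noteq> 0" "(x, k) \<in> set (zip xs ks)" for ks xs x k
  proof
    assume 0: "component x k = 0"
    from that(2) obtain l r where "zip xs ks = l @ (x, k) # r"
      by (meson split_list)
    then have "s ks xs = 0"
      using clinear_zero[OF g] by (simp add: s_def 0)
    with that(1) show False by simp
  qed
  have fin: "finite {ks. s ks xs \<noteq> 0}" for xs
  proof (rule finite_subset)
    let ?K = "\<Union>x\<in>set xs. {k. component x k \<noteq> 0}"
    show "{ks. s ks xs \<noteq> 0} \<subseteq> {ks. set ks \<subseteq> ?K \<and> length ks = length xs}"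
    proof (intro subsetI CollectI conjI)
      fix ks k assume ks: "ks \<in> {ks. s ks xs \<noteq> 0}"
      then show len: "length ks = length xs" by (auto simp: s_def split: if_splits)
      assume "k \<in> set ks"
      then obtain i where "i < length ks" "k = ks ! i" by (auto simp: in_set_conv_nth)
      with len have "(xs ! i, k) \<in> set (zip xs ks)" by (auto simp: set_zip)
      with s_component[of ks xs] ks show "k \<in> ?K" by (auto dest: set_zip_leftD)
    qed
    show "finite {ks. set ks \<subseteq> ?K \<and> length ks = length xs}"
      by (intro finite_lists_length_eq finite_UN_I finite_components) simp
  qed
  have "multilinear (\<lambda>xs. Sum_any (\<lambda>ks. s ks xs))"
    unfolding multilinear_def
  proof (intro allI clinear_Sum_any[OF _ fin])
    fix l r ks
    show "clinear (\<lambda>x. s ks (l @ x # r))"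
    proof (cases "length ks = length l + Suc (length r)")
      case True
      define k where "k = ks ! length l"
      have ks: "ks = take (length l) ks @ k # drop (Suc (length l)) ks"
        unfolding k_def using True by (intro id_take_nth_drop) simp
      have "s ks (l @ x # r) = g (map2 (\<lambda>x k. (component x k, k)) l (take (length l) ks) @
          (component x k, k) # map2 (\<lambda>x k. (component x k, k)) r (drop (Suc (length l)) ks))" for x
      proof -
        have "map2 (\<lambda>x k. (component x k, k)) (l @ x # r) ks =
            map2 (\<lambda>x k. (component x k, k)) l (take (length l) ks) @
            (component x k, k) # map2 (\<lambda>x k. (component x k, k)) r (drop (Suc (length l)) ks)"
          using True by (subst ks) (simp add: zip_append)
        with True show ?thesis by (simp add: s_def)
      qed
      then show ?thesis
        by (simp add: clinear_compose[OF g clinear_component])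
    next
      case False
      then show ?thesis by (auto simp: s_def intro!: clinearI)
    qed
  qed
  then obtain F where F: "clinear F" "\<And>xs. F (tensor_word xs) = Sum_any (\<lambda>ks. s ks xs)"
    using multilinear_extension by metis
  have "F (heis_monomial B ams) = g ams" if pos: "positive_modes ams" for ams
  proof -
    let ?xs = "map (\<lambda>(a, m). mode a m) ams"
    have self: "map2 (\<lambda>x k. (component x k, k)) ?xs (map snd ams) = ams"
      using pos by (induction rule: monomial_induct) (simp_all add: component_mode)
    \<comment> \<open>The letter a(-m) can have a nonzero component only in degree m, so only the
      choice of the monomial's own modes remains.\<close>
    have "F (heis_monomial B ams) = (\<Sum>ks\<in>{map snd ams}. s ks ?xs)"
      unfolding heis_monomial_eq_tensor_word[OF pos] F(2)
    proof (rule Sum_any.expand_superset)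
      show "{ks. s ks ?xs \<noteq> 0} \<subseteq> {map snd ams}"
      proof
        fix ks assume ks: "ks \<in> {ks. s ks ?xs \<noteq> 0}"
        then have len: "length ks = length ams" by (auto simp: s_def split: if_splits)
        have "ks ! i = snd (ams ! i)" if "i < length ams" for i
        proof -
          have "(mode (fst (ams ! i)) (snd (ams ! i)), ks ! i) \<in> set (zip ?xs ks)"
            using that len by (auto simp: set_zip case_prod_beta intro!: exI[of _ i])
          from s_component[OF _ this] ks show ?thesis
            by (auto simp: component_mode split: if_splits)
        qed
        with len show "ks \<in> {map snd ams}" by (auto intro: nth_equalityI)
      qed
    qed simp
    then show ?thesis by (simp add: s_def self)
  qed
  with F(1) show ?thesis by blast
qed

section \<open>The vertex operator map\<close>

abbreviation Y :: "'a heis_module \<Rightarrow> int \<Rightarrow> 'a heis_module \<Rightarrow> 'a heis_module" where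
  "Y \<equiv> heis_Y B"

text \<open>The map is built separately for each exponent j and argument v; it is unique because the
  monomials span.\<close>

lemma heis_Y:
  shows clinear_Y_left: "clinear (\<lambda>u. Y u j v)"
    and Y_monomial: "positive_modes ams \<Longrightarrow> Y (heis_monomial B ams) = normal_product_coeff B ams"
proof -
  let ?P = "\<lambda>Y. (\<forall>j v. clinear (\<lambda>u. Y u j v)) \<and>
    (\<forall>ams. positive_modes ams \<longrightarrow> Y (heis_monomial B ams) = normal_product_coeff B ams)"
  have "\<forall>jv. \<exists>F. clinear F \<and> (\<forall>ams. positive_modes ams \<longrightarrow>
      F (heis_monomial B ams) = normal_product_coeff B ams (fst jv) (snd jv))"
    by (intro allI monomial_extension clinear_normal_product_coeff_factor)
  then obtain F where F: "\<And>jv. clinear (F jv)" "\<And>jv ams. positive_modes ams \<Longrightarrow>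
      F jv (heis_monomial B ams) = normal_product_coeff B ams (fst jv) (snd jv)"
    by metis
  have ex: "?P (\<lambda>u j v. F (j, v) u)"
    by (auto simp: F)
  have "\<exists>!Y. ?P Y"
  proof (rule ex_ex1I)
    show "\<exists>Y. ?P Y"
      by (rule exI[where P = ?P, OF ex])
  next
    fix X X' assume XX': "?P X" "?P X'"
    show "X = X'"
    proof (intro ext)
      fix u j v
      show "X u j v = X' u j v"
        by (rule clinear_eq_on_span[where S = "heis_monomial B ` Collect positive_modes"
              and f = "\<lambda>u. X u j v" and g = "\<lambda>u. X' u j v"])
          (use XX' span_heis_monomial in auto)
    qed
  qed
  then have P: "?P Y"
    unfolding heis_Y_def by (rule theI')
  show "clinear (\<lambda>u. Y u j v)"
    by (rule P[THEN conjunct1, THEN spec, THEN spec])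
  show "positive_modes ams \<Longrightarrow> Y (heis_monomial B ams) = normal_product_coeff B ams"
    by (rule P[THEN conjunct2, THEN spec, THEN mp])
qed

lemmas Y_add_left = clinear_add[OF clinear_Y_left]
  and Y_scaleC_left = clinear_scale[OF clinear_Y_left]
  and Y_zero_left [simp] = clinear_zero[OF clinear_Y_left]

lemma Y_1: "Y 1 j v = (if j = 0 then v else 0)"
  using Y_monomial[of "[]"] by (simp add: normal_product_coeff_Nil)

lemma clinear_Y: "clinear (Y u j)"
proof (induction u rule: monomial_linear_induct)
  case (monomial ams)
  then show ?case by (simp add: Y_monomial clinear_normal_product_coeff)
qed (auto intro!: clinearI simp: Y_add_left Y_scaleC_left clinear_add clinear_scale scaleC_add_right
    mult.commute)

lemmas Y_add = clinear_add[OF clinear_Y]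
  and Y_scaleC = clinear_scale[OF clinear_Y]
  and Y_sum = clinear_sum[OF clinear_Y]
  and Y_diff = clinear_diff[OF clinear_Y]
  and Y_zero [simp] = clinear_zero[OF clinear_Y]

lemma Y_truncation: "\<exists>J. \<forall>j<J. Y u j v = 0"
proof (induction u rule: monomial_linear_induct)
  case (monomial ams)
  obtain b where "mode_bound b v" using mode_bound_exists by blast
  from normal_product_coeff_truncation[OF this] monomial show ?case
    by (auto simp: Y_monomial)
next
  case (add u w)
  then obtain J K where "\<forall>j<J. Y u j v = 0" "\<forall>j<K. Y w j v = 0" by blast
  then show ?case
    by (intro exI[of _ "min J K"]) (simp add: Y_add_left)
next
  case (scale c u)
  then show ?case by (auto simp: Y_scaleC_left)
qed

lemma Y_eventually_0: "\<forall>\<^sub>F n in sequentially. Y u (j - int n) v = 0"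
proof -
  obtain J where J: "\<forall>j<J. Y u j v = 0" using Y_truncation by blast
  show ?thesis
    using eventually_gt_at_top[of "nat (j - J)"] by eventually_elim (use J in auto)
qed

lemma eventually_annihilate_0: "\<forall>\<^sub>F n in sequentially. annihilate a n v = 0"
proof -
  obtain N where "\<forall>n>N. \<forall>a. annihilate a n v = 0"
    using annihilate_eventually_0 by blast
  then show ?thesis
    by (intro eventually_mono[OF eventually_gt_at_top[of N]]) blast
qed

text \<open>The recursion of the overview, for the coefficient of x^j. Besides it, the later proofs
  rest only on \<open>Y_1\<close>, linearity and truncation of Y.\<close>

lemma Y_create:
  assumes "m \<ge> 1"
  shows "\<forall>\<^sub>F N in sequentially. Y (create a m u) j v = field_terms (Y u) a m j v N"
proof (induction u rule: monomial_linear_induct)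
  case (monomial ams)
  have "Y (create a m (heis_monomial B ams)) = normal_product_coeff B ((a, m) # ams)"
    using Y_monomial[of "(a, m) # ams"] monomial assms by (simp add: heis_monomial_Cons)
  with monomial show ?case
    using normal_product_coeff_Cons[of a m ams j v] by (simp add: Y_monomial)
next
  case (add u w)
  then show ?case
    by eventually_elim (simp add: field_terms_def create_add Y_add_left scaleC_add_right sum.distrib)
next
  case (scale c u)
  then show ?case
    by eventually_elim (simp add: field_terms_def create_scaleC Y_scaleC_left scaleC_add_right
        scaleC_sum_right mult.commute)
qed

end


section \<open>Commutation relations\<close>

lemma sum_shift_down:
  fixes f :: "nat \<Rightarrow> 'b::ab_group_add"
  shows "(\<Sum>n=1..N. f (n - 1)) = (\<Sum>n=1..N. f n) + f 0 - f N"
  by (induction N) (simp_all add: algebra_simps)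

lemma sum_shift_up:
  fixes f :: "nat \<Rightarrow> 'b::ab_group_add"
  shows "(\<Sum>n=1..N. f (Suc n)) = (\<Sum>n=1..N. f n) - f 1 + f (Suc N)"
  by (induction N) (simp_all add: algebra_simps)

text \<open>For a creation mode the upper entry -(-n) - 1 is a natural number; hence the coefficient
  is 0 for n < m and 1 for n = m.\<close>

lemma field_coeff_neg: "n \<ge> 1 \<Longrightarrow> field_coeff m (- int n) = of_nat ((n - 1) choose (m - 1))"
  by (simp add: field_coeff_def binomial_gbinomial of_nat_diff)

text \<open>The relation [D, A(x)] = dA(x)/dx for A(x) the sum of c(m,n) a(n) x^(-n-m), read off at
  a(n): on the left D turns a(n+1) into -(n+1) a(n), on the right the power of x gives
  -(n+m).\<close>

lemma field_coeff_shift: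
  assumes "m \<ge> 1"
  shows "of_int (n + 1) * field_coeff m (n + 1) = of_int (n + int m) * field_coeff m n"
proof -
  let ?z = "of_int (- n - 1) :: complex"
  have "(?z - of_nat (m - 1)) * (?z gchoose (m - 1)) = ?z * ((?z - 1) gchoose (m - 1))"
    by (rule gbinomial_absorb_comp)
  moreover have "field_coeff m (n + 1) = (?z - 1) gchoose (m - 1)"
    by (simp add: field_coeff_def algebra_simps)
  ultimately show ?thesis
    using assms by (simp add: field_coeff_def of_nat_diff algebra_simps)
qed

text \<open>Differentiating the (m-1)-st divided derivative once more gives m times the m-th
  one.\<close>

lemma field_coeff_Suc:
  assumes "m \<ge> 1"
  shows "of_nat m * field_coeff (Suc m) n = - of_int (n + int m) * field_coeff m n"
proof -
  let ?z = "of_int (- n - 1) :: complex"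
  have "?z * (?z gchoose (m - 1)) = of_nat (m - 1) * (?z gchoose (m - 1)) + of_nat (Suc (m - 1)) * (?z gchoose Suc (m - 1))"
    by (rule gbinomial_mult_1)
  then show ?thesis
    using assms by (simp add: field_coeff_def of_nat_diff algebra_simps)
qed

context heisenberg
begin

text \<open>There are two contractions of b with a: in the recursion b(p) contracts with the
  creation mode a(-p), whose coefficient is c(m,-p), and on the right b(q) removes a(-m) for q = m.
  They agree because p binomial(p-1, m-1) = m binomial(p, m). All other terms match by the induction
  hypothesis.\<close>

lemma annihilate_Y:
  "annihilate b p (Y u j v) = Y u j (annihilate b p v) +
    (\<Sum>q=1..p. of_nat (p choose q) *\<^sub>C Y (annihilate b q u) (j - int p + int q) v)"
proof (induction u arbitrary: j v rule: create_induct)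
  case one
  show ?case by (simp add: Y_1)
next
  case (create a m u)
  show ?case
  proof (rule eventually_eqI)
    let ?q = "\<lambda>q. create a m (annihilate b q u)"
    have "\<forall>\<^sub>F N in sequentially. \<forall>q\<in>{1..p}. Y (?q q) (j - int p + int q) v =
        field_terms (Y (annihilate b q u)) a m (j - int p + int q) v N"
      by (intro eventually_ball_finite ballI Y_create create(1)) simp
    with Y_create[OF create(1), of a u j v] Y_create[OF create(1), of a u j "annihilate b p v"]
      eventually_ge_at_top[of p]
    show "\<forall>\<^sub>F N in sequentially. annihilate b p (Y (create a m u) j v) =
      Y (create a m u) j (annihilate b p v) +
      (\<Sum>q=1..p. of_nat (p choose q) *\<^sub>C Y (annihilate b q (create a m u)) (j - int p + int q) v)"
    proof eventually_elim
      case (elim N)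
      define C where "C = (of_nat m * of_nat (p choose m) * B b a) *\<^sub>C Y u (j - int p + int m) v"
      have contract: "(\<Sum>n=1..N. field_coeff m (- int n) *\<^sub>C
          (if p = n then (of_nat p * B b a) *\<^sub>C Y u (j - int n + int m) v else 0)) = C"
      proof (cases "p = 0")
        case True
        then show ?thesis
          using create(1) by (auto simp: C_def intro!: sum.neutral)
      next
        case False
        have "of_nat ((p - 1) choose (m - 1)) * of_nat p = (of_nat m * of_nat (p choose m) :: complex)"
          using False create(1) times_binomial_minus1_eq[of m p]
          unfolding of_nat_mult[symmetric] by (simp add: mult.commute)
        moreover have "(\<Sum>n=1..N. field_coeff m (- int n) *\<^sub>C
            (if p = n then (of_nat p * B b a) *\<^sub>C Y u (j - int n + int m) v else 0)) =
          (\<Sum>n=1..N. if p = n then field_coeff m (- int p) *\<^sub>C (of_nat p * B b a) *\<^sub>C Y u (j - int p + int m) v else 0)"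
          by (rule sum.cong) auto
        ultimately show ?thesis
          using False elim(3)
          by (simp add: sum.delta C_def field_coeff_neg flip: mult.assoc)
      qed
      have rhs: "(\<Sum>q=1..p. of_nat (p choose q) *\<^sub>C Y (annihilate b q (create a m u)) (j - int p + int q) v) =
          C + (\<Sum>q=1..p. of_nat (p choose q) *\<^sub>C field_terms (Y (annihilate b q u)) a m (j - int p + int q) v N)"
      proof -
        have "(\<Sum>q=1..p. of_nat (p choose q) *\<^sub>C Y (annihilate b q (create a m u)) (j - int p + int q) v) =
          (\<Sum>q=1..p. (if q = m then C else 0)) + (\<Sum>q=1..p. of_nat (p choose q) *\<^sub>C Y (?q q) (j - int p + int q) v)"
          unfolding sum.distrib[symmetric]
          by (rule sum.cong) (auto simp: annihilate_create Y_add_left Y_scaleC_left C_def scaleC_add_right mult_ac)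
        moreover have "(\<Sum>q=1..p. (if q = m then C else 0)) = C"
          using create(1) by (cases "m \<le> p") (auto simp: C_def sum.delta)
        ultimately show ?thesis
          using elim(4) by simp
      qed
      have "annihilate b p (field_terms (Y u) a m j v N) = field_terms (Y u) a m j (annihilate b p v) N + C +
          (\<Sum>n=1..N.
             field_coeff m (- int n) *\<^sub>C create a n (\<Sum>q=1..p. of_nat (p choose q) *\<^sub>C
               Y (annihilate b q u) (j - int n + int m - int p + int q) v) +
             field_coeff m (int n) *\<^sub>C (\<Sum>q=1..p. of_nat (p choose q) *\<^sub>C
               Y (annihilate b q u) (j + int n + int m - int p + int q) (annihilate a n v)))"
        (is "_ = _ + ?R")
        unfolding field_terms_def contract[symmetric] sum.distrib[symmetric] annihilate_sum
        by (rule sum.cong)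
          (auto simp: annihilate_add annihilate_scaleC annihilate_create create create_add
            scaleC_add_right annihilate_commute[of b p a])
      also have "?R =
          (\<Sum>q=1..p. of_nat (p choose q) *\<^sub>C field_terms (Y (annihilate b q u)) a m (j - int p + int q) v N)"
        unfolding field_terms_def create_sum scaleC_sum_right sum.distrib[symmetric]
        by (subst sum.swap, intro sum.cong refl)
          (simp add: create_scaleC scaleC_add_right mult_ac algebra_simps)
      finally show ?case
        using elim(1,2) rhs by (simp add: add.assoc)
    qed
  qed
next
  case (add u w)
  then show ?case
    by (simp add: Y_add_left annihilate_add scaleC_add_right sum.distrib algebra_simps)
next
  case (scale c u)
  then show ?case
    by (simp add: Y_scaleC_left annihilate_scaleC scaleC_add_right scaleC_sum_right mult.commute)
qed

section \<open>The grading operator and the d-bracket\<close>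

lemma weight_annihilate: "weight (annihilate a n u) = annihilate a n (weight u) - of_nat n *\<^sub>C annihilate a n u"
  by (induction u rule: create_induct)
    (auto simp: weight_1 clinear_add[OF clinear_weight] clinear_scale[OF clinear_weight] clinear_zero[OF clinear_weight]
      annihilate_add annihilate_scaleC annihilate_create weight_create create_add create_scaleC create_diff
      scaleC_add_right cvs.scale_right_diff_distrib mult_ac)

text \<open>All terms of the recursion have the same extra weight: the degree n of a(-n) adds to the
  exponent j - n + m, the degree -n of a(n) to j + n + m, and both give j + m.\<close>

lemma weight_Y:
  "weight (Y u j v) = Y u j (weight v) + Y (weight u) j v + of_int j *\<^sub>C Y u j v"
proof (induction u arbitrary: j v rule: create_induct)
  case one
  show ?case
    by (simp add: Y_1 weight_1 clinear_zero[OF clinear_weight])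
next
  case (create a m u)
  show ?case
  proof (rule eventually_eqI)
    show "\<forall>\<^sub>F N in sequentially. weight (Y (create a m u) j v) =
      Y (create a m u) j (weight v) + Y (weight (create a m u)) j v + of_int j *\<^sub>C Y (create a m u) j v"
      using Y_create[OF create(1), of a u j v] Y_create[OF create(1), of a u j "weight v"]
        Y_create[OF create(1), of a "weight u" j v]
    proof eventually_elim
      case (elim N)
      have "weight (field_terms (Y u) a m j v N) = field_terms (Y u) a m j (weight v) N +
          field_terms (Y (weight u)) a m j v N + of_nat m *\<^sub>C field_terms (Y u) a m j v N +
          of_int j *\<^sub>C field_terms (Y u) a m j v N"
        unfolding field_terms_def scaleC_sum_right sum.distrib[symmetric] clinear_sum[OF clinear_weight]
      proof (rule sum.cong, simp, goal_cases)
        case (1 n)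
        let ?s = "j - int n + int m" and ?t = "j + int n + int m"
        have 1: "weight (create a n (Y u ?s v)) = create a n (Y u ?s (weight v)) +
          create a n (Y (weight u) ?s v) + (of_nat m + of_int j) *\<^sub>C create a n (Y u ?s v)"
          by (simp add: weight_create create create_add create_diff create_scaleC algebra_simps scaleC_add_left
              cvs.scale_left_diff_distrib)
        have 2: "weight (Y u ?t (annihilate a n v)) = Y u ?t (annihilate a n (weight v)) +
          Y (weight u) ?t (annihilate a n v) + (of_nat m + of_int j) *\<^sub>C Y u ?t (annihilate a n v)"
          by (simp add: create weight_annihilate Y_diff Y_scaleC algebra_simps scaleC_add_left
              cvs.scale_left_diff_distrib)
        show ?case
          unfolding clinear_add[OF clinear_weight] clinear_scale[OF clinear_weight] 1 2
          by (simp add: scaleC_add_right scaleC_add_left algebra_simps)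
      qed
      then show ?case
        using elim by (simp add: weight_create Y_add_left Y_scaleC_left add.assoc)
    qed
  qed
next
  case (add u w)
  then show ?case
    by (simp add: Y_add_left clinear_add[OF clinear_weight] scaleC_add_right algebra_simps)
next
  case (scale c u)
  then show ?case
    by (simp add: Y_scaleC_left clinear_scale[OF clinear_weight] scaleC_add_right mult.commute)
qed

section \<open>The translation operator D and the creation property\<close>

definition translate :: "'a heis_module \<Rightarrow> 'a heis_module" where
  "translate = (SOME d. clinear d \<and> d 1 = 0 \<and>
     (\<forall>a k u. d (create a k u) = of_nat k *\<^sub>C create a (Suc k) u + create a k (d u)))"

lemma translate:
  shows clinear_translate: "clinear translate" and translate_1: "translate 1 = 0"
    and translate_create:
      "translate (create a k u) = of_nat k *\<^sub>C create a (Suc k) u + create a k (translate u)"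
  using someI_ex[OF create_derivation[of Suc], folded translate_def] by blast+

lemma translate_annihilate:
  "translate (annihilate a n u) = annihilate a n (translate u) - of_nat n *\<^sub>C annihilate a (n - 1) u"
proof (induction u rule: create_induct)
  case one
  then show ?case by (simp add: translate_1 clinear_zero[OF clinear_translate])
next
  case (create b k u)
  \<comment> \<open>For n = k + 1 a contraction arises on one side from D b(-k) = k b(-k-1), on the
    other from a(n-1); both coefficients are n (n-1) B(a,b). The subtraction n - 1 is truncated at n
    = 0, where the factor n makes this harmless.\<close>
  have "(if n = Suc k then of_nat k * (of_nat n * B a b) else 0) =
      of_nat n * (if n - 1 = k then of_nat (n - 1) * B a b else 0)"
    using create(1) by (cases n) auto
  then have "(if n = Suc k then (of_nat k * (of_nat n * B a b)) *\<^sub>C u else 0) =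
      of_nat n *\<^sub>C (if n - 1 = k then (of_nat (n - 1) * B a b) *\<^sub>C u else 0)"
    by (auto split: if_splits)
  with create show ?case
    by (auto simp: clinear_add[OF clinear_translate] clinear_scale[OF clinear_translate] clinear_zero[OF clinear_translate]
      annihilate_add annihilate_scaleC annihilate_create translate_create create_add create_scaleC create_diff
      scaleC_add_right cvs.scale_right_diff_distrib mult_ac split: if_splits)
next
  case (add u v)
  then show ?case
    by (simp add: annihilate_add clinear_add[OF clinear_translate] scaleC_add_right)
next
  case (scale c u)
  then show ?case
    by (simp add: annihilate_scaleC clinear_scale[OF clinear_translate] cvs.scale_right_diff_distrib mult.commute)
qed

text \<open>\<open>[D, a(n)] = -n a(n - 1)\<close> changes the mode, so the two sums agree only after shifting the
  summation index by one; the boundary terms vanish for large \<open>N\<close>.\<close>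

lemma translate_Y:
  "translate (Y u j v) = Y u j (translate v) + of_int (j + 1) *\<^sub>C Y u (j + 1) v"
proof (induction u arbitrary: j v rule: create_induct)
  case one
  show ?case
    by (cases "j = - 1") (auto simp: Y_1 clinear_zero[OF clinear_translate])
next
  case (create a m u)
  show ?case
  proof (rule eventually_eqI)
    show "\<forall>\<^sub>F N in sequentially. translate (Y (create a m u) j v) =
      Y (create a m u) j (translate v) + of_int (j + 1) *\<^sub>C Y (create a m u) (j + 1) v"
      using Y_create[OF create(1), of a u j v] Y_create[OF create(1), of a u j "translate v"]
        Y_create[OF create(1), of a u "j + 1" v] eventually_annihilate_0[of a v]
        Y_eventually_0[of u "j + int m" v]
    proof eventually_elim
      case (elim N)
      \<comment> \<open>\<open>f\<close> and \<open>g\<close> are the terms in which D changes a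
        creation or an annihilation mode, indexed by the new mode; \<open>h\<close> collects the
        derivatives from the induction hypothesis. Among the boundary terms, f 1 and g 0 vanish
        identically, f (N+1) and g N for large N.\<close>
      define f where "f n = (of_nat (n - 1) * field_coeff m (1 - int n)) *\<^sub>C create a n (Y u (j + 1 - int n + int m) v)" for n
      define g where "g n = (of_nat (n + 1) * field_coeff m (int n + 1)) *\<^sub>C Y u (j + 1 + int n + int m) (annihilate a n v)" for n
      define h where "h n = (field_coeff m (- int n) * of_int (j - int n + int m + 1)) *\<^sub>C create a n (Y u (j + 1 - int n + int m) v) +
        (field_coeff m (int n) * of_int (j + int n + int m + 1)) *\<^sub>C Y u (j + 1 + int n + int m) (annihilate a n v)" for n
      have f: "(\<Sum>n=1..N. f (Suc n)) = (\<Sum>n=1..N. f n)"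
        using elim(5) unfolding sum_shift_up by (simp add: f_def algebra_simps)
      have g: "(\<Sum>n=1..N. g (n - 1)) = (\<Sum>n=1..N. g n)"
        using elim(4) unfolding sum_shift_down by (simp add: g_def)
      have "translate (field_terms (Y u) a m j v N) = field_terms (Y u) a m j (translate v) N +
          (\<Sum>n=1..N. f (Suc n)) - (\<Sum>n=1..N. g (n - 1)) + (\<Sum>n=1..N. h n)"
        unfolding field_terms_def sum.distrib[symmetric] sum_subtractf[symmetric] clinear_sum[OF clinear_translate]
      proof (rule sum.cong, simp, goal_cases)
        case n: (1 n)
        let ?s = "j - int n + int m" and ?t = "j + int n + int m"
        have 1: "translate (create a n (Y u ?s v)) = create a n (Y u ?s (translate v)) +
          of_nat n *\<^sub>C create a (Suc n) (Y u ?s v) + of_int (?s + 1) *\<^sub>C create a n (Y u (?s + 1) v)"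
          by (simp only: translate_create create(2) create_add create_scaleC) (simp add: algebra_simps)
        have 2: "translate (Y u ?t (annihilate a n v)) = Y u ?t (annihilate a n (translate v)) -
          of_nat n *\<^sub>C Y u ?t (annihilate a (n - 1) v) + of_int (?t + 1) *\<^sub>C Y u (?t + 1) (annihilate a n v)"
          by (simp only: create(2) translate_annihilate Y_diff Y_scaleC)
        have f': "f (Suc n) = (field_coeff m (- int n) * of_nat n) *\<^sub>C create a (Suc n) (Y u ?s v)"
          by (simp add: f_def mult.commute)
        have g': "g (n - 1) = (field_coeff m (int n) * of_nat n) *\<^sub>C Y u ?t (annihilate a (n - 1) v)"
          using n by (simp add: g_def mult.commute of_nat_diff)
        have h': "h n = (field_coeff m (- int n) * of_int (?s + 1)) *\<^sub>C create a n (Y u (?s + 1) v) +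
            (field_coeff m (int n) * of_int (?t + 1)) *\<^sub>C Y u (?t + 1) (annihilate a n v)"
          by (simp add: h_def algebra_simps)
        show ?case
          unfolding clinear_add[OF clinear_translate] clinear_scale[OF clinear_translate] 1 2 f' g' h'
          by (simp add: scaleC_add_right cvs.scale_right_diff_distrib)
      qed
      also have "\<dots> = field_terms (Y u) a m j (translate v) N + (\<Sum>n=1..N. f n - g n + h n)"
        unfolding f g by (simp add: sum.distrib sum_subtractf)
      also have "(\<Sum>n=1..N. f n - g n + h n) = of_int (j + 1) *\<^sub>C field_terms (Y u) a m (j + 1) v N"
        unfolding field_terms_def scaleC_sum_right
      proof (rule sum.cong, simp, goal_cases)
        case (1 n)
        then have n: "n \<ge> 1" by simp
        have 1: "of_nat (n - 1) * field_coeff m (1 - int n) + field_coeff m (- int n) * of_int (j - int n + int m + 1)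
            = of_int (j + 1) * field_coeff m (- int n)"
          using field_coeff_shift[OF create(1), of "- int n"] n by (simp add: of_nat_diff algebra_simps)
        have 2: "field_coeff m (int n) * of_int (j + int n + int m + 1) - of_nat (n + 1) * field_coeff m (int n + 1)
            = of_int (j + 1) * field_coeff m (int n)"
          using field_coeff_shift[OF create(1), of "int n"] by (simp add: algebra_simps)
        have "f n - g n + h n =
            (of_nat (n - 1) * field_coeff m (1 - int n) + field_coeff m (- int n) * of_int (j - int n + int m + 1)) *\<^sub>C
              create a n (Y u (j + 1 - int n + int m) v) +
            (field_coeff m (int n) * of_int (j + int n + int m + 1) - of_nat (n + 1) * field_coeff m (int n + 1)) *\<^sub>C
              Y u (j + 1 + int n + int m) (annihilate a n v)"
          unfolding f_def g_def h_def scaleC_add_left cvs.scale_left_diff_distrib by (simp only: algebra_simps)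
        then show ?case
          unfolding 1 2 by (simp add: scaleC_add_right)
      qed
      finally show ?case
        using elim by simp
    qed
  qed
next
  case (add u w)
  then show ?case
    by (simp add: Y_add_left clinear_add[OF clinear_translate] scaleC_add_right algebra_simps)
next
  case (scale c u)
  then show ?case
    by (simp add: Y_scaleC_left clinear_scale[OF clinear_translate] scaleC_add_right mult.commute)
qed

lemma Y_translate: "Y (translate u) j v = of_int (j + 1) *\<^sub>C Y u (j + 1) v"
proof (induction u arbitrary: j v rule: create_induct)
  case one
  show ?case by (cases "j = - 1") (auto simp: Y_1 translate_1)
next
  case (create a m u)
  show ?case
  proof (rule eventually_eqI)
    have "Suc m \<ge> 1" by simp
    from Y_create[OF create(1), of a u "j + 1" v] Y_create[OF create(1), of a "translate u" j v]
        Y_create[OF this, of a u j v]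
    show "\<forall>\<^sub>F N in sequentially. Y (translate (create a m u)) j v =
      of_int (j + 1) *\<^sub>C Y (create a m u) (j + 1) v"
    proof eventually_elim
      case (elim N)
      have "of_nat m *\<^sub>C field_terms (Y u) a (Suc m) j v N + field_terms (Y (translate u)) a m j v N =
          of_int (j + 1) *\<^sub>C field_terms (Y u) a m (j + 1) v N"
        unfolding field_terms_def scaleC_sum_right sum.distrib[symmetric]
      proof (rule sum.cong, simp, goal_cases)
        case (1 n)
        let ?x = "create a n (Y u (j + 1 - int n + int m) v)"
          and ?y = "Y u (j + 1 + int n + int m) (annihilate a n v)"
        have 1: "of_nat m * field_coeff (Suc m) (- int n) + field_coeff m (- int n) * of_int (j + 1 - int n + int m) =
            of_int (j + 1) * field_coeff m (- int n)"
          using field_coeff_Suc[OF create(1), of "- int n"] by (simp add: algebra_simps)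
        have 2: "of_nat m * field_coeff (Suc m) (int n) + field_coeff m (int n) * of_int (j + 1 + int n + int m) =
            of_int (j + 1) * field_coeff m (int n)"
          using field_coeff_Suc[OF create(1), of "int n"] by (simp add: algebra_simps)
        have arg: "j - int n + int (Suc m) = j + 1 - int n + int m" "j + int n + int (Suc m) = j + 1 + int n + int m"
          "j - int n + int m + 1 = j + 1 - int n + int m" "j + int n + int m + 1 = j + 1 + int n + int m"
          by simp_all
        have "of_nat m *\<^sub>C (field_coeff (Suc m) (- int n) *\<^sub>C ?x + field_coeff (Suc m) (int n) *\<^sub>C ?y) +
          (field_coeff m (- int n) *\<^sub>C create a n (of_int (j + 1 - int n + int m) *\<^sub>C Y u (j + 1 - int n + int m) v) +
           field_coeff m (int n) *\<^sub>C of_int (j + 1 + int n + int m) *\<^sub>C ?y) =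
          (of_nat m * field_coeff (Suc m) (- int n) + field_coeff m (- int n) * of_int (j + 1 - int n + int m)) *\<^sub>C ?x +
          (of_nat m * field_coeff (Suc m) (int n) + field_coeff m (int n) * of_int (j + 1 + int n + int m)) *\<^sub>C ?y"
          by (simp only: create_scaleC scaleC_add_right scaleC_add_left scaleC_scaleC add_ac)
        then show ?case
          unfolding 1 2 create(2) arg by (simp add: scaleC_add_right)
      qed
      with elim show ?case
        by (simp add: translate_create Y_add_left Y_scaleC_left)
    qed
  qed
next
  case (add u w)
  then show ?case
    by (simp add: Y_add_left clinear_add[OF clinear_translate] scaleC_add_right)
next
  case (scale c u)
  then show ?case
    by (simp add: Y_scaleC_left clinear_scale[OF clinear_translate] mult.commute)
qed

text \<open>On the vacuum only creation terms remain. The terms n < m have coefficient 0, the terms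
  n > m have the negative exponent j - n + m and vanish by induction, and n = m has coefficient
  1.\<close>

lemma Y_creation: "j \<le> 0 \<Longrightarrow> Y u j 1 = (if j = 0 then u else 0)"
proof (induction u arbitrary: j rule: create_induct)
  case one
  then show ?case by (simp add: Y_1)
next
  case (create a m u)
  show ?case
  proof (rule eventually_eqI)
    show "\<forall>\<^sub>F N in sequentially. Y (create a m u) j 1 = (if j = 0 then create a m u else 0)"
      using Y_create[OF create(1), of a u j 1] eventually_ge_at_top[of m]
    proof eventually_elim
      case (elim N)
      have "field_terms (Y u) a m j 1 N = (\<Sum>n=1..N. if n = m then (if j = 0 then create a m u else 0) else 0)"
        unfolding field_terms_def
      proof (rule sum.cong, simp, goal_cases)
        case (1 n)
        then have n: "n \<ge> 1" by simp
        consider "n < m" | "n = m" | "n > m" by linarith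
        then have "field_coeff m (- int n) *\<^sub>C create a n (Y u (j - int n + int m) 1) =
            (if n = m then (if j = 0 then create a m u else 0) else 0)"
        proof cases
          case 1
          with n have "n - 1 < m - 1" by arith
          with 1 n show ?thesis by (simp add: field_coeff_neg)
        next
          case 2
          with n create.IH[of j] create.prems show ?thesis
            by (simp add: field_coeff_neg scaleC_one)
        next
          case 3
          with create.IH[of "j - int n + int m"] create.prems show ?thesis by simp
        qed
        then show ?case by simp
      qed
      with elim create(1) show ?case by (simp add: sum.delta)
    qed
  qed
qed (simp_all add: Y_add_left Y_scaleC_left)

lemma D_operator_eq_translate: "D_operator Y 1 = translate"
proof
  fix u
  have "Y u 1 1 = Y (translate u) 0 1" by (simp add: Y_translate scaleC_one)
  also have "\<dots> = translate u" by (simp add: Y_creation)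
  finally show "D_operator Y 1 u = translate u"
    by (simp add: D_operator_def series_deriv_def scaleC_one)
qed

end


section \<open>Summation of families\<close>

lemma has_sum_sum:
  fixes f :: "'i \<Rightarrow> 'x \<Rightarrow> 'b::{topological_comm_monoid_add}"
  assumes "\<And>i. i \<in> I \<Longrightarrow> (f i has_sum s i) A"
  shows "((\<lambda>x. \<Sum>i\<in>I. f i x) has_sum (\<Sum>i\<in>I. s i)) A"
  using assms
  by (induction I rule: infinite_finite_induct) (auto intro!: has_sum_add)

text \<open>The product of a numerical series with a Laurent series, where the monomial contained in
  the n-th number shifts the exponents; this is the bijection \<open>T n\<close>. Summability of
  complex families is absolute, so the double family is summable.\<close>

lemma has_sum_mult_convolution:
  fixes c :: "'i \<Rightarrow> complex" and F :: "'x \<Rightarrow> complex"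
  assumes c: "(c has_sum s) I" and F: "(F has_sum S) A" and T: "\<And>n. n \<in> I \<Longrightarrow> bij_betw (T n) A A"
  shows "((\<lambda>(n, x). c n * F (T n x)) has_sum s * S) (I \<times> A)"
proof -
  have abs: "(\<lambda>n. norm (c n)) summable_on I" "(\<lambda>y. norm (F y)) summable_on A"
    using c F has_sum_imp_summable summable_on_iff_abs_summable_on_complex by blast+
  have "(\<lambda>x. norm (case x of (n, y) \<Rightarrow> c n * F y)) summable_on (I \<times> A)"
  proof (subst Infinite_Sum.abs_summable_on_Sigma_iff, intro conjI ballI)
    show "(\<lambda>y. norm (case (n, y) of (n, y) \<Rightarrow> c n * F y)) summable_on A" for n
      using summable_on_cmult_right[OF abs(2)] by (simp add: norm_mult)
    have "infsum (\<lambda>y. norm (case (n, y) of (n, y) \<Rightarrow> c n * F y)) A = norm (c n) * infsum (\<lambda>y. norm (F y)) A" for n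
      by (simp add: norm_mult infsum_cmult_right')
    then show "(\<lambda>n. norm (infsum (\<lambda>y. norm (case (n, y) of (n, y) \<Rightarrow> c n * F y)) A)) summable_on I"
      using summable_on_cmult_left[OF abs(1), of "\<bar>infsum (\<lambda>y. norm (F y)) A\<bar>"] by (simp add: abs_mult)
  qed
  then have "(\<lambda>(n, y). c n * F y) summable_on (I \<times> A)"
    by (rule abs_summable_summable)
  then have sum: "((\<lambda>(n, y). c n * F y) has_sum s * S) (I \<times> A)"
    using has_sum_cmult_right[OF F] has_sum_cmult_left[OF c] by (intro has_sum_SigmaI) auto
  have bij: "bij_betw (\<lambda>(n, x). (n, T n x)) (I \<times> A) (I \<times> A)"
  proof (rule bij_betw_byWitness[where f' = "\<lambda>(n, y). (n, the_inv_into A (T n) y)"])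
    have inj: "inj_on (T n) A" and surj: "T n ` A = A" if "n \<in> I" for n
      using T[OF that] by (simp_all add: bij_betw_def)
    show "\<forall>p\<in>I \<times> A. (\<lambda>(n, y). (n, the_inv_into A (T n) y)) ((\<lambda>(n, x). (n, T n x)) p) = p"
      using the_inv_into_f_f[OF inj] by (simp add: split_beta)
    show "\<forall>p\<in>I \<times> A. (\<lambda>(n, x). (n, T n x)) ((\<lambda>(n, y). (n, the_inv_into A (T n) y)) p) = p"
      using f_the_inv_into_f[OF inj] surj by (simp add: split_beta)
    show "(\<lambda>(n, x). (n, T n x)) ` (I \<times> A) \<subseteq> I \<times> A"
    proof (rule image_subsetI)
      fix p assume "p \<in> I \<times> A"
      then show "(\<lambda>(n, x). (n, T n x)) p \<in> I \<times> A"
        using surj[of "fst p"] by (simp add: split_beta mem_Times_iff) (metis imageI)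
    qed
    show "(\<lambda>(n, y). (n, the_inv_into A (T n) y)) ` (I \<times> A) \<subseteq> I \<times> A"
    proof (rule image_subsetI)
      fix p assume "p \<in> I \<times> A"
      then show "(\<lambda>(n, y). (n, the_inv_into A (T n) y)) p \<in> I \<times> A"
        using the_inv_into_into[OF inj, of "fst p" "snd p" A] surj[of "fst p"]
        by (simp add: split_beta mem_Times_iff)
    qed
  qed
  show ?thesis
    using sum has_sum_reindex_bij_betw[OF bij, where f = "\<lambda>(n, y). c n * F y" and S = "s * S"]
    by (simp add: case_prod_unfold)
qed

lemma has_sum_fibres:
  fixes h :: "'i \<times> 'x \<Rightarrow> complex"
  assumes "(h has_sum S) (I \<times> A)" "\<And>x. x \<in> A \<Longrightarrow> ((\<lambda>n. h (n, x)) has_sum g x) I"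
  shows "(g has_sum S) A"
proof (rule has_sum_SigmaD[where f = "\<lambda>(x, n). h (n, x)" and B = "\<lambda>_. I"])
  show "((\<lambda>(x, n). h (n, x)) has_sum S) (A \<times> I)"
    using assms(1) by (subst has_sum_swap) (simp add: case_prod_unfold)
qed (use assms(2) in simp)

text \<open>The bridge from truncated identities to infinite sums: if the partial sums are constant
  for large N, all but finitely many terms are 0.\<close>

lemma has_sum_eventually:
  fixes t :: "nat \<Rightarrow> complex"
  assumes "\<forall>\<^sub>F N in sequentially. x = (\<Sum>n=1..N. t n)"
  shows "(t has_sum x) {1..}"
proof -
  obtain N where N: "\<And>n. n \<ge> N \<Longrightarrow> x = (\<Sum>n=1..n. t n)"
    using assms by (auto simp: eventually_sequentially)
  have "t n = 0" if n: "n > N" for n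
  proof -
    obtain k where k: "n = Suc k" "k \<ge> N"
      using n by (cases n) auto
    have "(\<Sum>i=1..Suc k. t i) = (\<Sum>i=1..k. t i)"
      using N[of k] N[of "Suc k"] k(2) by (metis le_SucI)
    then show ?thesis unfolding k(1) by simp
  qed
  then show ?thesis
    using N[OF order.refl] by (intro has_sum_finite_neutralI[of "{1..N}"]) auto
qed

section \<open>Binomial expansions of the coefficient functions\<close>

lemma powi_binomial_has_sum:
  fixes t :: complex
  assumes "norm t < 1"
  shows "((\<lambda>k. (of_int a gchoose k) * t ^ k) has_sum (1 + t) powi a) UNIV"
proof (rule norm_summable_imp_has_sum)
  \<comment> \<open>Convergence at the larger radius r < 1 gives absolute convergence at
    \<open>t\<close>.\<close>
  obtain r where r: "norm t < r" "r < 1"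
    using assms dense by blast
  have "r > 0" using r(1) norm_ge_zero[of t] by linarith
  have "summable (\<lambda>k. (of_int a gchoose k) * of_real r ^ k :: complex)"
    using gen_binomial_complex[of "of_real r" "of_int a"] r \<open>r > 0\<close> by (auto simp: sums_iff)
  from powser_insidea[OF this, of t] show "summable (\<lambda>k. norm ((of_int a gchoose k) * t ^ k))"
    using r \<open>r > 0\<close> by simp
  have "1 + t \<noteq> 0"
    using assms by (metis add_eq_0_iff norm_minus_cancel norm_one less_irrefl)
  then have "(1 + t) powr of_int a = (1 + t) powi a"
    by (simp add: powr_of_int power_int_def power_inverse)
  with gen_binomial_complex[OF assms, of "of_int a"]
  show "(\<lambda>k. (of_int a gchoose k) * t ^ k) sums (1 + t) powi a" by simp
qed

lemma has_sum_shift_index: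
  fixes f :: "nat \<Rightarrow> complex"
  assumes "(g has_sum s) UNIV" "\<And>k. f (k + m) = g k" "\<And>n. n \<ge> 1 \<Longrightarrow> n < m \<Longrightarrow> f n = 0" "m \<ge> 1"
  shows "(f has_sum s) {1..}"
proof -
  have "(f has_sum s) {m..} \<longleftrightarrow> (g has_sum s) UNIV"
    by (rule has_sum_reindex_bij_witness[of _ "\<lambda>k. k + m" "\<lambda>n. n - m"]) (auto simp: assms(2)[symmetric])
  moreover have "(f has_sum s) {m..} \<longleftrightarrow> (f has_sum s) {1..}"
    by (rule has_sum_cong_neutral) (use assms in auto)
  ultimately show ?thesis using assms(1) by simp
qed

text \<open>The Taylor expansion at w of c(m,n) (w+x)^(-n-m), the coefficient of a(n) in a divided
  derivative of a; the l-th term involves the (l-1)-st derivative. With l = k + m the coefficients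
  match by trinomial revision, and the terms l < m vanish. Iterates use it with w = z 1 and x = z 0
  - z 1.\<close>

lemma field_coeff_expansion_sum:
  fixes x w :: complex
  assumes xw: "norm x < norm w" "x \<noteq> 0" and m: "m \<ge> 1"
  shows "((\<lambda>l. field_coeff m (- int l) * field_coeff l n * x powi (int l - int m) * w powi (- n - int l))
    has_sum field_coeff m n * (w + x) powi (- n - int m)) {1..}"
proof (rule has_sum_shift_index[OF _ _ _ m])
  have w: "w \<noteq> 0" using xw by auto
  let ?a = "- n - int m" and ?t = "x / w"
  have t: "norm ?t < 1" using xw w by (simp add: norm_divide)
  have "((\<lambda>k. (field_coeff m n * w powi ?a) * ((of_int ?a gchoose k) * ?t ^ k)) has_sum
      (field_coeff m n * w powi ?a) * (1 + ?t) powi ?a) UNIV"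
    by (rule has_sum_cmult_right[OF powi_binomial_has_sum[OF t]])
  also have "(field_coeff m n * w powi ?a) * (1 + ?t) powi ?a = field_coeff m n * (w * (1 + ?t)) powi ?a"
    by (simp add: power_int_mult_distrib)
  also have "w * (1 + ?t) = w + x"
    using w by (simp add: field_simps)
  finally show "((\<lambda>k. (field_coeff m n * w powi ?a) * ((of_int ?a gchoose k) * ?t ^ k)) has_sum
      field_coeff m n * (w + x) powi ?a) UNIV" .
  fix k
  have "(of_int (- n - 1) gchoose (k + m - 1)) * (of_nat (k + m - 1) gchoose (m - 1)) =
      (of_int (- n - 1) gchoose (m - 1)) * ((of_int (- n - 1) - of_nat (m - 1) :: complex) gchoose (k + m - 1 - (m - 1)))"
    by (rule gbinomial_trinomial_revision) (use m in simp)
  moreover have "of_int (- n - 1) - of_nat (m - 1) = (of_int ?a :: complex)" "k + m - 1 - (m - 1) = k"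
    using m by (simp_all add: of_nat_diff)
  moreover have "field_coeff m (- int (k + m)) = of_nat (k + m - 1) gchoose (m - 1)"
    using m by (simp only: field_coeff_neg binomial_gbinomial)
  ultimately have coeff: "field_coeff m (- int (k + m)) * field_coeff (k + m) n = field_coeff m n * (of_int ?a gchoose k)"
    by (simp only: field_coeff_def mult.commute)
  have "w powi (- n - int (k + m)) = w powi ?a * w powi (- int k)"
    using w by (simp flip: power_int_add add: algebra_simps)
  then have "x powi (int (k + m) - int m) * w powi (- n - int (k + m)) = w powi ?a * ?t ^ k"
    by (simp add: power_int_minus power_divide field_simps)
  with coeff show "field_coeff m (- int (k + m)) * field_coeff (k + m) n * x powi (int (k + m) - int m) *
      w powi (- n - int (k + m)) = (field_coeff m n * w powi ?a) * ((of_int ?a gchoose k) * ?t ^ k)"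
    by (simp only: mult_ac)
next
  fix l assume "l \<ge> 1" "l < m"
  then have "l - 1 < m - 1" by arith
  with \<open>l \<ge> 1\<close> show "field_coeff m (- int l) * field_coeff l n * x powi (int l - int m) * w powi (- n - int l) = 0"
    by (simp add: field_coeff_neg)
qed

text \<open>The contraction of two fields expanded for |w| < |z|; this is where the poles at z = w
  come from. With n = k + q, negating the upper entries turns the generalized binomials into
  ordinary ones, which match by a product formula.\<close>

lemma contraction_has_sum:
  fixes z w :: complex
  assumes zw: "norm w < norm z" "w \<noteq> 0" and m: "m \<ge> 1" and q: "q \<ge> 1"
  shows "((\<lambda>n. field_coeff m (int n) * of_nat (n choose q) * z powi (- int n - int m) * w powi (int n - int q))
    has_sum field_coeff m (int q) * (z - w) powi (- int q - int m)) {1..}"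
proof (rule has_sum_shift_index[OF _ _ _ q])
  have z: "z \<noteq> 0" using zw by auto
  let ?a = "- int q - int m" and ?t = "- w / z"
  have t: "norm ?t < 1" using zw z by (simp add: norm_divide)
  have "((\<lambda>k. (field_coeff m (int q) * z powi ?a) * ((of_int ?a gchoose k) * ?t ^ k)) has_sum
      (field_coeff m (int q) * z powi ?a) * (1 + ?t) powi ?a) UNIV"
    by (rule has_sum_cmult_right[OF powi_binomial_has_sum[OF t]])
  also have "(field_coeff m (int q) * z powi ?a) * (1 + ?t) powi ?a = field_coeff m (int q) * (z * (1 + ?t)) powi ?a"
    by (simp add: power_int_mult_distrib)
  also have "z * (1 + ?t) = z - w"
    using z by (simp add: field_simps)
  finally show "((\<lambda>k. (field_coeff m (int q) * z powi ?a) * ((of_int ?a gchoose k) * ?t ^ k)) has_sum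
      field_coeff m (int q) * (z - w) powi ?a) UNIV" .
  fix k
  have neg: "field_coeff m (int n) = (- 1) ^ (m - 1) * of_nat ((n + m - 1) choose (m - 1))" for n
  proof -
    have "of_nat (m - 1) - (of_int (- int n - 1) :: complex) - 1 = of_nat (n + m - 1)"
      using m by (simp add: of_nat_diff)
    with gbinomial_negated_upper[of "of_int (- int n - 1) :: complex" "m - 1"] show ?thesis
      by (simp add: field_coeff_def binomial_gbinomial)
  qed
  have "of_nat k - (of_int ?a :: complex) - 1 = of_nat (k + q + m - 1)"
    using m by (simp add: of_nat_diff)
  with gbinomial_negated_upper[of "of_int ?a :: complex" k]
  have choose: "(of_int ?a gchoose k :: complex) = (- 1) ^ k * of_nat ((k + q + m - 1) choose k)"
    by (simp add: binomial_gbinomial)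
  have nat: "((k + q + m - 1) choose (m - 1)) * ((k + q) choose q) =
      ((q + m - 1) choose (m - 1)) * ((k + q + m - 1) choose k)"
    using choose_mult_lemma[of q "m - 1" k] binomial_symmetric[of "m - 1" "k + q + m - 1"]
      binomial_symmetric[of q "k + q"] binomial_symmetric[of "m - 1" "q + m - 1"] m
    by (simp add: algebra_simps)
  have coeff: "field_coeff m (int (k + q)) * of_nat ((k + q) choose q) =
      field_coeff m (int q) * ((of_int ?a gchoose k) * (- 1) ^ k)"
  proof -
    have one: "(- 1 :: complex) ^ k * (- 1) ^ k = 1"
      by (simp flip: power_mult_distrib)
    have "field_coeff m (int (k + q)) * of_nat ((k + q) choose q) =
        (- 1) ^ (m - 1) * of_nat (((k + q + m - 1) choose (m - 1)) * ((k + q) choose q))"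
      by (simp only: neg of_nat_mult mult.assoc)
    also have "\<dots> = (- 1) ^ (m - 1) * of_nat ((q + m - 1) choose (m - 1)) *
        of_nat ((k + q + m - 1) choose k) * ((- 1) ^ k * (- 1) ^ k)"
      by (simp only: nat one of_nat_mult mult.assoc mult_1_right)
    finally show ?thesis
      by (simp only: neg choose mult_ac)
  qed
  have "z powi (- int (k + q) - int m) = z powi ?a * z powi (- int k)"
    using z by (simp flip: power_int_add add: algebra_simps)
  then have "z powi (- int (k + q) - int m) * w powi (int (k + q) - int q) = z powi ?a * (w / z) ^ k"
    by (simp add: power_int_minus power_divide field_simps)
  moreover have "?t ^ k = (- 1) ^ k * (w / z) ^ k"
    by (simp flip: power_mult_distrib)
  ultimately show "field_coeff m (int (k + q)) * of_nat ((k + q) choose q) * z powi (- int (k + q) - int m) *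
      w powi (int (k + q) - int q) = (field_coeff m (int q) * z powi ?a) * ((of_int ?a gchoose k) * ?t ^ k)"
    using coeff by (simp only: mult_ac)
qed simp

section \<open>Rational functions\<close>

text \<open>The exponents \<open>\<alpha> i\<close> may repeat; equal ones are collected. Closure
  then needs no normal form: a sum uses the disjoint union of the index sets, a product their
  cartesian product.\<close>

lemma polynomial_function_family:
  assumes "finite I"
  shows "polynomial_function n (\<lambda>z. \<Sum>i\<in>I. c i * (\<Prod>k<n. z k ^ \<alpha> i k))"
proof -
  have "(\<Sum>i\<in>I. c i * (\<Prod>k<n. z k ^ \<alpha> i k)) =
      (\<Sum>\<beta>\<in>\<alpha> ` I. (\<Sum>i\<in>{i\<in>I. \<alpha> i = \<beta>}. c i) * (\<Prod>k<n. z k ^ \<beta> k))" for z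
    unfolding sum.image_gen[OF assms, of _ \<alpha>] sum_distrib_right
    by (intro sum.cong refl) auto
  then show ?thesis
    unfolding polynomial_function_def using assms by (intro exI[of _ "\<alpha> ` I"] exI conjI) auto
qed

lemma polynomial_function_const: "polynomial_function n (\<lambda>z. c)"
  using polynomial_function_family[of "{()}" n "\<lambda>_. c" "\<lambda>_ _. 0"] by simp

lemma polynomial_function_var: "i < n \<Longrightarrow> polynomial_function n (\<lambda>z. z i)"
  using polynomial_function_family[of "{()}" n "\<lambda>_. 1" "\<lambda>_ k. if k = i then 1 else 0"]
  by (simp add: if_distrib[of "(^) _"] prod.delta cong: if_cong)

lemma polynomial_function_add:
  assumes "polynomial_function n p" "polynomial_function n q"
  shows "polynomial_function n (\<lambda>z. p z + q z)"
proof -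
  obtain A c A' c' where "finite A" "p = (\<lambda>z. \<Sum>\<alpha>\<in>A. c \<alpha> * (\<Prod>i<n. z i ^ \<alpha> i))"
    "finite A'" "q = (\<lambda>z. \<Sum>\<alpha>\<in>A'. c' \<alpha> * (\<Prod>i<n. z i ^ \<alpha> i))"
    using assms unfolding polynomial_function_def by blast
  then show ?thesis
    using polynomial_function_family[of "A <+> A'" n "case_sum c c'" "case_sum id id"]
    by (simp add: sum.Plus)
qed

lemma polynomial_function_mult:
  assumes "polynomial_function n p" "polynomial_function n q"
  shows "polynomial_function n (\<lambda>z. p z * q z)"
proof -
  obtain A c A' c' where "finite A" "p = (\<lambda>z. \<Sum>\<alpha>\<in>A. c \<alpha> * (\<Prod>i<n. z i ^ \<alpha> i))"
    "finite A'" "q = (\<lambda>z. \<Sum>\<alpha>\<in>A'. c' \<alpha> * (\<Prod>i<n. z i ^ \<alpha> i))"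
    using assms unfolding polynomial_function_def by blast
  then show ?thesis
    using polynomial_function_family[of "A \<times> A'" n "\<lambda>(\<alpha>, \<beta>). c \<alpha> * c' \<beta>" "\<lambda>(\<alpha>, \<beta>) i. \<alpha> i + \<beta> i"]
    by (simp add: sum_product sum.cartesian_product case_prod_unfold power_add prod.distrib mult.assoc
        mult.left_commute)
qed

lemma polynomial_function_power: "polynomial_function n p \<Longrightarrow> polynomial_function n (\<lambda>z. p z ^ k)"
  by (induction k) (simp_all add: polynomial_function_const polynomial_function_mult)

lemma polynomial_function_shift:
  assumes "polynomial_function n p"
  shows "polynomial_function (Suc n) (\<lambda>z. p (\<lambda>i. z (Suc i)))"
proof -
  obtain A c where "finite A" "p = (\<lambda>z. \<Sum>\<alpha>\<in>A. c \<alpha> * (\<Prod>i<n. z i ^ \<alpha> i))"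
    using assms unfolding polynomial_function_def by blast
  then show ?thesis
    using polynomial_function_family[of A "Suc n" c "\<lambda>\<alpha>. case_nat 0 \<alpha>"]
    by (simp add: prod.lessThan_Suc_shift del: prod.lessThan_Suc)
qed

definition generic :: "nat \<Rightarrow> (nat \<Rightarrow> complex) set" where
  "generic n = {z. (\<forall>i<n. z i \<noteq> 0) \<and> (\<forall>i<n. \<forall>j<n. i \<noteq> j \<longrightarrow> z i \<noteq> z j)}"

text \<open>\<^const>\<open>rational_function\<close> is not closed under addition, because division by \<open>0\<close> gives \<open>0\<close> at the
  poles.  Equality at the generic points repairs this.\<close>

definition generically_rational :: "nat \<Rightarrow> ((nat \<Rightarrow> complex) \<Rightarrow> complex) \<Rightarrow> bool" where
  "generically_rational n f \<longleftrightarrow> (\<exists>p q. polynomial_function n p \<and> polynomial_function n q \<and>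
     (\<forall>z\<in>generic n. q z \<noteq> 0 \<and> f z = p z / q z))"

lemma generically_rationalD:
  "generically_rational n f \<Longrightarrow> \<exists>R. rational_function n R \<and> (\<forall>z\<in>generic n. f z = R z)"
  unfolding generically_rational_def rational_function_def generic_def by fast

lemma generically_rational_polynomial: "polynomial_function n p \<Longrightarrow> generically_rational n p"
  unfolding generically_rational_def
  by (intro exI[of _ p] exI[of _ "\<lambda>_. 1"]) (simp add: polynomial_function_const)

lemma generically_rational_const: "generically_rational n (\<lambda>z. c)"
  by (intro generically_rational_polynomial polynomial_function_const)

lemma generically_rational_add:
  assumes "generically_rational n f" "generically_rational n g"
  shows "generically_rational n (\<lambda>z. f z + g z)"
proof -
  obtain p q p' q' where *: "polynomial_function n p" "polynomial_function n q"
    "polynomial_function n p'" "polynomial_function n q'"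
    "\<forall>z\<in>generic n. q z \<noteq> 0 \<and> f z = p z / q z" "\<forall>z\<in>generic n. q' z \<noteq> 0 \<and> g z = p' z / q' z"
    using assms unfolding generically_rational_def by blast
  show ?thesis
    unfolding generically_rational_def
  proof (intro exI conjI)
    show "polynomial_function n (\<lambda>z. p z * q' z + p' z * q z)" "polynomial_function n (\<lambda>z. q z * q' z)"
      by (intro polynomial_function_add polynomial_function_mult *)+
  qed (use *(5,6) in \<open>auto simp: field_simps\<close>)
qed

lemma generically_rational_mult:
  assumes "generically_rational n f" "generically_rational n g"
  shows "generically_rational n (\<lambda>z. f z * g z)"
proof -
  obtain p q p' q' where *: "polynomial_function n p" "polynomial_function n q"
    "polynomial_function n p'" "polynomial_function n q'"
    "\<forall>z\<in>generic n. q z \<noteq> 0 \<and> f z = p z / q z" "\<forall>z\<in>generic n. q' z \<noteq> 0 \<and> g z = p' z / q' z"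
    using assms unfolding generically_rational_def by blast
  show ?thesis
    unfolding generically_rational_def
  proof (intro exI conjI)
    show "polynomial_function n (\<lambda>z. p z * p' z)" "polynomial_function n (\<lambda>z. q z * q' z)"
      by (intro polynomial_function_mult *)+
  qed (use *(5,6) in auto)
qed

lemma generically_rational_sum:
  "(\<And>i. i \<in> I \<Longrightarrow> generically_rational n (f i)) \<Longrightarrow> generically_rational n (\<lambda>z. \<Sum>i\<in>I. f i z)"
  by (induction I rule: infinite_finite_induct)
    (simp_all add: generically_rational_const generically_rational_add)

lemma generically_rational_powi:
  assumes "polynomial_function n p" "\<forall>z\<in>generic n. p z \<noteq> 0"
  shows "generically_rational n (\<lambda>z. p z powi k)"
proof (cases "k \<ge> 0")
  case True
  then show ?thesis
    using generically_rational_polynomial[OF polynomial_function_power[OF assms(1), of "nat k"]]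
    by (simp add: power_int_def)
next
  case False
  then show ?thesis
    unfolding generically_rational_def using assms
    by (intro exI[of _ "\<lambda>_. 1"] exI[of _ "\<lambda>z. p z ^ nat (- k)"])
      (auto simp: power_int_def polynomial_function_const polynomial_function_power field_simps)
qed

lemma generically_rational_var_powi: "i < n \<Longrightarrow> generically_rational n (\<lambda>z. z i powi k)"
  by (rule generically_rational_powi) (auto simp: polynomial_function_var generic_def)

lemma generically_rational_diff_powi:
  assumes "i < n" "j < n" "i \<noteq> j"
  shows "generically_rational n (\<lambda>z. (z i - z j) powi k)"
proof (rule generically_rational_powi)
  have "polynomial_function n (\<lambda>z. z i + (- 1) * z j)"
    by (intro polynomial_function_add polynomial_function_mult polynomial_function_const
        polynomial_function_var assms)
  then show "polynomial_function n (\<lambda>z. z i - z j)" by simp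
qed (use assms in \<open>auto simp: generic_def\<close>)

lemma generic_shift: "z \<in> generic (Suc n) \<Longrightarrow> (\<lambda>i. z (Suc i)) \<in> generic n"
  by (auto simp: generic_def)

lemma generically_rational_shift:
  assumes "generically_rational n f"
  shows "generically_rational (Suc n) (\<lambda>z. f (\<lambda>i. z (Suc i)))"
proof -
  obtain p q where "polynomial_function n p" "polynomial_function n q"
    "\<forall>z\<in>generic n. q z \<noteq> 0 \<and> f z = p z / q z"
    using assms unfolding generically_rational_def by blast
  then show ?thesis
    unfolding generically_rational_def
    by (intro exI[of _ "\<lambda>z. p (\<lambda>i. z (Suc i))"] exI[of _ "\<lambda>z. q (\<lambda>i. z (Suc i))"])
      (simp add: polynomial_function_shift generic_shift)
qed

section \<open>The regions of convergence avoid the poles\<close>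

lemma product_region_decreasing:
  assumes "z \<in> product_region n" "i < j" "j < n"
  shows "norm (z j) < norm (z i)"
  using assms(2,3)
proof (induction j)
  case (Suc j)
  have step: "norm (z (Suc j)) < norm (z j)"
    using assms(1) Suc.prems by (auto simp: product_region_def)
  show ?case
    using Suc step by (cases "i = j") auto
qed simp

lemma product_region_generic: "product_region n \<subseteq> generic n"
proof
  fix z assume z: "z \<in> product_region n"
  then have "z i \<noteq> 0" if "i < n" for i
    using that by (force simp: product_region_def)
  moreover have "z i \<noteq> z j" if "i < n" "j < n" "i \<noteq> j" for i j
    using product_region_decreasing[OF z] that by (metis less_irrefl linorder_neqE_nat)
  ultimately show "z \<in> generic n" by (simp add: generic_def)
qed

lemma iterate_region_generic: "iterate_region \<subseteq> generic 2"
proof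
  fix z assume "z \<in> iterate_region"
  then have "z 0 \<noteq> z 1" "z 1 \<noteq> 0" "z 0 \<noteq> 0"
    by (auto simp: iterate_region_def)
  then show "z \<in> generic 2"
    by (auto simp: generic_def less_2_cases_iff)
qed

lemma product_region_shift: "z \<in> product_region (Suc n) \<Longrightarrow> (\<lambda>i. z (Suc i)) \<in> product_region n"
  by (simp add: product_region_def)


section \<open>Products of vertex operators\<close>

lemma has_sum_minus:
  fixes f g :: "'x \<Rightarrow> complex"
  assumes "(f has_sum s) A" "(g has_sum t) A"
  shows "((\<lambda>x. f x - g x) has_sum s - t) A"
  using has_sum_add[OF assms(1), of "\<lambda>x. - g x" "- t"] assms(2) by (simp add: has_sum_uminus)

text \<open>The reindexing of a Laurent series that absorbs a factor
  \<open>y p powi d\<close>.\<close>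

definition shift_index :: "nat \<Rightarrow> int \<Rightarrow> int list \<Rightarrow> int list" where
  "shift_index p d js = js[p := js ! p + d]"

lemma shift_index_simps [simp]:
  "shift_index 0 d (j # js) = (j + d) # js"
  "shift_index (Suc p) d (j # js) = j # shift_index p d js"
  "length (shift_index p d js) = length js"
  by (simp_all add: shift_index_def)

lemma bij_shift_index:
  assumes "p < n"
  shows "bij_betw (shift_index p d) {js. length js = n} {js. length js = n}"
  by (rule bij_betw_byWitness[where f' = "shift_index p (- d)"])
    (use assms in \<open>auto simp: shift_index_def\<close>)

lemma prod_shift_index:
  assumes "p < n" "length js = n" "y p \<noteq> (0 :: complex)"
  shows "(\<Prod>i<n. y i powi (shift_index p d js ! i)) = (\<Prod>i<n. y i powi (js ! i)) * y p powi d"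
proof -
  have "(\<Prod>i\<in>{..<n} - {p}. y i powi (shift_index p d js ! i)) = (\<Prod>i\<in>{..<n} - {p}. y i powi (js ! i))"
    by (rule prod.cong) (auto simp: shift_index_def)
  then show ?thesis
    using assms by (simp add: prod.remove[of "{..<n}" p] shift_index_def power_int_add)
qed

context heisenberg
begin

lemma Y_create_functional:
  assumes \<phi>: "clinear \<phi>" and m: "m \<ge> 1"
  shows "((\<lambda>n. field_coeff m (- int n) * \<phi> (create a n (Y u (j - int n + int m) v)) +
      field_coeff m (int n) * \<phi> (Y u (j + int n + int m) (annihilate a n v)))
    has_sum \<phi> (Y (create a m u) j v)) {1..}"
proof (rule has_sum_eventually)
  show "\<forall>\<^sub>F N in sequentially. \<phi> (Y (create a m u) j v) =
    (\<Sum>n=1..N. field_coeff m (- int n) * \<phi> (create a n (Y u (j - int n + int m) v)) +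
      field_coeff m (int n) * \<phi> (Y u (j + int n + int m) (annihilate a n v)))"
    using Y_create[OF m, of a u j v]
    by eventually_elim
      (simp add: field_terms_def clinear_sum[OF \<phi>] clinear_add[OF \<phi>] clinear_scale[OF \<phi>])
qed

lemma graded_dual_clinear: "v' \<in> graded_dual V \<Longrightarrow> clinear v'"
  by (simp add: graded_dual_def)

text \<open>The recursion lets creation operators act on v', so the induction must stay inside the
  graded dual. The degrees on which the functional is nonzero only move down by k.\<close>

lemma graded_dual_create:
  assumes "v' \<in> graded_dual V"
  shows "(\<lambda>w. v' (create a k w)) \<in> graded_dual V"
proof -
  have "{n. \<exists>v\<in>V n. v' (create a k v) \<noteq> 0} \<subseteq> (\<lambda>n. n - int k) ` {n. \<exists>v\<in>V n. v' v \<noteq> 0}"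
  proof
    fix n assume "n \<in> {n. \<exists>v\<in>V n. v' (create a k v) \<noteq> 0}"
    then show "n \<in> (\<lambda>n. n - int k) ` {n. \<exists>v\<in>V n. v' v \<noteq> 0}"
      using create_in_grading by (intro image_eqI[of _ _ "n + int k"]) auto
  qed
  moreover have "finite ((\<lambda>n. n - int k) ` {n. \<exists>v\<in>V n. v' v \<noteq> 0})"
    using assms by (simp add: graded_dual_def)
  ultimately have "finite {n. \<exists>v\<in>V n. v' (create a k v) \<noteq> 0}"
    by (rule finite_subset)
  then show ?thesis
    using assms clinear_compose[OF _ clinear_create, of v' a k] by (simp add: graded_dual_def)
qed

text \<open>Degrees are nonnegative and a(-k) raises them by k, so for large k its image lies beyond
  the finitely many degrees seen by v'.\<close>

lemma graded_dual_create_0: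
  assumes "v' \<in> graded_dual V"
  shows "\<exists>K. \<forall>k>K. \<forall>a w. v' (create a k w) = 0"
proof -
  have lin: "clinear v'" using assms by (rule graded_dual_clinear)
  define S where "S = {n. \<exists>v\<in>V n. v' v \<noteq> 0}"
  have "finite S" using assms by (simp add: graded_dual_def S_def)
  define K where "K = (\<Sum>n\<in>S. nat \<bar>n\<bar>)"
  have "v' (create a k w) = 0" if k: "k > K" for a k w
  proof (induction w rule: homogeneous_induct)
    case (homogeneous n w)
    show ?case
    proof (rule ccontr)
      assume *: "v' (create a k w) \<noteq> 0"
      then have "n + int k \<in> S"
        using create_in_grading[OF homogeneous, of a k] by (auto simp: S_def)
      then have "nat \<bar>n + int k\<bar> \<le> K"
        unfolding K_def using \<open>finite S\<close> by (intro member_le_sum) auto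
      with k have "n < 0" by linarith
      from grading_negative[OF homogeneous this] * show False
        by (simp add: clinear_zero[OF lin])
    qed
  qed (simp add: create_add clinear_add[OF lin])
  then show ?thesis by blast
qed

section \<open>Correlation functions and their recursion\<close>

definition compose_Y :: "'a heis_module list \<Rightarrow> int list \<Rightarrow> 'a heis_module \<Rightarrow> 'a heis_module" where
  "compose_Y us js v = foldr (\<lambda>(u, j). Y u j) (zip us js) v"

lemma compose_Y_simps [simp]:
  "compose_Y [] [] v = v"
  "compose_Y (u # us) (j # js) v = Y u j (compose_Y us js v)"
  by (simp_all add: compose_Y_def)

lemma compose_Y_zero: "length js = length us \<Longrightarrow> compose_Y us js 0 = 0"
  by (induction js us rule: list_induct2) simp_all

lemma compose_Y_zero_factor:
  "length js = length us \<Longrightarrow> p < length us \<Longrightarrow> us ! p = 0 \<Longrightarrow> compose_Y us js v = 0"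
proof (induction js us arbitrary: p rule: list_induct2)
  case (Cons j js u us)
  then show ?case by (cases p) auto
qed simp

lemma product_term_eq:
  "product_term Y v' us v z js = v' (compose_Y us js v) * (\<Prod>i<length us. z i powi (js ! i))"
  by (simp add: product_term_def compose_Y_def)

lemma product_term_Cons:
  "product_term Y v' (u # us) v z (j # js) =
    v' (Y u j (compose_Y us js v)) * (z 0 powi j * (\<Prod>i<length us. z (Suc i) powi (js ! i)))"
  by (simp add: product_term_eq prod.lessThan_Suc_shift del: prod.lessThan_Suc)

lemma annihilate_compose_Y:
  "length js = length us \<Longrightarrow>
    annihilate a n (compose_Y us js v) = compose_Y us js (annihilate a n v) +
    (\<Sum>p<length us. \<Sum>q=1..n. of_nat (n choose q) *\<^sub>C
      compose_Y (us[p := annihilate a q (us ! p)]) (shift_index p (int q - int n) js) v)"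
proof (induction js us rule: list_induct2)
  case (Cons j js u us)
  then show ?case
    by (simp add: annihilate_Y Y_add Y_sum Y_scaleC sum.lessThan_Suc_shift algebra_simps
        del: sum.lessThan_Suc)
qed simp

text \<open>Rationality and summation are carried by one witness f, so that the recursion yields
  both; generic rationality is the version closed under sums.\<close>

definition correlator :: "('a heis_module \<Rightarrow> complex) \<Rightarrow> 'a heis_module list \<Rightarrow> 'a heis_module \<Rightarrow>
    ((nat \<Rightarrow> complex) \<Rightarrow> complex) \<Rightarrow> bool" where
  "correlator v' us v f \<longleftrightarrow> generically_rational (length us) f \<and>
    (\<forall>z\<in>product_region (length us). (product_term Y v' us v z has_sum f z) (product_indices us))"

text \<open>The value of the correlation function with \<open>a(-m)u\<close> in the first place, in terms of correlation
  functions with \<open>u\<close> in the first place: the creation operators in \<open>a(x)\<close> act on \<open>v'\<close> (\<open>f1\<close>), the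
  annihilation operators on \<open>v\<close> (\<open>f2\<close>) and on the remaining vectors (\<open>f3\<close>).\<close>

definition correlator_recursion :: "nat \<Rightarrow> nat \<Rightarrow> nat \<Rightarrow> nat \<Rightarrow> nat \<Rightarrow> (nat \<Rightarrow> (nat \<Rightarrow> complex) \<Rightarrow> complex) \<Rightarrow>
    (nat \<Rightarrow> (nat \<Rightarrow> complex) \<Rightarrow> complex) \<Rightarrow> (nat \<Rightarrow> nat \<Rightarrow> (nat \<Rightarrow> complex) \<Rightarrow> complex) \<Rightarrow>
    (nat \<Rightarrow> complex) \<Rightarrow> complex" where
  "correlator_recursion l m K M Q f1 f2 f3 z =
    (\<Sum>k=1..K. field_coeff m (- int k) * z 0 powi (int k - int m) * f1 k z) +
    (\<Sum>n=1..M. field_coeff m (int n) * z 0 powi (- int n - int m) * f2 n z) +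
    (\<Sum>p<l. \<Sum>q=1..Q. field_coeff m (int q) * (z 0 - z (Suc p)) powi (- int q - int m) * f3 p q z)"

lemma has_sum_neutral_from:
  fixes f :: "nat \<Rightarrow> complex"
  assumes "\<And>n. n > K \<Longrightarrow> f n = 0"
  shows "(f has_sum (\<Sum>n=1..K. f n)) {1..}"
  by (rule has_sum_finite_neutralI[of "{1..K}"]) (use assms in auto)

text \<open>The terms up to K and M are finite combinations of shifted product series. The
  commutator terms form, for each p and q, a family over modes n and exponents. Summed over all
  pairs it factors into \<open>contraction_has_sum\<close> times a correlation function; summed over
  n first it gives what remains of the product series after the other terms are removed.\<close>

lemma product_step:
  assumes v': "v' \<in> graded_dual V" and m: "m \<ge> 1"
    and K: "\<And>k w. k > K \<Longrightarrow> v' (create a k w) = 0"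
    and M: "\<And>n. n > M \<Longrightarrow> annihilate a n v = 0"
    and Q: "\<And>p q. p < length us \<Longrightarrow> q > Q \<Longrightarrow> annihilate a q (us ! p) = 0"
    and f1: "\<And>k. correlator (\<lambda>w. v' (create a k w)) (u # us) v (f1 k)"
    and f2: "\<And>n. correlator v' (u # us) (annihilate a n v) (f2 n)"
    and f3: "\<And>p q. p < length us \<Longrightarrow> correlator v' (u # us[p := annihilate a q (us ! p)]) v (f3 p q)"
  shows "correlator v' (create a m u # us) v (correlator_recursion (length us) m K M Q f1 f2 f3)"
  unfolding correlator_def
proof (intro conjI ballI)
  let ?l = "length us"
  have rat: "generically_rational (Suc ?l) (f1 k)" "generically_rational (Suc ?l) (f2 k)"
    "p < ?l \<Longrightarrow> generically_rational (Suc ?l) (f3 p k)" for k p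
    using f1 f2 f3 by (simp_all add: correlator_def)
  show "generically_rational (length (create a m u # us)) (correlator_recursion ?l m K M Q f1 f2 f3)"
    unfolding correlator_recursion_def length_Cons
    by (intro generically_rational_add generically_rational_sum generically_rational_mult
        generically_rational_const generically_rational_var_powi generically_rational_diff_powi rat) auto
  fix z assume z: "z \<in> product_region (length (create a m u # us))"
  let ?L = "product_indices (create a m u # us)" and ?PT = "\<lambda>v' us v. product_term Y v' us v z"
  have L: "?L = {js. length js = Suc ?l}" "product_indices (u # us) = ?L"
    "product_indices (u # us[p := w]) = ?L" for p w
    by (simp_all add: product_indices_def)
  have z0: "z 0 \<noteq> 0" and zp: "z (Suc p) \<noteq> 0" "norm (z (Suc p)) < norm (z 0)" if "p < ?l" for p
    using product_region_decreasing[OF z, of 0 "Suc p"] z that by (force simp: product_region_def)+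
  have z0: "z 0 \<noteq> 0" using z by (force simp: product_region_def)
  \<comment> \<open>Each family is a series of the induction hypothesis times powers of the
    variables, reindexed by the exponents of the new product: \<open>h1\<close> for creation on v',
    \<open>h2\<close> for annihilation of v, \<open>h3\<close> for the commutator with the p-th
    remaining factor, where the mode n still varies.\<close>
  define h1 where "h1 k js = field_coeff m (- int k) * z 0 powi (int k - int m) *
    ?PT (\<lambda>w. v' (create a k w)) (u # us) v (shift_index 0 (int m - int k) js)" for k js
  define h2 where "h2 n js = field_coeff m (int n) * z 0 powi (- int n - int m) *
    ?PT v' (u # us) (annihilate a n v) (shift_index 0 (int n + int m) js)" for n js
  define h3 where "h3 p q n js = (field_coeff m (int n) * of_nat (n choose q) * z 0 powi (- int n - int m) *
      z (Suc p) powi (int n - int q)) * ?PT v' (u # us[p := annihilate a q (us ! p)]) v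
      (shift_index 0 (int n + int m) (shift_index (Suc p) (int q - int n) js))" for p q n js
  have bij0: "bij_betw (shift_index 0 d) ?L ?L" and bijS: "p < ?l \<Longrightarrow> bij_betw (shift_index (Suc p) d) ?L ?L" for d p
    unfolding L(1) by (rule bij_shift_index; simp)+
  have S1: "(h1 k has_sum field_coeff m (- int k) * z 0 powi (int k - int m) * f1 k z) ?L" for k
    unfolding h1_def using f1[of k] z
    by (intro has_sum_cmult_right) (simp add: has_sum_reindex_bij_betw[OF bij0] correlator_def L(2))
  have S2: "(h2 n has_sum field_coeff m (int n) * z 0 powi (- int n - int m) * f2 n z) ?L" for n
    unfolding h2_def using f2[of n] z
    by (intro has_sum_cmult_right) (simp add: has_sum_reindex_bij_betw[OF bij0] correlator_def L(2))
  have S3: "((\<lambda>(n, js). h3 p q n js) has_sum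
      field_coeff m (int q) * (z 0 - z (Suc p)) powi (- int q - int m) * f3 p q z) ({1..} \<times> ?L)"
    if p: "p < ?l" and q: "q \<ge> 1" for p q
    unfolding h3_def
  proof (rule has_sum_mult_convolution)
    show "((\<lambda>n. field_coeff m (int n) * of_nat (n choose q) * z 0 powi (- int n - int m) *
        z (Suc p) powi (int n - int q)) has_sum field_coeff m (int q) * (z 0 - z (Suc p)) powi (- int q - int m)) {1..}"
      by (rule contraction_has_sum) (use zp[OF p] m q in auto)
    show "(?PT v' (u # us[p := annihilate a q (us ! p)]) v has_sum f3 p q z) ?L"
      using f3[OF p, of q] z by (simp add: correlator_def L(3))
    show "bij_betw (\<lambda>js. shift_index 0 (int n + int m) (shift_index (Suc p) (int q - int n) js)) ?L ?L" for n
      using bij_betw_trans[OF bijS[OF p] bij0] by (simp add: comp_def)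
  qed
  have pointwise: "((\<lambda>n. \<Sum>p<?l. \<Sum>q=1..Q. h3 p q n js) has_sum
      ?PT v' (create a m u # us) v js - (\<Sum>k=1..K. h1 k js) - (\<Sum>n=1..M. h2 n js)) {1..}"
    if mem: "js \<in> ?L" for js
  proof -
    obtain j js' where js: "js = j # js'" "length js' = ?l"
      using mem unfolding L(1) by (auto simp: length_Suc_conv)
    note lin = graded_dual_clinear[OF v']
    define t where "t = compose_Y us js' v"
    define P where "P = (\<Prod>i<?l. z (Suc i) powi (js' ! i))"
    have z0_split: "z 0 powi i * z 0 powi k = z 0 powi j" if "i + k = j" for i k
      using z0 that by (simp flip: power_int_add)
    have h1: "h1 k js = field_coeff m (- int k) * v' (create a k (Y u (j - int k + int m) t)) * (z 0 powi j * P)" for k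
      using z0_split[of "int k - int m" "j + (int m - int k)"]
      by (simp add: h1_def js product_term_Cons t_def P_def algebra_simps)
    have h2: "h2 n js = field_coeff m (int n) *
        v' (Y u (j + int n + int m) (compose_Y us js' (annihilate a n v))) * (z 0 powi j * P)" for n
      using z0_split[of "- int n - int m" "j + (int n + int m)"]
      by (simp add: h2_def js product_term_Cons P_def algebra_simps)
    define X where "X n p q = v' (Y u (j + int n + int m)
        (compose_Y (us[p := annihilate a q (us ! p)]) (shift_index p (int q - int n) js') v))" for n p q
    have h3: "h3 p q n js = field_coeff m (int n) * (of_nat (n choose q) * X n p q) * (z 0 powi j * P)"
      if p: "p < ?l" for p q n
    proof -
      let ?P = "\<Prod>i<?l. z (Suc i) powi (shift_index p (int q - int n) js' ! i)"
      have "?P = P * z (Suc p) powi (int q - int n)"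
        unfolding P_def using prod_shift_index[OF p js(2), of "\<lambda>i. z (Suc i)"] zp[OF p] by simp
      moreover have "z (Suc p) powi (int n - int q) * z (Suc p) powi (int q - int n) = 1"
        using zp[OF p] by (simp flip: power_int_add)
      ultimately have "z (Suc p) powi (int n - int q) * ?P = P"
        by (simp add: mult.left_commute)
      then have "z 0 powi (- int n - int m) * z (Suc p) powi (int n - int q) *
          (z 0 powi (j + (int n + int m)) * ?P) =
          z 0 powi j * P"
        using z0_split[of "- int n - int m" "j + (int n + int m)"] by (simp add: mult_ac)
      moreover have "h3 p q n js = field_coeff m (int n) * (of_nat (n choose q) * X n p q) *
          (z 0 powi (- int n - int m) * z (Suc p) powi (int n - int q) *
          (z 0 powi (j + (int n + int m)) * ?P))"
        by (simp add: h3_def js product_term_Cons X_def add.assoc mult_ac)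
      ultimately show ?thesis by simp
    qed
    \<comment> \<open>The commutator sum runs up to n. A bound independent of n is possible: for q >
      n the binomial is 0, for q > Q the p-th vector is killed.\<close>
    have X: "(\<Sum>q=1..n. of_nat (n choose q) * X n p q) = (\<Sum>q=1..Q. of_nat (n choose q) * X n p q)"
      if p: "p < ?l" for n p
    proof (rule sum.mono_neutral_cong)
      fix q assume "q \<in> {1..n} - {1..Q}"
      then have "annihilate a q (us ! p) = 0" using Q p by auto
      then have "compose_Y (us[p := annihilate a q (us ! p)]) (shift_index p (int q - int n) js') v = 0"
        using p js(2) by (intro compose_Y_zero_factor[of _ _ p]) auto
      then show "of_nat (n choose q) * X n p q = 0"
        by (simp add: X_def clinear_zero[OF lin])
    qed auto
    have terms: "(field_coeff m (- int n) * v' (create a n (Y u (j - int n + int m) t)) +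
        field_coeff m (int n) * v' (Y u (j + int n + int m) (annihilate a n t))) * (z 0 powi j * P) - h1 n js - h2 n js =
        (\<Sum>p<?l. \<Sum>q=1..Q. h3 p q n js)" for n
    proof -
      have "v' (Y u (j + int n + int m) (annihilate a n t)) =
          v' (Y u (j + int n + int m) (compose_Y us js' (annihilate a n v))) +
          (\<Sum>p<?l. \<Sum>q=1..n. of_nat (n choose q) * X n p q)"
        by (simp add: t_def annihilate_compose_Y[OF js(2)] Y_add Y_sum Y_scaleC clinear_add[OF lin]
            clinear_sum[OF lin] clinear_scale[OF lin] X_def)
      also have "(\<Sum>p<?l. \<Sum>q=1..n. of_nat (n choose q) * X n p q) =
          (\<Sum>p<?l. \<Sum>q=1..Q. of_nat (n choose q) * X n p q)"
        by (rule sum.cong) (use X in auto)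
      finally show ?thesis
        by (simp add: h1 h2 h3 sum_distrib_left sum_distrib_right algebra_simps)
    qed
    have "((\<lambda>n. (field_coeff m (- int n) * v' (create a n (Y u (j - int n + int m) t)) +
        field_coeff m (int n) * v' (Y u (j + int n + int m) (annihilate a n t))) * (z 0 powi j * P) - h1 n js - h2 n js)
      has_sum v' (Y (create a m u) j t) * (z 0 powi j * P) - (\<Sum>k=1..K. h1 k js) - (\<Sum>n=1..M. h2 n js)) {1..}"
    proof (intro has_sum_minus has_sum_cmult_left Y_create_functional lin m has_sum_neutral_from)
      show "h1 n js = 0" if "n > K" for n
        using K[OF that] by (simp add: h1)
      show "h2 n js = 0" if "n > M" for n
        using M[OF that] by (simp add: h2 compose_Y_zero[OF js(2)] clinear_zero[OF lin])
    qed
    then show ?thesis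
      unfolding terms by (simp add: js product_term_Cons t_def P_def)
  qed
  have rest: "((\<lambda>js. ?PT v' (create a m u # us) v js - (\<Sum>k=1..K. h1 k js) - (\<Sum>n=1..M. h2 n js)) has_sum
      (\<Sum>p<?l. \<Sum>q=1..Q. field_coeff m (int q) * (z 0 - z (Suc p)) powi (- int q - int m) * f3 p q z)) ?L"
  proof (rule has_sum_fibres[where h = "\<lambda>x. \<Sum>p<?l. \<Sum>q=1..Q. (\<lambda>(n, js). h3 p q n js) x"])
    show "((\<lambda>x. \<Sum>p<?l. \<Sum>q=1..Q. (\<lambda>(n, js). h3 p q n js) x) has_sum
      (\<Sum>p<?l. \<Sum>q=1..Q. field_coeff m (int q) * (z 0 - z (Suc p)) powi (- int q - int m) * f3 p q z)) ({1..} \<times> ?L)"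
      by (intro has_sum_sum S3) auto
  qed (use pointwise in simp)
  have "((\<lambda>js. (\<Sum>k=1..K. h1 k js) + (\<Sum>n=1..M. h2 n js)) has_sum
      (\<Sum>k=1..K. field_coeff m (- int k) * z 0 powi (int k - int m) * f1 k z) +
      (\<Sum>n=1..M. field_coeff m (int n) * z 0 powi (- int n - int m) * f2 n z)) ?L"
    by (intro has_sum_add has_sum_sum S1 S2)
  from has_sum_add[OF this rest] have "((\<lambda>js. (\<Sum>k=1..K. h1 k js) + (\<Sum>n=1..M. h2 n js) +
      (?PT v' (create a m u # us) v js - (\<Sum>k=1..K. h1 k js) - (\<Sum>n=1..M. h2 n js))) has_sum
      correlator_recursion ?l m K M Q f1 f2 f3 z) ?L"
    unfolding correlator_recursion_def .
  then
  show "(?PT v' (create a m u # us) v has_sum correlator_recursion ?l m K M Q f1 f2 f3 z) ?L"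
    by simp
qed

text \<open>The identity operator contributes only the exponent 0, so the remaining variables just
  move up one place.\<close>

lemma correlator_one:
  assumes "clinear v'" "correlator v' us v f"
  shows "correlator v' (1 # us) v (\<lambda>z. f (\<lambda>i. z (Suc i)))"
  unfolding correlator_def
proof (intro conjI ballI)
  show "generically_rational (length (1 # us)) (\<lambda>z. f (\<lambda>i. z (Suc i)))"
    using assms generically_rational_shift by (simp add: correlator_def)
  fix z assume "z \<in> product_region (length (1 # us))"
  then have *: "(product_term Y v' us v (\<lambda>i. z (Suc i)) has_sum f (\<lambda>i. z (Suc i))) (product_indices us)"
    using assms product_region_shift by (simp add: correlator_def)
  have "(product_term Y v' (1 # us) v z has_sum f (\<lambda>i. z (Suc i))) ((#) 0 ` product_indices us)"
  proof (subst has_sum_reindex)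
    show "(product_term Y v' (1 # us) v z \<circ> (#) 0 has_sum f (\<lambda>i. z (Suc i))) (product_indices us)"
    proof -
      have "product_term Y v' (1 # us) v z (0 # js) = product_term Y v' us v (\<lambda>i. z (Suc i)) js" for js
        unfolding product_term_Cons by (simp add: Y_1 product_term_eq)
      with * show ?thesis by (simp add: comp_def)
    qed
  qed simp
  also have "?this \<longleftrightarrow> (product_term Y v' (1 # us) v z has_sum f (\<lambda>i. z (Suc i))) (product_indices (1 # us))"
  proof (rule has_sum_cong_neutral)
    fix js assume js: "js \<in> product_indices (1 # us) - (#) 0 ` product_indices us"
    then obtain j js' where "js = j # js'" "j \<noteq> 0"
      by (auto simp: product_indices_def length_Suc_conv)
    then show "product_term Y v' (1 # us) v z js = 0"
      using clinear_zero[OF assms(1)] by (simp add: product_term_Cons Y_1)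
  qed (auto simp: product_indices_def)
  finally show "(product_term Y v' (1 # us) v z has_sum f (\<lambda>i. z (Suc i))) (product_indices (1 # us))" .
qed


lemma correlator_linear:
  assumes lin: "clinear v'" and fg: "correlator v' (u # us) v f" "correlator v' (w # us) v g"
  shows "correlator v' ((c *\<^sub>C u + d *\<^sub>C w) # us) v (\<lambda>z. c * f z + d * g z)"
  unfolding correlator_def
proof (intro conjI ballI)
  let ?u = "c *\<^sub>C u + d *\<^sub>C w"
  show "generically_rational (length (?u # us)) (\<lambda>z. c * f z + d * g z)"
    using fg by (simp add: correlator_def generically_rational_add generically_rational_mult
        generically_rational_const)
  fix z assume "z \<in> product_region (length (?u # us))"
  then have "((\<lambda>js. c * product_term Y v' (u # us) v z js + d * product_term Y v' (w # us) v z js)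
      has_sum c * f z + d * g z) (product_indices (?u # us))"
    using fg by (intro has_sum_add has_sum_cmult_right) (simp_all add: correlator_def product_indices_def)
  also have "?this \<longleftrightarrow>
      (product_term Y v' (?u # us) v z has_sum c * f z + d * g z) (product_indices (?u # us))"
  proof (rule has_sum_cong)
    fix js assume "js \<in> product_indices (?u # us)"
    then obtain j js' where "js = j # js'"
      by (auto simp: product_indices_def length_Suc_conv)
    then show "c * product_term Y v' (u # us) v z js + d * product_term Y v' (w # us) v z js =
        product_term Y v' (?u # us) v z js"
      by (simp add: product_term_Cons Y_add_left Y_scaleC_left clinear_add[OF lin]
          clinear_scale[OF lin] distrib_right)
  qed
  finally show "(product_term Y v' (?u # us) v z has_sum c * f z + d * g z) (product_indices (?u # us))" .
qed

lemma correlator_add: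
  "clinear v' \<Longrightarrow> correlator v' (u # us) v f \<Longrightarrow> correlator v' (w # us) v g \<Longrightarrow>
    correlator v' ((u + w) # us) v (\<lambda>z. f z + g z)"
  using correlator_linear[of v' u us v f w g 1 1] by (simp add: scaleC_one)

lemma correlator_scale:
  "clinear v' \<Longrightarrow> correlator v' (u # us) v f \<Longrightarrow>
    correlator v' ((c *\<^sub>C u) # us) v (\<lambda>z. c * f z)"
  using correlator_linear[of v' u us v f u f c 0] by simp

lemma correlator_Nil: "correlator v' [] v (\<lambda>z. v' v)"
  unfolding correlator_def
  by (auto simp: generically_rational_const product_indices_def product_term_eq intro!: has_sum_finiteI)

lemma annihilate_bound: "\<exists>Q. \<forall>p<length us. \<forall>q>Q. \<forall>a. annihilate a q (us ! p) = 0"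
proof -
  obtain N where N: "\<And>u n a. n > N u \<Longrightarrow> annihilate a n u = 0"
    using annihilate_eventually_0 by metis
  show ?thesis
  proof (intro exI allI impI)
    fix p q a assume "p < length us" "(\<Sum>p<length us. N (us ! p)) < q"
    moreover from this(1) have "N (us ! p) \<le> (\<Sum>p<length us. N (us ! p))"
      by (intro member_le_sum) auto
    ultimately show "annihilate a q (us ! p) = 0"
      by (intro N) linarith
  qed
qed

text \<open>The outer induction on the length serves the case of first vector 1. The inner one, on
  the first vector, keeps v', v and the remaining vectors arbitrary, since the recursion changes all
  of them but not their number.\<close>

lemma correlator_exists: "v' \<in> graded_dual V \<Longrightarrow> \<exists>f. correlator v' us v f"
proof (induction us arbitrary: v' v rule: length_induct)
  case (1 us)
  show ?case
  proof (cases us)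
    case Nil
    then show ?thesis using correlator_Nil by blast
  next
    case (Cons u us')
    have IH: "\<exists>f. correlator v' ws v f" if "length ws = length us'" "v' \<in> graded_dual V" for ws v v'
      using 1(1) that Cons by auto
    have "\<exists>f. correlator v' (u # ws) v f" if "length ws = length us'" "v' \<in> graded_dual V" for ws v v'
      using that
    proof (induction u arbitrary: ws v v' rule: create_induct)
      case one
      then show ?case
        using IH correlator_one graded_dual_clinear by blast
    next
      case (create a m u)
      obtain K where K: "\<forall>k>K. \<forall>a w. v' (create a k w) = 0"
        using graded_dual_create_0[OF create.prems(2)] by blast
      obtain M where M: "\<forall>n>M. \<forall>a. annihilate a n v = 0"
        using annihilate_eventually_0 by blast
      obtain Q where Q: "\<forall>p<length ws. \<forall>q>Q. \<forall>a. annihilate a q (ws ! p) = 0"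
        using annihilate_bound by blast
      have "\<forall>k. \<exists>f. correlator (\<lambda>w. v' (create a k w)) (u # ws) v f"
        using create.IH[OF create.prems(1) graded_dual_create[OF create.prems(2)]] by blast
      then obtain f1 where f1: "\<And>k. correlator (\<lambda>w. v' (create a k w)) (u # ws) v (f1 k)" by metis
      have "\<forall>n. \<exists>f. correlator v' (u # ws) (annihilate a n v) f"
        using create.IH[OF create.prems] by blast
      then obtain f2 where f2: "\<And>n. correlator v' (u # ws) (annihilate a n v) (f2 n)" by metis
      have "\<forall>p q. \<exists>f. correlator v' (u # ws[p := annihilate a q (ws ! p)]) v f"
        using create.IH[OF _ create.prems(2)] create.prems(1) by simp
      then obtain f3 where f3: "\<And>p q. correlator v' (u # ws[p := annihilate a q (ws ! p)]) v (f3 p q)" by metis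
      show ?case
        using product_step[OF create.prems(2) create.hyps, of K a M v ws Q u f1 f2 f3] K M Q f1 f2 f3 by blast
    next
      case (add u w)
      then show ?case
        using correlator_add graded_dual_clinear by meson
    next
      case (scale c u)
      then show ?case
        using correlator_scale graded_dual_clinear by meson
    qed
    with Cons 1(2) show ?thesis by simp
  qed
qed

section \<open>Iterates of vertex operators\<close>

text \<open>One function for both series: its existence contains the rationality of the iterate as
  well as associativity.\<close>

definition assoc_correlator :: "('a heis_module \<Rightarrow> complex) \<Rightarrow> 'a heis_module \<Rightarrow> 'a heis_module \<Rightarrow>
    'a heis_module \<Rightarrow> ((nat \<Rightarrow> complex) \<Rightarrow> complex) \<Rightarrow> bool" where
  "assoc_correlator v' u1 u2 v f \<longleftrightarrow> correlator v' [u1, u2] v f \<and>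
    (\<forall>z\<in>iterate_region. (iterate_term Y v' u1 u2 v z has_sum f z) UNIV)"

lemma iterate_term_eq:
  "iterate_term Y v' u1 u2 v z (i, j) = v' (Y (Y u1 i u2) j v) * ((z 0 - z 1) powi i * z 1 powi j)"
  by (simp add: iterate_term_def)

text \<open>Paired with v', both sums of the recursion have bounds independent of u, m and j. The
  iterate needs this because there m is a running index l, and the truncation in
  \<open>Y_create\<close> may depend on it.\<close>

lemma Y_create_finite:
  assumes lin: "clinear v'" and m: "m \<ge> 1"
    and K: "\<And>k w. k > K \<Longrightarrow> v' (create a k w) = 0"
    and M: "\<And>n. n > M \<Longrightarrow> annihilate a n v = 0"
  shows "v' (Y (create a m u) j v) =
    (\<Sum>k=1..K. field_coeff m (- int k) * v' (create a k (Y u (j - int k + int m) v))) +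
    (\<Sum>n=1..M. field_coeff m (int n) * v' (Y u (j + int n + int m) (annihilate a n v)))"
proof (rule has_sum_unique[OF Y_create_functional[OF lin m]], rule has_sum_add; rule has_sum_neutral_from)
  show "field_coeff m (- int n) * v' (create a n (Y u (j - int n + int m) v)) = 0" if "n > K" for n
    using K[OF that] by simp
  show "field_coeff m (int n) * v' (Y u (j + int n + int m) (annihilate a n v)) = 0" if "n > M" for n
    using M[OF that] by (simp add: clinear_zero[OF lin])
qed

lemma bij_shift_pair: "bij_betw (\<lambda>(i, j). (i + c, j + d)) (UNIV :: (int \<times> int) set) UNIV"
  by (rule bij_betw_byWitness[where f' = "\<lambda>(i, j). (i - c, j - d)"]) auto

text \<open>The inner recursion for Y(a(-m)u, x)u_2 yields creation modes a(-l), to which the outer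
  recursion applies, and annihilation of u_2. Summing the former over l resums the Taylor expansion
  of powers of z 0 around z 1; the latter already carries the powers of z 0 - z 1. The result is the
  recursion of the product with one remaining vector.\<close>

lemma iterate_step:
  assumes v': "v' \<in> graded_dual V" and m: "m \<ge> 1"
    and K: "\<And>k w. k > K \<Longrightarrow> v' (create a k w) = 0"
    and M: "\<And>n. n > M \<Longrightarrow> annihilate a n v = 0"
    and Q: "\<And>q. q > Q \<Longrightarrow> annihilate a q u2 = 0"
    and f1: "\<And>k. assoc_correlator (\<lambda>w. v' (create a k w)) u u2 v (f1 k)"
    and f2: "\<And>n. assoc_correlator v' u u2 (annihilate a n v) (f2 n)"
    and f3: "\<And>q. assoc_correlator v' u (annihilate a q u2) v (f3 q)"
  shows "assoc_correlator v' (create a m u) u2 v (correlator_recursion 1 m K M Q f1 f2 (\<lambda>_. f3))"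
  unfolding assoc_correlator_def
proof (intro conjI ballI)
  have "correlator v' (create a m u # [u2]) v (correlator_recursion (length [u2]) m K M Q f1 f2 (\<lambda>_. f3))"
    by (rule product_step[OF v' m K M]) (use f1 f2 f3 Q in \<open>auto simp: assoc_correlator_def\<close>)
  then show "correlator v' [create a m u, u2] v (correlator_recursion 1 m K M Q f1 f2 (\<lambda>_. f3))" by simp
  fix z assume z: "z \<in> iterate_region"
  define x w where "x = z 0 - z 1" and "w = z 1"
  have xw: "norm x < norm w" "x \<noteq> 0" "w \<noteq> 0" "w + x = z 0"
    using z by (auto simp: iterate_region_def x_def w_def)
  note lin = graded_dual_clinear[OF v']
  let ?IT = "\<lambda>v' u1 u2 v. iterate_term Y v' u1 u2 v z"
  have IT: "?IT v' u1 u2 v (i, j) = v' (Y (Y u1 i u2) j v) * (x powi i * w powi j)" for v' u1 u2 v i j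
    by (simp add: iterate_term_eq x_def w_def)
  \<comment> \<open>Powers are again absorbed into exponents, now those of x and w. The inner
    creation mode l is the summation index, while k and n are the outer modes.\<close>
  define h1 where "h1 k l ij = (field_coeff m (- int l) * field_coeff l (- int k) * x powi (int l - int m) *
      w powi (- (- int k) - int l)) * ?IT (\<lambda>w. v' (create a k w)) u u2 v
      ((\<lambda>(i, j). (i + (int m - int l), j + (int l - int k))) ij)" for k l ij
  define h2 where "h2 n l ij = (field_coeff m (- int l) * field_coeff l (int n) * x powi (int l - int m) *
      w powi (- int n - int l)) * ?IT v' u u2 (annihilate a n v)
      ((\<lambda>(i, j). (i + (int m - int l), j + (int n + int l))) ij)" for n l ij
  define h3 where "h3 q ij = (field_coeff m (int q) * x powi (- int q - int m)) *
      ?IT v' u (annihilate a q u2) v ((\<lambda>(i, j). (i + (int q + int m), j + 0)) ij)" for q ij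
  have S1: "((\<lambda>(l, ij). h1 k l ij) has_sum field_coeff m (- int k) * z 0 powi (int k - int m) * f1 k z) ({1..} \<times> UNIV)" for k
    unfolding h1_def
  proof (rule has_sum_mult_convolution[OF _ _ bij_shift_pair])
    show "((\<lambda>l. field_coeff m (- int l) * field_coeff l (- int k) * x powi (int l - int m) *
      w powi (- (- int k) - int l)) has_sum field_coeff m (- int k) * z 0 powi (int k - int m)) {1..}"
      using field_coeff_expansion_sum[OF xw(1,2) m, of "- int k"] by (simp add: xw(4))
    show "(?IT (\<lambda>w. v' (create a k w)) u u2 v has_sum f1 k z) UNIV"
      using f1[of k] z by (simp add: assoc_correlator_def)
  qed
  have S2: "((\<lambda>(l, ij). h2 n l ij) has_sum field_coeff m (int n) * z 0 powi (- int n - int m) * f2 n z) ({1..} \<times> UNIV)" for n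
    unfolding h2_def
  proof (rule has_sum_mult_convolution[OF _ _ bij_shift_pair])
    show "((\<lambda>l. field_coeff m (- int l) * field_coeff l (int n) * x powi (int l - int m) *
      w powi (- int n - int l)) has_sum field_coeff m (int n) * z 0 powi (- int n - int m)) {1..}"
      using field_coeff_expansion_sum[OF xw(1,2) m, of "int n"] by (simp add: xw(4))
    show "(?IT v' u u2 (annihilate a n v) has_sum f2 n z) UNIV"
      using f2[of n] z by (simp add: assoc_correlator_def)
  qed
  have S3: "(h3 q has_sum field_coeff m (int q) * (z 0 - z 1) powi (- int q - int m) * f3 q z) UNIV" for q
    unfolding h3_def x_def using f3[of q] z
    by (intro has_sum_cmult_right, subst has_sum_reindex_bij_betw[OF bij_shift_pair])
      (simp add: assoc_correlator_def)
  have pointwise: "((\<lambda>l. (\<Sum>k=1..K. h1 k l ij) + (\<Sum>n=1..M. h2 n l ij)) has_sum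
      ?IT v' (create a m u) u2 v ij - (\<Sum>q=1..Q. h3 q ij)) {1..}" for ij
  proof -
    obtain i j where ij: "ij = (i, j)" by (cases ij)
    define \<phi> where "\<phi> s = v' (Y s j v)" for s
    have \<phi>: "clinear \<phi>"
      unfolding \<phi>_def by (rule clinear_compose[OF lin clinear_Y_left])
    define W where "W = x powi i * w powi j"
    define s where "s l = Y u (i - int l + int m) u2" for l
    have split: "x powi k * x powi k' = x powi i" if "k + k' = i" for k k'
      using xw that by (simp flip: power_int_add)
    have split': "w powi k * w powi k' = w powi j" if "k + k' = j" for k k'
      using xw that by (simp flip: power_int_add)
    have h1: "h1 k l ij = field_coeff m (- int l) * (field_coeff l (- int k) *
        v' (create a k (Y (s l) (j - int k + int l) v))) * W" for k l
    proof -
      have "x powi (int l - int m) * x powi (i + (int m - int l)) * (w powi (- (- int k) - int l) * w powi (j + (int l - int k))) = W"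
        (is "?M = W")
        unfolding W_def by (subst split, simp, subst split', simp_all)
      moreover have "h1 k l ij = field_coeff m (- int l) * (field_coeff l (- int k) *
        v' (create a k (Y (s l) (j - int k + int l) v))) *
        ?M"
        by (simp add: h1_def ij IT s_def algebra_simps)
      ultimately show ?thesis by simp
    qed
    have h2: "h2 n l ij = field_coeff m (- int l) * (field_coeff l (int n) *
        v' (Y (s l) (j + int n + int l) (annihilate a n v))) * W" for n l
    proof -
      have "x powi (int l - int m) * x powi (i + (int m - int l)) * (w powi (- int n - int l) * w powi (j + (int n + int l))) = W"
        (is "?M = W")
        unfolding W_def by (subst split, simp, subst split', simp_all)
      moreover have "h2 n l ij = field_coeff m (- int l) * (field_coeff l (int n) *
        v' (Y (s l) (j + int n + int l) (annihilate a n v))) *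
        ?M"
        by (simp add: h2_def ij IT s_def algebra_simps)
      ultimately show ?thesis by simp
    qed
    have h3: "h3 q ij = field_coeff m (int q) * \<phi> (Y u (i + int q + int m) (annihilate a q u2)) * W" for q
    proof -
      have "x powi (- int q - int m) * x powi (i + (int q + int m)) * w powi j = W"
        unfolding W_def by (subst split) simp_all
      moreover have "h3 q ij = field_coeff m (int q) * \<phi> (Y u (i + int q + int m) (annihilate a q u2)) *
          (x powi (- int q - int m) * x powi (i + (int q + int m)) * w powi j)"
        by (simp add: h3_def ij IT \<phi>_def algebra_simps)
      ultimately show ?thesis by simp
    qed
    have total: "((\<lambda>l. (field_coeff m (- int l) * \<phi> (create a l (s l)) +
        field_coeff m (int l) * \<phi> (Y u (i + int l + int m) (annihilate a l u2))) * W - h3 l ij)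
      has_sum \<phi> (Y (create a m u) i u2) * W - (\<Sum>q=1..Q. h3 q ij)) {1..}"
      unfolding s_def
    proof (intro has_sum_minus has_sum_cmult_left Y_create_functional \<phi> m has_sum_neutral_from)
      show "h3 q ij = 0" if "q > Q" for q
        using Q[OF that] by (simp add: h3 clinear_zero[OF \<phi>])
    qed
    have "(field_coeff m (- int l) * \<phi> (create a l (s l)) +
        field_coeff m (int l) * \<phi> (Y u (i + int l + int m) (annihilate a l u2))) * W - h3 l ij =
        (\<Sum>k=1..K. h1 k l ij) + (\<Sum>n=1..M. h2 n l ij)" if "l \<in> {1..}" for l
    proof -
      have "\<phi> (create a l (s l)) =
        (\<Sum>k=1..K. field_coeff l (- int k) * v' (create a k (Y (s l) (j - int k + int l) v))) +
        (\<Sum>n=1..M. field_coeff l (int n) * v' (Y (s l) (j + int n + int l) (annihilate a n v)))"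
        unfolding \<phi>_def using that by (intro Y_create_finite lin K M) auto
      then show ?thesis
        by (simp add: h1 h2 h3 sum_distrib_left sum_distrib_right algebra_simps)
    qed
    from has_sum_cong[OF this, THEN iffD1, OF _ total] have
      "((\<lambda>l. (\<Sum>k=1..K. h1 k l ij) + (\<Sum>n=1..M. h2 n l ij)) has_sum
        \<phi> (Y (create a m u) i u2) * W - (\<Sum>q=1..Q. h3 q ij)) {1..}"
      by simp
    then show ?thesis
      by (simp add: ij IT \<phi>_def W_def)
  qed
  have "((\<lambda>ij. ?IT v' (create a m u) u2 v ij - (\<Sum>q=1..Q. h3 q ij)) has_sum
      (\<Sum>k=1..K. field_coeff m (- int k) * z 0 powi (int k - int m) * f1 k z) +
      (\<Sum>n=1..M. field_coeff m (int n) * z 0 powi (- int n - int m) * f2 n z)) UNIV"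
  proof (rule has_sum_fibres[where h = "\<lambda>y. (\<Sum>k=1..K. (\<lambda>(l, ij). h1 k l ij) y) + (\<Sum>n=1..M. (\<lambda>(l, ij). h2 n l ij) y)"])
    show "((\<lambda>y. (\<Sum>k=1..K. (\<lambda>(l, ij). h1 k l ij) y) + (\<Sum>n=1..M. (\<lambda>(l, ij). h2 n l ij) y)) has_sum
      (\<Sum>k=1..K. field_coeff m (- int k) * z 0 powi (int k - int m) * f1 k z) +
      (\<Sum>n=1..M. field_coeff m (int n) * z 0 powi (- int n - int m) * f2 n z)) ({1..} \<times> UNIV)"
      by (intro has_sum_add has_sum_sum S1 S2)
  qed (use pointwise in simp)
  moreover have "((\<lambda>ij. \<Sum>q=1..Q. h3 q ij) has_sum
      (\<Sum>q=1..Q. field_coeff m (int q) * (z 0 - z 1) powi (- int q - int m) * f3 q z)) UNIV"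
    by (intro has_sum_sum S3)
  ultimately have "((\<lambda>ij. (?IT v' (create a m u) u2 v ij - (\<Sum>q=1..Q. h3 q ij)) + (\<Sum>q=1..Q. h3 q ij)) has_sum
      (\<Sum>k=1..K. field_coeff m (- int k) * z 0 powi (int k - int m) * f1 k z) +
      (\<Sum>n=1..M. field_coeff m (int n) * z 0 powi (- int n - int m) * f2 n z) +
      (\<Sum>q=1..Q. field_coeff m (int q) * (z 0 - z 1) powi (- int q - int m) * f3 q z)) UNIV"
    by (rule has_sum_add)
  then
  show "(?IT v' (create a m u) u2 v has_sum correlator_recursion 1 m K M Q f1 f2 (\<lambda>_. f3) z) UNIV"
    by (simp add: correlator_recursion_def)
qed

lemma assoc_correlator_exists:
  "v' \<in> graded_dual V \<Longrightarrow> \<exists>f. assoc_correlator v' u1 u2 v f"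
proof (induction u1 arbitrary: u2 v v' rule: create_induct)
  case one
  obtain f where f: "correlator v' [u2] v f"
    using correlator_exists[OF one] by blast
  \<comment> \<open>With first vector 1 the inner series is \<open>u2\<close> at exponent 0, so the
    iterate is the series of a single vertex operator at z 1.\<close>
  have "(iterate_term Y v' 1 u2 v z has_sum f (\<lambda>i. z (Suc i))) UNIV" if z: "z \<in> iterate_region" for z
  proof -
    have "(\<lambda>i. z (Suc i)) \<in> product_region 1"
      using z by (auto simp: product_region_def iterate_region_def)
    then have "(product_term Y v' [u2] v (\<lambda>i. z (Suc i)) has_sum f (\<lambda>i. z (Suc i))) (product_indices [u2])"
      using f by (simp add: correlator_def)
    also have "?this \<longleftrightarrow> (iterate_term Y v' 1 u2 v z has_sum f (\<lambda>i. z (Suc i))) ({0} \<times> UNIV)"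
      by (rule has_sum_reindex_bij_witness[of _ "\<lambda>(i, j). [j]" "\<lambda>js. (0, hd js)"])
        (auto simp: product_indices_def length_Suc_conv product_term_Cons iterate_term_eq Y_1)
    also have "\<dots> \<longleftrightarrow> (iterate_term Y v' 1 u2 v z has_sum f (\<lambda>i. z (Suc i))) UNIV"
      by (rule has_sum_cong_neutral)
        (auto simp: iterate_term_eq Y_1 clinear_zero[OF graded_dual_clinear[OF one]] split: if_splits)
    finally show ?thesis .
  qed
  with correlator_one[OF graded_dual_clinear[OF one] f] show ?case
    unfolding assoc_correlator_def by blast
next
  case (create a m u)
  obtain K where K: "\<forall>k>K. \<forall>a w. v' (create a k w) = 0"
    using graded_dual_create_0[OF create.prems] by blast
  obtain M where M: "\<forall>n>M. \<forall>a. annihilate a n v = 0"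
    using annihilate_eventually_0 by blast
  obtain Q where Q: "\<forall>q>Q. \<forall>a. annihilate a q u2 = 0"
    using annihilate_eventually_0 by blast
  have "\<forall>k. \<exists>f. assoc_correlator (\<lambda>w. v' (create a k w)) u u2 v f"
    using create.IH[OF graded_dual_create[OF create.prems]] by blast
  then obtain f1 where f1: "\<And>k. assoc_correlator (\<lambda>w. v' (create a k w)) u u2 v (f1 k)" by metis
  have "\<forall>n. \<exists>f. assoc_correlator v' u u2 (annihilate a n v) f"
    using create.IH[OF create.prems] by blast
  then obtain f2 where f2: "\<And>n. assoc_correlator v' u u2 (annihilate a n v) (f2 n)" by metis
  have "\<forall>q. \<exists>f. assoc_correlator v' u (annihilate a q u2) v f"
    using create.IH[OF create.prems] by blast
  then obtain f3 where f3: "\<And>q. assoc_correlator v' u (annihilate a q u2) v (f3 q)" by metis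
  show ?case
    using iterate_step[OF create.prems create.hyps, of K a M v Q u2 u f1 f2 f3] K M Q f1 f2 f3 by blast
next
  case (add u w)
  obtain f g where fg: "assoc_correlator v' u u2 v f" "assoc_correlator v' w u2 v g"
    using add.IH[OF add.prems] by blast
  note lin = graded_dual_clinear[OF add.prems]
  have "iterate_term Y v' (u + w) u2 v z = (\<lambda>ij. iterate_term Y v' u u2 v z ij + iterate_term Y v' w u2 v z ij)" for z
    by (rule ext) (auto simp: iterate_term_eq Y_add_left clinear_add[OF lin] distrib_right)
  with fg correlator_add[OF lin, of u "[u2]" v f w g]
  have "assoc_correlator v' (u + w) u2 v (\<lambda>z. f z + g z)"
    by (auto simp: assoc_correlator_def intro!: has_sum_add)
  then show ?case by blast
next
  case (scale c u)
  obtain f where f: "assoc_correlator v' u u2 v f"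
    using scale.IH[OF scale.prems] by blast
  note lin = graded_dual_clinear[OF scale.prems]
  have "iterate_term Y v' (c *\<^sub>C u) u2 v z = (\<lambda>ij. c * iterate_term Y v' u u2 v z ij)" for z
    by (rule ext) (auto simp: iterate_term_eq Y_scaleC_left clinear_scale[OF lin])
  with f correlator_scale[OF lin, of u "[u2]" v f c]
  have "assoc_correlator v' (c *\<^sub>C u) u2 v (\<lambda>z. c * f z)"
    by (auto simp: assoc_correlator_def intro!: has_sum_cmult_right)
  then show ?case by blast
qed

section \<open>Verification of the axioms\<close>

lemma has_sum_imp_abs_summable:
  "(f has_sum s) A \<Longrightarrow> (\<lambda>x. norm (f x :: complex)) summable_on A"
  using has_sum_imp_summable summable_on_iff_abs_summable_on_complex by blast

theorem heisenberg_vertex_algebra: "meromorphic_open_string_vertex_algebra V Y 1"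
proof (rule meromorphic_open_string_vertex_algebra.intro)
  show "graded_space V" by (rule graded_space_grading)
  show "clinear (\<lambda>u. Y u j v)" for j v by (rule clinear_Y_left)
  show "clinear (Y u j)" for u j by (rule clinear_Y)
  show "\<exists>N. \<forall>n<N. V n = {0}"
    using grading_negative by (intro exI[of _ 0]) auto
  show "Y 1 j v = (if j = 0 then v else 0)" for j v by (rule Y_1)
  show "Y u j 1 = 0" if "j < 0" for u j
    using that by (simp add: Y_creation)
  show "Y u 0 1 = u" for u by (simp add: Y_creation)
next
  fix v' us v assume v': "v' \<in> graded_dual V"
  obtain f where f: "correlator v' us v f"
    using correlator_exists[OF v'] by blast
  then obtain R where R: "rational_function (length us) R" "\<forall>z\<in>generic (length us). f z = R z"
    using generically_rationalD unfolding correlator_def by blast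
  have "(product_term Y v' us v z has_sum R z) (product_indices us)" if "z \<in> product_region (length us)" for z
  proof -
    have "f z = R z" using R(2) that product_region_generic by blast
    with f that show ?thesis unfolding correlator_def by metis
  qed
  with R(1) show "\<exists>R. rational_function (length us) R \<and> (\<forall>z\<in>product_region (length us).
      (\<lambda>js. norm (product_term Y v' us v z js)) summable_on product_indices us \<and>
      (product_term Y v' us v z has_sum R z) (product_indices us))"
    using has_sum_imp_abs_summable by blast
next
  fix v' u1 u2 v assume v': "v' \<in> graded_dual V"
  obtain f where f: "assoc_correlator v' u1 u2 v f"
    using assoc_correlator_exists[OF v'] by blast
  then have "generically_rational 2 f"
    by (simp add: correlator_def assoc_correlator_def numeral_2_eq_2)
  then obtain R where R: "rational_function 2 R" "\<forall>z\<in>generic 2. f z = R z"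
    using generically_rationalD by blast
  have "(iterate_term Y v' u1 u2 v z has_sum R z) UNIV" if "z \<in> iterate_region" for z
  proof -
    have "f z = R z" using R(2) that iterate_region_generic by blast
    with f that show ?thesis unfolding assoc_correlator_def by metis
  qed
  with R(1) show "\<exists>R. rational_function 2 R \<and> (\<forall>z\<in>iterate_region.
      (\<lambda>ij. norm (iterate_term Y v' u1 u2 v z ij)) summable_on UNIV \<and>
      (iterate_term Y v' u1 u2 v z has_sum R z) UNIV)"
    using has_sum_imp_abs_summable by blast
  fix z assume "z \<in> product_region 2" "z \<in> iterate_region"
  with f have "infsum (product_term Y v' [u1, u2] v z) (product_indices [u1, u2]) = f z"
    "infsum (iterate_term Y v' u1 u2 v z) UNIV = f z"
    by (auto simp: assoc_correlator_def correlator_def numeral_2_eq_2 intro!: infsumI)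
  then show "infsum (product_term Y v' [u1, u2] v z) (product_indices [u1, u2]) =
      infsum (iterate_term Y v' u1 u2 v z) UNIV" by simp
next
  show "grading_operator V (Y u j v) - Y u j (grading_operator V v) =
      Y (grading_operator V u) j v + series_deriv (Y u) (j - 1) v" for u j v
    by (simp add: grading_operator_eq_weight weight_Y series_deriv_def)
  show "series_deriv (Y u) j v = Y (D_operator Y 1 u) j v" for u j v
    by (simp add: D_operator_eq_translate Y_translate series_deriv_def)
  show "series_deriv (Y u) j v = D_operator Y 1 (Y u j v) - Y u j (D_operator Y 1 v)" for u j v
    by (simp add: D_operator_eq_translate translate_Y series_deriv_def)
qed

end

theorem theorem5p1:
  fixes B :: "'a::complex_vector \<Rightarrow> 'a \<Rightarrow> complex"
  assumes "bilinear_form B" and "nondegenerate B"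
  shows "meromorphic_open_string_vertex_algebra (heis_grading B) (heis_Y B) 1 \<and>
    (finite_dimensional (UNIV :: 'a set) \<longrightarrow>
      grading_restricted_meromorphic_open_string_vertex_algebra (heis_grading B) (heis_Y B) 1)"
proof -
  interpret heisenberg B
    by unfold_locales (rule assms(1))
  show ?thesis
    using heisenberg_vertex_algebra grading_finite_dimensional
    by (simp add: grading_restricted_meromorphic_open_string_vertex_algebra_def
        grading_restricted_meromorphic_open_string_vertex_algebra_axioms_def)
qed

end
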